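(* Let $n\ge 2$ be an integer, let $p>n$ be real, and let $\beta$ be a real number with $$\beta<-\frac13+\frac{2}{3(p-1)}+\sqrt{\left(-\frac13+\frac{2}{3(p-1)}\right)^2+\frac13}.$$ Then there is a constant $C_1=C_1(\beta,p,n)$, depending only on $\beta,p,n$, such that the following holds. If $u:\mathbb{R}^n\to\mathbb{R}$ is an extremal of Morrey's inequality satisfying (1) $-\Delta_p u=c\,(\delta_{e_n}-\delta_{-e_n})$ in $\mathbb{R}^n$ for some constant $c>0$; (2) $|u|\le 1$ in $\mathbb{R}^n$, $u(e_n)=1$ and $u(-e_n)=-1$; (3) $u$ is antisymmetric with respect to the $x_n$-variable; (4) $u$ is positive in $\mathbb{R}^n\cap\{x_n>0\}$; then $$|u(x)|\le C_1|x|^{-\beta}\quad\text{for all } |x|\ge 1.$$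
   Context: Morrey's inequality: for $p>n$ there is a constant $C>0$ such that $$[u]_{C^{0,1-\frac np}(\mathbb{R}^n)}:=\sup_{x\ne y}\frac{|u(x)-u(y)|}{|x-y|^{1-\frac np}}\le C\left(\int_{\mathbb{R}^n}|\nabla u|^p\,dx\right)^{1/p}$$ for all functions $u$ on $\mathbb{R}^n$ whose (weak) first order partial derivatives belong to $L^p(\mathbb{R}^n)$, where $u$ is identified with its continuous representative. Let $C(p,n)$ denote the smallest such constant. An extremal is a function $u$ with first order partial derivatives in $L^p(\mathbb{R}^n)$ for which equality holds with $C=C(p,n)$. The $p$-Laplace operator is $\Delta_p u=\nabla\cdot(|\nabla u|^{p-2}\nabla u)$, understood in the weak sense. Thus (1) means $\int_{\mathbb{R}^n}|\nabla u|^{p-2}\nabla u\cdot\nabla\varphi\,dx=c\,(\varphi(e_n)-\varphi(-e_n))$ for all $\varphi\in C_c^\infty(\mathbb{R}^n)$. Here $e_n=(0,\dots,0,1)$ and $\delta_y$ is the Dirac mass at $y$. Antisymmetric with respect to the $x_n$-variable means $u(x_1,\dots,x_{n-1},-x_n)=-u(x_1,\dots,x_{n-1},x_n)$ for all $x$. *)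

theory Defs
  imports "HOL-Analysis.Analysis"
begin

definition partial :: "'n \<Rightarrow> (real^'n \<Rightarrow> real) \<Rightarrow> real^'n::finite \<Rightarrow> real" where
  "partial i f x = frechet_derivative f (at x) (axis i 1)"

definition gradient :: "(real^'n \<Rightarrow> real) \<Rightarrow> real^'n::finite \<Rightarrow> real^'n" where
  "gradient f x = (\<chi> i. partial i f x)"

primrec C_k :: "nat \<Rightarrow> (real^'n::finite \<Rightarrow> real) \<Rightarrow> bool" where
  "C_k 0 f \<longleftrightarrow> continuous_on UNIV f"
| "C_k (Suc k) f \<longleftrightarrow> (\<forall>x. f differentiable (at x)) \<and> (\<forall>i. C_k k (partial i f))"

definition test_function :: "(real^'n::finite \<Rightarrow> real) \<Rightarrow> bool" where
  "test_function \<phi> \<longleftrightarrow> (\<forall>k. C_k k \<phi>) \<and> compact (closure {x. \<phi> x \<noteq> 0})"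

definition locally_integrable :: "(real^'n::finite \<Rightarrow> real) \<Rightarrow> bool" where
  "locally_integrable f \<longleftrightarrow> (\<forall>K. compact K \<longrightarrow> set_integrable lborel K f)"

definition has_weak_partial ::
  "'n \<Rightarrow> (real^'n::finite \<Rightarrow> real) \<Rightarrow> (real^'n \<Rightarrow> real) \<Rightarrow> bool" where
  "has_weak_partial i u g \<longleftrightarrow> locally_integrable u \<and> locally_integrable g \<and>
     (\<forall>\<phi>. test_function \<phi> \<longrightarrow>
        (LINT x|lborel. u x * partial i \<phi> x) = - (LINT x|lborel. g x * \<phi> x))"

(* A weak partial derivative is unique only up to null sets; every notion below depends
   only on its a.e. equivalence class, so the choice of representative is immaterial. *)
definition weak_partial :: "'n \<Rightarrow> (real^'n::finite \<Rightarrow> real) \<Rightarrow> real^'n \<Rightarrow> real" where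
  "weak_partial i u = (SOME g. has_weak_partial i u g)"

definition weak_gradient :: "(real^'n::finite \<Rightarrow> real) \<Rightarrow> real^'n \<Rightarrow> real^'n" where
  "weak_gradient u x = (\<chi> i. weak_partial i u x)"

definition in_Lp :: "real \<Rightarrow> (real^'n::finite \<Rightarrow> real) \<Rightarrow> bool" where
  "in_Lp p g \<longleftrightarrow> g \<in> borel_measurable lborel \<and> integrable lborel (\<lambda>x. \<bar>g x\<bar> powr p)"

(* Functions with first order weak partial derivatives in L^p. Continuity expresses that,
   for p > n, such a function is identified with its continuous representative. *)
definition grad_Lp :: "real \<Rightarrow> (real^'n::finite \<Rightarrow> real) \<Rightarrow> bool" where
  "grad_Lp p u \<longleftrightarrow> continuous_on UNIV u \<and>
     (\<forall>i. (\<exists>g. has_weak_partial i u g) \<and> in_Lp p (weak_partial i u))"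

definition grad_norm :: "real \<Rightarrow> (real^'n::finite \<Rightarrow> real) \<Rightarrow> real" where
  "grad_norm p u = (LINT x|lborel. norm (weak_gradient u x) powr p) powr (1 / p)"

(* Extended-valued, since the supremum over real numbers is unspecified when unbounded. *)
definition holder_seminorm :: "real \<Rightarrow> (real^'n::finite \<Rightarrow> real) \<Rightarrow> ennreal" where
  "holder_seminorm \<alpha> u =
     (SUP (x, y) \<in> {(x, y). x \<noteq> y}. ennreal (\<bar>u x - u y\<bar> / norm (x - y) powr \<alpha>))"

definition morrey_exponent :: "'n::finite itself \<Rightarrow> real \<Rightarrow> real" where
  "morrey_exponent _ p = 1 - real CARD('n) / p"

definition morrey_constant :: "'n::finite itself \<Rightarrow> real \<Rightarrow> real" where
  "morrey_constant N p = (LEAST C. 0 < C \<and>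
     (\<forall>u :: real^'n \<Rightarrow> real. grad_Lp p u \<longrightarrow>
        holder_seminorm (morrey_exponent N p) u \<le> ennreal (C * grad_norm p u)))"

definition morrey_extremal :: "real \<Rightarrow> (real^'n::finite \<Rightarrow> real) \<Rightarrow> bool" where
  "morrey_extremal p u \<longleftrightarrow> grad_Lp p u \<and>
     holder_seminorm (morrey_exponent TYPE('n) p) u =
       ennreal (morrey_constant TYPE('n) p * grad_norm p u)"

(* The distribution - Delta_p u applied to the test function phi. *)
definition neg_p_laplacian ::
  "real \<Rightarrow> (real^'n::finite \<Rightarrow> real) \<Rightarrow> (real^'n \<Rightarrow> real) \<Rightarrow> real" where
  "neg_p_laplacian p u \<phi> =
     (LINT x|lborel. norm (weak_gradient u x) powr (p - 2) * (weak_gradient u x \<bullet> gradient \<phi> x))"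

definition reflect :: "'n \<Rightarrow> real^'n::finite \<Rightarrow> real^'n" where
  "reflect m x = (\<chi> i. if i = m then - x $ i else x $ i)"

end

theory Submission
  imports Defs
begin

text \<open>
  The extremality of u is used only through its gradient being in L^p. By antisymmetry it suffices
  to bound u from above in the half-space \<open>x\<^sub>n > 0\<close>, outside the unit ball, where u is p-harmonic,
  at most 1, and zero on the flat part of the boundary. A barrier is sought in the form
  \<open>w = exp (- \<beta> (ln r + H (x\<^sub>n / r)))\<close>. With \<open>k\<close> the derivative of H with respect to the polar angle,
  w is a strict supersolution of the p-Laplace equation as soon as \<open>k\<close> satisfies, for some exponent
  \<open>\<gamma> > \<beta>\<close>, the autonomous equation
  \<open>k' = (1 + k\<^sup>2) (\<gamma> (p - 1) (1 + k\<^sup>2) + p - 2) / (1 + (p - 1) k\<^sup>2)\<close> coming from the planar problem; the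
  additional terms in higher dimensions have a favourable sign because w decreases away from the
  \<open>x\<^sub>n\<close>-axis. The time this equation needs from \<open>k = 0\<close> to blow-up is explicit, and it exceeds
  \<open>\<pi> / 2\<close>, the angle of the half-space, exactly when \<open>\<gamma>\<close> is below the critical exponent.
  Since \<open>\<beta>\<close> is strictly subcritical, w is positive up to the boundary, so the set where u exceeds w
  stays away from it. One compares by testing both equations with
  \<open>\<eta> (max 0 (v - w - \<sigma>))\<^sup>2\<close> where v is a mollification of u and \<open>\<eta>\<close> a cutoff on balls of radius R: by
  monotonicity of the p-Laplacian and strictness of the barrier only cutoff terms remain, and
  these vanish as R grows because \<open>p > n\<close>.
\<close>

section \<open>Test functions and mollifiers\<close>

text \<open>The barrier comes from the plane. There \<open>exp (- \<gamma> (ln r + H))\<close> is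
  p-harmonic exactly when the angular derivative of H solves a first-order autonomous equation; the
  critical exponent is the one for which this function vanishes precisely at the edge of the
  half-plane. Keeping the slope that belongs to \<open>\<gamma>\<close> while lowering the power to
  \<open>\<beta>\<close> turns the planar equation into a strict inequality. The comparison takes
  place in an unbounded domain, and no decay of \<open>u\<close> is known beforehand. What replaces
  it is that the gradient of \<open>u\<close> lies in L^p and that of \<open>w\<close> is at most a
  constant over \<open>|x|\<close>. A test function built from \<open>u\<close> itself would need a
  chain rule for weak derivatives. Built from a mollification \<open>v\<close> it is C^1, at the
  price of a term with the gradient of \<open>v - u\<close>; for this term convergence is needed
  only in a pairing with the power p - 1 of a fixed L^p weight. The profile is chosen before
  \<open>u\<close> and before the axis, and the final constant is a maximum over the profile alone;
  therefore it depends only on \<open>\<beta>\<close>, p and n.\<close>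

lemma partial_eq: "(f has_derivative f') (at x) \<Longrightarrow> partial i f x = f' (axis i 1)"
  unfolding partial_def by (metis frechet_derivative_at)

lemma has_derivative_partials:
  fixes f :: "real^'n::finite \<Rightarrow> real"
  assumes "f differentiable (at x)"
  shows "(f has_derivative (\<lambda>h. \<Sum>i\<in>UNIV. h $ i * partial i f x)) (at x)"
proof -
  let ?D = "frechet_derivative f (at x)"
  have D: "(f has_derivative ?D) (at x)" using assms frechet_derivative_works by blast
  then have lin: "linear ?D" by (rule has_derivative_linear)
  have "?D h = (\<Sum>i\<in>UNIV. h $ i * partial i f x)" for h
  proof -
    have "?D h = ?D (\<Sum>i\<in>UNIV. h $ i *\<^sub>R axis i 1)"
      using basis_expansion[of h] by (simp add: scalar_mult_eq_scaleR)
    also have "\<dots> = (\<Sum>i\<in>UNIV. h $ i * ?D (axis i 1))"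
      using lin by (simp add: linear_sum linear_cmul)
    finally show ?thesis by (simp add: partial_def)
  qed
  then show ?thesis using D by presburger
qed

lemma C_k_Suc_imp: "C_k (Suc k) f \<Longrightarrow> C_k k f"
proof (induction k arbitrary: f)
  case 0
  then show ?case
    by (auto intro!: differentiable_imp_continuous_on simp: differentiable_on_def differentiable_at_withinI)
next
  case (Suc k)
  then show ?case by (metis C_k.simps(2))
qed

lemma partial_const: "partial i (\<lambda>x. c) = (\<lambda>x. 0)"
  by (rule ext) (simp add: partial_eq[OF has_derivative_const])

lemma C_k_const: "C_k k (\<lambda>x. c)"
  by (induction k arbitrary: c) (auto simp: partial_const)

lemma partial_add:
  assumes "f differentiable (at x)" "g differentiable (at x)"
  shows "partial i (\<lambda>x. f x + g x) x = partial i f x + partial i g x"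
proof -
  have "((\<lambda>x. f x + g x) has_derivative (\<lambda>h. frechet_derivative f (at x) h + frechet_derivative g (at x) h)) (at x)"
    by (intro has_derivative_add) (use assms frechet_derivative_works in blast)+
  from partial_eq[OF this] show ?thesis by (simp add: partial_def)
qed

lemma partial_mult:
  assumes "f differentiable (at x)" "g differentiable (at x)"
  shows "partial i (\<lambda>x. f x * g x) x = f x * partial i g x + partial i f x * g x"
proof -
  have "((\<lambda>x. f x * g x) has_derivative (\<lambda>h. f x * frechet_derivative g (at x) h + frechet_derivative f (at x) h * g x)) (at x)"
    by (intro has_derivative_mult) (use assms frechet_derivative_works in blast)+
  from partial_eq[OF this] show ?thesis by (simp add: partial_def)
qed

lemma C_k_add: "C_k k f \<Longrightarrow> C_k k g \<Longrightarrow> C_k k (\<lambda>x. f x + g x)"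
proof (induction k arbitrary: f g)
  case 0
  then show ?case by (simp add: continuous_on_add)
next
  case (Suc k)
  have "partial i (\<lambda>x. f x + g x) = (\<lambda>x. partial i f x + partial i g x)" for i
    using Suc.prems by (intro ext partial_add) auto
  then show ?case using Suc by (auto intro: differentiable_add)
qed

lemma C_k_mult: "C_k k f \<Longrightarrow> C_k k g \<Longrightarrow> C_k k (\<lambda>x. f x * g x)"
proof (induction k arbitrary: f g)
  case 0
  then show ?case by (simp add: continuous_on_mult)
next
  case (Suc k)
  have e: "partial i (\<lambda>x. f x * g x) = (\<lambda>x. f x * partial i g x + partial i f x * g x)" for i
    using Suc.prems by (intro ext partial_mult) auto
  have "C_k k (\<lambda>x. f x * partial i g x + partial i f x * g x)" for i
    using Suc.prems C_k_Suc_imp[OF Suc.prems(1)] C_k_Suc_imp[OF Suc.prems(2)]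
    by (intro C_k_add Suc.IH) auto
  then show ?case using Suc.prems by (auto simp: e intro: differentiable_mult)
qed

lemma C_k_prod: "finite I \<Longrightarrow> (\<And>i. i \<in> I \<Longrightarrow> C_k k (f i)) \<Longrightarrow> C_k k (\<lambda>x. \<Prod>i\<in>I. f i x)"
  by (induction rule: finite_induct) (auto intro: C_k_const C_k_mult)

section \<open>Smooth functions of one coordinate that vanish on a half-line, and the bump built
  from them\<close>

definition flat :: "real poly \<Rightarrow> real \<Rightarrow> real" where
  "flat P t = (if t > 0 then poly P (1 / t) * exp (- (1 / t)) else 0)"

lemma poly_exp_decay: "((\<lambda>x. poly P x * exp (- x)) \<longlongrightarrow> 0) (at_top :: real filter)"
proof -
  have "((\<lambda>x. \<Sum>i\<le>degree P. coeff P i * (x ^ i / exp x)) \<longlongrightarrow> (\<Sum>i\<le>degree P. coeff P i * 0)) (at_top :: real filter)"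
    by (intro tendsto_intros tendsto_power_div_exp_0)
  then show ?thesis
    by (simp add: poly_altdef sum_distrib_right exp_minus divide_inverse mult.assoc)
qed

text \<open>For \<open>t > 0\<close> the chain rule gives
  \<open>(1/t^2) (P - P')(1/t) exp(-1/t)\<close>, a function of the same kind; at 0 the difference
  quotients tend to 0 because the exponential beats every power. Indexing by polynomials thus makes
  the family closed under differentiation, and smoothness becomes an induction.\<close>

lemma flat_deriv:
  "(flat P has_real_derivative flat ([:0, 0, 1:] * (P - pderiv P)) t) (at t)"
proof -
  consider "t > 0" | "t < 0" | "t = 0" by linarith
  then show ?thesis
  proof cases
    case 1
    have "eventually (\<lambda>x. x \<in> {0<..}) (nhds t)" using 1 by (intro eventually_nhds_in_open) auto
    then have "eventually (\<lambda>x. poly P (1 / x) * exp (- (1 / x)) = flat P x) (nhds t)"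
      by eventually_elim (simp add: flat_def)
    moreover have "((\<lambda>x. poly P (1 / x) * exp (- (1 / x))) has_real_derivative
        flat ([:0, 0, 1:] * (P - pderiv P)) t) (at t)"
      using 1 unfolding flat_def
      by (auto intro!: derivative_eq_intros DERIV_chain2[OF poly_DERIV] simp: field_simps power2_eq_square)
    ultimately show ?thesis by (rule DERIV_cong_ev[OF refl _ refl, THEN iffD1])
  next
    case 2
    have "eventually (\<lambda>x. x \<in> {..<0}) (nhds t)" using 2 by (intro eventually_nhds_in_open) auto
    then have "eventually (\<lambda>x. 0 = flat P x) (nhds t)"
      by eventually_elim (simp add: flat_def)
    moreover have "((\<lambda>x. 0) has_real_derivative flat ([:0, 0, 1:] * (P - pderiv P)) t) (at t)"
      using 2 unfolding flat_def by simp
    ultimately show ?thesis by (rule DERIV_cong_ev[OF refl _ refl, THEN iffD1])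
  next
    case 3
    have "((\<lambda>x. flat P x / x) \<longlongrightarrow> 0) (at_right 0)"
    proof -
      have "((\<lambda>x. poly ([:0, 1:] * P) x * exp (- x)) \<longlongrightarrow> 0) at_top" by (rule poly_exp_decay)
      then have "((\<lambda>t. poly ([:0, 1:] * P) (inverse t) * exp (- inverse t)) \<longlongrightarrow> 0) (at_right 0)"
        by (rule filterlim_compose[OF _ filterlim_inverse_at_top_right])
      then show ?thesis
      proof (rule Lim_transform_eventually)
        have "eventually (\<lambda>s. s > 0) (at_right (0::real))" by (simp add: eventually_at_filter)
        then show "\<forall>\<^sub>F x in at_right 0. poly ([:0, 1:] * P) (inverse x) * exp (- inverse x) = flat P x / x"
          by eventually_elim (simp add: flat_def field_simps)
      qed
    qed
    moreover have "((\<lambda>x. flat P x / x) \<longlongrightarrow> 0) (at_left 0)"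
    proof (rule Lim_transform_eventually[OF tendsto_const])
      have "eventually (\<lambda>s. s < 0) (at_left (0::real))" by (simp add: eventually_at_filter)
      then show "\<forall>\<^sub>F x in at_left 0. 0 = flat P x / x"
        by eventually_elim (simp add: flat_def)
    qed
    ultimately have "((\<lambda>x. flat P x / x) \<longlongrightarrow> 0) (at 0)" by (simp add: filterlim_split_at)
    then show ?thesis unfolding has_field_derivative_iff using 3 by (simp add: flat_def)
  qed
qed

lemma C_k_flat: "C_k k (\<lambda>x::real^'n::finite. flat P (c + a * x $ i))"
proof (induction k arbitrary: P)
  case 0
  have "isCont (flat P) t" for t using flat_deriv DERIV_isCont by blast
  then have "continuous_on UNIV (flat P)" by (simp add: continuous_at_imp_continuous_on)
  then show ?case by (auto intro!: continuous_on_compose2[of UNIV "flat P"] continuous_intros)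
next
  case (Suc k)
  let ?Q = "[:0, 0, 1:] * (P - pderiv P)"
  have D: "((\<lambda>x::real^'n. flat P (c + a * x $ i)) has_derivative (\<lambda>h. (a * h $ i) * flat ?Q (c + a * x $ i))) (at x)" for x
    by (rule DERIV_compose_FDERIV[OF flat_deriv]) (auto intro!: derivative_eq_intros bounded_linear.has_derivative[OF bounded_linear_vec_nth])
  have e: "partial j (\<lambda>x::real^'n. flat P (c + a * x $ i)) = (\<lambda>x. (if j = i then a else 0) * flat ?Q (c + a * x $ i))" for j
    by (rule ext) (simp add: partial_eq[OF D] axis_def)
  have "C_k k (\<lambda>x::real^'n. (if j = i then a else 0) * flat ?Q (c + a * x $ i))" for j
    by (rule C_k_mult[OF C_k_const Suc.IH])
  then show ?case using D by (auto simp: e differentiable_def simp del: mult_pCons_left)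
qed

lemma continuous_compact_support_integrable:
  fixes f :: "'a::euclidean_space \<Rightarrow> real"
  assumes "continuous_on UNIV f" "compact K" "\<And>x. x \<notin> K \<Longrightarrow> f x = 0"
  shows "integrable lborel f"
proof -
  have "integrable lborel (\<lambda>x. indicator K x *\<^sub>R f x)"
    by (rule borel_integrable_compact) (use assms in \<open>auto intro: continuous_on_subset\<close>)
  moreover have "(\<lambda>x. indicator K x *\<^sub>R f x) = f" using assms(3) by (force simp: indicator_def)
  ultimately show ?thesis by simp
qed

lemma test_functionI:
  assumes "\<And>k. C_k k f" "compact K" "\<And>x. x \<notin> K \<Longrightarrow> f x = 0"
  shows "test_function f"
proof -
  have "closure {x. f x \<noteq> 0} \<subseteq> K"
    by (rule closure_minimal) (use assms in \<open>auto intro: compact_imp_closed\<close>)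
  then have "compact (closure {x. f x \<noteq> 0})"
    using assms(2) by (metis closed_closure compact_Int_closed inf.absorb_iff2)
  then show ?thesis unfolding test_function_def using assms by simp
qed

lemma test_functionE:
  assumes "test_function f"
  obtains K where "compact K" "\<And>x. x \<notin> K \<Longrightarrow> f x = 0"
  using assms closure_subset[of "{x. f x \<noteq> 0}"] unfolding test_function_def by (metis (mono_tags) mem_Collect_eq subsetD)

text \<open>Only a bound on the support is recorded and no scaling family is fixed, so a mollifier
  for a small radius is also one for every larger radius.\<close>

definition mollifier :: "real \<Rightarrow> (real^'n::finite \<Rightarrow> real) \<Rightarrow> bool" where
  "mollifier d \<rho> \<longleftrightarrow> test_function \<rho> \<and> (\<forall>x. \<rho> x \<ge> 0) \<and> (\<forall>x. norm x \<ge> d \<longrightarrow> \<rho> x = 0)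
     \<and> (LINT x|lborel. \<rho> x) = 1"

text \<open>The product over all coordinates of \<open>flat 1 (e + x_i)\<close> and
  \<open>flat 1 (e - x_i)\<close> is positive exactly on an open cube, and dividing by its integral
  normalizes it. The integral is positive because otherwise the nonempty open set where the bump is
  nonzero would be negligible.\<close>

lemma mollifier_exists:
  assumes "d > 0"
  obtains \<rho> :: "real^'n::finite \<Rightarrow> real" where "mollifier d \<rho>"
proof -
  \<comment> \<open>With n + 1 in the denominator the l1 bound \<open>n e\<close> is strictly below
    \<open>d\<close>, so the cube lies in the ball of radius \<open>d\<close>.\<close>
  define e where "e = d / (real CARD('n) + 1)"
  have e: "e > 0" unfolding e_def using assms by simp
  define b :: "real^'n \<Rightarrow> real" where "b x = (\<Prod>i\<in>UNIV. flat 1 (e + 1 * x $ i) * flat 1 (e + (-1) * x $ i))" for x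
  have C: "C_k k b" for k unfolding b_def by (intro C_k_prod C_k_mult C_k_flat) auto
  have flat0: "flat 1 t \<ge> 0" for t by (simp add: flat_def)
  have nn: "b x \<ge> 0" for x unfolding b_def by (intro prod_nonneg mult_nonneg_nonneg flat0)
  have z: "b x = 0" if "norm x \<ge> d" for x
  proof -
    have "\<exists>i. \<bar>x $ i\<bar> \<ge> e"
    proof (rule ccontr)
      assume "\<not> ?thesis"
      then have "\<bar>x $ i\<bar> \<le> e" for i by (meson linear)
      then have "norm x \<le> (\<Sum>i\<in>(UNIV::'n set). e)"
        using norm_le_l1_cart[of x] sum_mono[of UNIV "\<lambda>i. \<bar>x $ i\<bar>" "\<lambda>_. e"] by force
      also have "\<dots> = real CARD('n) * e" by simp
      also have "\<dots> < d" using assms unfolding e_def by (simp add: field_simps)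
      finally show False using that by simp
    qed
    then obtain i where "\<bar>x $ i\<bar> \<ge> e" by blast
    then have "flat 1 (e + 1 * x $ i) * flat 1 (e + (-1) * x $ i) = 0" unfolding flat_def by auto
    then show ?thesis unfolding b_def by (metis (mono_tags, lifting) UNIV_I finite prod_zero_iff)
  qed
  have b0: "b 0 > 0" unfolding b_def by (intro prod_pos) (simp add: flat_def e)
  have cont: "continuous_on UNIV b" using C[of 0] by simp
  have int: "integrable lborel b"
    by (rule continuous_compact_support_integrable[OF cont compact_cball[of 0 d]]) (auto intro!: z)
  have pos: "integral\<^sup>L lborel b > 0"
  proof -
    have "integral\<^sup>L lborel b \<noteq> 0"
    proof
      assume "integral\<^sup>L lborel b = 0"
      then have "AE x in lborel. b x = 0" using integral_nonneg_eq_0_iff_AE[OF int] nn by simp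
      then have "AE x in lebesgue. b x = 0" by (rule AE_completion)
      then have "{x. b x \<noteq> 0} \<in> null_sets lebesgue" by (simp add: AE_iff_null_sets completion.AE_iff_null_sets)
      then have "negligible {x. b x \<noteq> 0}" by (simp add: negligible_iff_null_sets)
      moreover have "open {x. b x \<noteq> 0}" by (intro open_Collect_neq cont continuous_intros)
      ultimately show False using open_not_negligible b0 by fastforce
    qed
    then show ?thesis using integral_nonneg_AE[of b lborel] nn by (simp add: order_less_le)
  qed
  define c where "c = 1 / integral\<^sup>L lborel b"
  have "mollifier d (\<lambda>x. c * b x)"
    unfolding mollifier_def
  proof (intro conjI allI impI)
    show "test_function (\<lambda>x. c * b x)"
      by (rule test_functionI[of _ "cball 0 d"]) (auto intro!: C_k_mult C_k_const C z)
    show "c * b x \<ge> 0" for x using pos nn unfolding c_def by simp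
    show "c * b x = 0" if "norm x \<ge> d" for x using z[OF that] by simp
    show "(LINT x|lborel. c * b x) = 1" using pos unfolding c_def by simp
  qed
  then show ?thesis using that by blast
qed

section \<open>Convolution\<close>

lemma locint_mult_integrable:
  fixes \<phi> f :: "real^'n::finite \<Rightarrow> real"
  assumes f: "locally_integrable f" and "continuous_on UNIV \<phi>" "compact K" "\<And>x. x \<notin> K \<Longrightarrow> \<phi> x = 0"
  shows "integrable lborel (\<lambda>x. \<phi> x * f x)"
proof -
  have 1: "integrable lborel (\<lambda>x. indicator K x *\<^sub>R f x)"
    using f assms(3) unfolding locally_integrable_def set_integrable_def by blast
  have "compact (\<phi> ` K)" using assms(2,3) by (intro compact_continuous_image) (auto intro: continuous_on_subset)
  then obtain M where M: "\<And>x. x \<in> K \<Longrightarrow> \<bar>\<phi> x\<bar> \<le> M"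
    by (meson bounded_real compact_imp_bounded image_eqI)
  have m: "\<phi> \<in> borel_measurable lborel" using assms(2) borel_measurable_continuous_onI by simp
  have e: "\<phi> x * f x = \<phi> x * (indicator K x *\<^sub>R f x)" for x using assms(4)[of x] by (auto simp: indicator_def)
  show ?thesis unfolding e
  proof (rule Bochner_Integration.integrable_bound[OF integrable_mult_right[OF integrable_norm[OF 1], of "M"]])
    show "(\<lambda>x. \<phi> x * (indicator K x *\<^sub>R f x)) \<in> borel_measurable lborel"
      by (rule borel_measurable_times[OF m borel_measurable_integrable[OF 1]])
    show "AE x in lborel. norm (\<phi> x * (indicator K x *\<^sub>R f x)) \<le> norm (M * norm (indicator K x *\<^sub>R f x))"
    proof (intro always_eventually allI)
      fix x show "norm (\<phi> x * (indicator K x *\<^sub>R f x)) \<le> norm (M * norm (indicator K x *\<^sub>R f x))"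
        using M[of x] by (cases "x \<in> K") (auto simp: abs_mult intro!: mult_right_mono)
    qed
  qed
qed

lemma continuous_locally_integrable:
  fixes f :: "real^'n::finite \<Rightarrow> real"
  shows "continuous_on UNIV f \<Longrightarrow> locally_integrable f"
  unfolding locally_integrable_def set_integrable_def
  by (intro allI impI borel_integrable_compact) (auto intro: continuous_on_subset)

lemma distr_lborel_reflect: "distr lborel borel (\<lambda>y. x - y) = (lborel :: 'a::euclidean_space measure)"
  using lborel_affine[of "-1" x] by (simp add: density_1)

lemma lborel_integral_reflect:
  fixes f :: "'a::euclidean_space \<Rightarrow> real"
  assumes "f \<in> borel_measurable borel"
  shows "(LINT y|lborel. f (x - y)) = (LINT y|lborel. f y)"
proof -
  have "(LINT y|lborel. f y) = (LINT y|distr lborel borel (\<lambda>y. x - y). f y)" by (simp add: distr_lborel_reflect)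
  also have "\<dots> = (LINT y|lborel. f (x - y))" by (rule integral_distr) (use assms in auto)
  finally show ?thesis by simp
qed

lemma nn_integral_lborel_reflect:
  fixes f :: "'a::euclidean_space \<Rightarrow> ennreal"
  assumes "f \<in> borel_measurable borel"
  shows "(\<integral>\<^sup>+ y. f (x - y) \<partial>lborel) = (\<integral>\<^sup>+ y. f y \<partial>lborel)"
proof -
  have "(\<integral>\<^sup>+ y. f y \<partial>lborel) = (\<integral>\<^sup>+ y. f y \<partial>distr lborel borel (\<lambda>y. x - y))" by (simp add: distr_lborel_reflect)
  also have "\<dots> = (\<integral>\<^sup>+ y. f (x - y) \<partial>lborel)" by (rule nn_integral_distr) (use assms in auto)
  finally show ?thesis by simp
qed

text \<open>On the closed unit neighbourhood of \<open>K\<close> this is uniform continuity on a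
  compact set. The bound \<open>d \<le> 1\<close> settles the rest: two points closer than
  \<open>d\<close> either both lie in that neighbourhood or both lie outside \<open>K\<close>, where
  \<open>f\<close> vanishes.\<close>

lemma compact_support_uniformly_continuous:
  fixes f :: "'a::euclidean_space \<Rightarrow> real"
  assumes c: "continuous_on UNIV f" and K: "compact K" "\<And>x. x \<notin> K \<Longrightarrow> f x = 0" and e: "e > 0"
  obtains d where "d > 0" "d \<le> 1" "\<And>x y. dist x y < d \<Longrightarrow> \<bar>f x - f y\<bar> < e"
proof -
  define K1 where "K1 = {x + y |x y. x \<in> K \<and> y \<in> cball 0 1}"
  have K1: "compact K1" unfolding K1_def by (intro compact_sums K compact_cball)
  have "uniformly_continuous_on K1 f"
    by (rule compact_uniformly_continuous[OF continuous_on_subset[OF c] K1]) simp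
  then obtain d where d: "d > 0" "\<And>x y. x \<in> K1 \<Longrightarrow> y \<in> K1 \<Longrightarrow> dist x y < d \<Longrightarrow> dist (f x) (f y) < e"
    using e unfolding uniformly_continuous_on_def by metis
  have in1: "y \<in> K1" if "x \<in> K" "dist x y < 1" for x y
  proof -
    have "y = x + (y - x)" "y - x \<in> cball 0 1" using that by (auto simp: dist_norm norm_minus_commute)
    then show ?thesis unfolding K1_def using that by blast
  qed
  show ?thesis
  proof (rule that[of "min d 1"])
    fix x y :: 'a assume a: "dist x y < min d 1"
    show "\<bar>f x - f y\<bar> < e"
    proof (cases "x \<in> K \<or> y \<in> K")
      case True
      then have "x \<in> K1 \<and> y \<in> K1" using in1[of x x] in1[of y y] in1[of x y] in1[of y x] a by (auto simp: dist_commute)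
      then show ?thesis using d(2)[of x y] a by (simp add: dist_real_def)
    next
      case False
      then show ?thesis using K(2) e by simp
    qed
  qed (use d in auto)
qed

lemma partial_zero_outside:
  assumes "compact K" "\<And>x. x \<notin> K \<Longrightarrow> f x = 0" "x \<notin> K"
  shows "partial i f x = 0"
proof -
  have o: "open (- K)" using assms(1) by (simp add: compact_imp_closed open_Compl)
  have "(f has_derivative (\<lambda>h. 0)) (at x)"
    by (rule has_derivative_transform_within_open[OF has_derivative_const o]) (use assms in auto)
  from partial_eq[OF this] show ?thesis .
qed

lemma test_function_partial:
  assumes "test_function f" shows "test_function (partial i f)"
proof -
  obtain K where K: "compact K" "\<And>x. x \<notin> K \<Longrightarrow> f x = 0" using test_functionE[OF assms] by blast
  show ?thesis
  proof (rule test_functionI[OF _ K(1)])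
    show "C_k k (partial i f)" for k
      using assms unfolding test_function_def by (metis C_k.simps(2))
    show "partial i f x = 0" if "x \<notin> K" for x using partial_zero_outside[OF K that] .
  qed
qed

lemma partial_reflected:
  assumes "\<And>z. f differentiable (at z)"
  shows "partial i (\<lambda>y. f (x - y)) = (\<lambda>y. - partial i f (x - y))"
    "(\<lambda>y. f (x - y)) differentiable (at y)"
proof -
  have D: "((\<lambda>y. f (x - y)) has_derivative (\<lambda>h. \<Sum>i\<in>UNIV. (- h) $ i * partial i f (x - y))) (at y)" for y
    by (rule has_derivative_compose[where g = f and f = "\<lambda>y. x - y" and f' = uminus and g' = "\<lambda>h. \<Sum>i\<in>UNIV. h $ i * partial i f (x - y)"])
      (auto intro!: derivative_eq_intros has_derivative_partials assms)
  then show "(\<lambda>y. f (x - y)) differentiable (at y)" unfolding differentiable_def by blast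
  show "partial i (\<lambda>y. f (x - y)) = (\<lambda>y. - partial i f (x - y))"
  proof
    fix y
    have "partial i (\<lambda>y. f (x - y)) y = (\<Sum>j\<in>UNIV. (- axis i 1) $ j * partial j f (x - y))"
      by (rule partial_eq[OF D])
    also have "\<dots> = (\<Sum>j\<in>UNIV. if j = i then - partial j f (x - y) else 0)"
      by (rule sum.cong) (auto simp: axis_def)
    finally show "partial i (\<lambda>y. f (x - y)) y = - partial i f (x - y)" by simp
  qed
qed

lemma C_k_reflected: "C_k k f \<Longrightarrow> C_k k (\<lambda>y. f (x - y))"
proof (induction k arbitrary: f)
  case 0
  then show ?case by (auto intro!: continuous_on_compose2[of UNIV f] continuous_intros)
next
  case (Suc k)
  have d: "f differentiable (at z)" for z using Suc.prems by simp
  have "C_k k (\<lambda>y. (-1) * partial i f (x - y))" for i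
    by (rule C_k_mult[OF C_k_const]) (use Suc in auto)
  then show ?case using partial_reflected[OF d] by simp
qed

lemma compact_reflect: "compact K \<Longrightarrow> compact ((\<lambda>z. x - z) ` (K :: 'a::euclidean_space set))"
  by (intro compact_continuous_image continuous_intros)

lemma test_function_reflected: "test_function f \<Longrightarrow> test_function (\<lambda>y. f (x - y))"
proof -
  assume f: "test_function f"
  obtain K where K: "compact K" "\<And>x. x \<notin> K \<Longrightarrow> f x = 0" using test_functionE[OF f] by blast
  show ?thesis
  proof (rule test_functionI[OF _ compact_reflect[OF K(1), of x]])
    show "C_k k (\<lambda>y. f (x - y))" for k using f C_k_reflected unfolding test_function_def by blast
    show "f (x - y) = 0" if "y \<notin> (\<lambda>z. x - z) ` K" for y
    proof (rule K(2))
      show "x - y \<notin> K" using that by (metis diff_diff_eq2 add_diff_cancel_left' image_eqI)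
    qed
  qed
qed

section \<open>Convolution with a test function and its derivatives\<close>

definition conv :: "(real^'n::finite \<Rightarrow> real) \<Rightarrow> (real^'n \<Rightarrow> real) \<Rightarrow> real^'n \<Rightarrow> real" where
  "conv \<rho> f x = (LINT y|lborel. \<rho> (x - y) * f y)"

lemma conv_integrable:
  assumes "locally_integrable f" "continuous_on UNIV \<rho>" "compact K" "\<And>x. x \<notin> K \<Longrightarrow> \<rho> x = 0"
  shows "integrable lborel (\<lambda>y. \<rho> (x - y) * f y)"
proof (rule locint_mult_integrable[OF assms(1) _ compact_reflect[OF assms(3), of x]])
  show "continuous_on UNIV (\<lambda>y. \<rho> (x - y))"
    by (rule continuous_on_compose2[OF assms(2)]) (auto intro!: continuous_intros)
  show "\<rho> (x - y) = 0" if "y \<notin> (\<lambda>z. x - z) ` K" for y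
    by (rule assms(4)) (use that in \<open>metis diff_diff_eq2 add_diff_cancel_left' image_eqI\<close>)
qed

text \<open>The mean value inequality is applied to the remainder as a function of the increment:
  its derivative at \<open>v\<close> is a difference of partial derivatives at \<open>z + v\<close>
  and \<open>z\<close>, small uniformly in \<open>z\<close>. This uniformity is what permits
  integrating the expansion, for convolutions as well as for translates.\<close>

lemma first_order_uniform:
  fixes f :: "real^'n::finite \<Rightarrow> real"
  assumes f: "C_k (Suc 0) f" and K: "compact K" "\<And>x. x \<notin> K \<Longrightarrow> f x = 0" and e: "e > 0"
  obtains d where "d > 0" "d \<le> 1"
    "\<And>z h. norm h < d \<Longrightarrow> \<bar>f (z + h) - f z - (\<Sum>i\<in>UNIV. h $ i * partial i f z)\<bar> \<le> e * norm h"
proof -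
  have d: "f differentiable (at z)" for z using f by simp
  define e' where "e' = e / real CARD('n)"
  have e': "e' > 0" unfolding e'_def using e by simp
  have "\<exists>d>0. d \<le> 1 \<and> (\<forall>x y. dist x y < d \<longrightarrow> \<bar>partial i f x - partial i f y\<bar> < e')" for i
    by (rule compact_support_uniformly_continuous[of "partial i f" K e'])
      (use f K e' partial_zero_outside[OF K] in \<open>auto\<close>)
  then obtain D where D: "\<And>i. D i > 0" "\<And>i. D i \<le> 1" "\<And>i x y. dist x y < D i \<Longrightarrow> \<bar>partial i f x - partial i f y\<bar> < e'"
    by metis
  define d where "d = Min (range D)"
  have dpos: "d > 0" "d \<le> 1" and dD: "\<And>i. d \<le> D i"
    unfolding d_def using D(1,2) by (auto simp: Min_gr_iff Min_le_iff)
  show ?thesis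
  proof (rule that[OF dpos])
    fix z h :: "real^'n" assume h: "norm h < d"
    define G where "G v = f (z + v) - (\<Sum>i\<in>UNIV. v $ i * partial i f z)" for v
    have DG: "(G has_derivative (\<lambda>w. \<Sum>i\<in>UNIV. w $ i * (partial i f (z + v) - partial i f z))) (at v within ball 0 d)" for v
    proof -
      have 1: "((\<lambda>v. f (z + v)) has_derivative (\<lambda>w. \<Sum>i\<in>UNIV. w $ i * partial i f (z + v))) (at v)"
        by (rule has_derivative_compose[where g = f and f = "\<lambda>y. z + y" and f' = "\<lambda>h. h" and g' = "\<lambda>h. \<Sum>i\<in>UNIV. h $ i * partial i f (z + v)"])
          (auto intro!: derivative_eq_intros has_derivative_partials d)
      have 2: "((\<lambda>v. \<Sum>i\<in>UNIV. v $ i * partial i f z) has_derivative (\<lambda>w. \<Sum>i\<in>UNIV. w $ i * partial i f z)) (at v)"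
        by (auto intro!: derivative_eq_intros bounded_linear.has_derivative[OF bounded_linear_vec_nth])
      have "(G has_derivative (\<lambda>w. (\<Sum>i\<in>UNIV. w $ i * partial i f (z + v)) - (\<Sum>i\<in>UNIV. w $ i * partial i f z))) (at v)"
        unfolding G_def by (rule has_derivative_diff[OF 1 2])
      then show ?thesis by (simp add: sum_subtractf right_diff_distrib has_derivative_at_withinI)
    qed
    have on: "onorm (\<lambda>w. \<Sum>i\<in>UNIV. w $ i * (partial i f (z + v) - partial i f z)) \<le> e" if v: "v \<in> ball 0 d" for v
    proof (rule onorm_le)
      fix w :: "real^'n"
      have "\<bar>\<Sum>i\<in>UNIV. w $ i * (partial i f (z + v) - partial i f z)\<bar> \<le> (\<Sum>i\<in>UNIV. \<bar>w $ i * (partial i f (z + v) - partial i f z)\<bar>)"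
        by (rule sum_abs)
      also have "\<dots> \<le> (\<Sum>i\<in>(UNIV::'n set). norm w * e')"
      proof (rule sum_mono)
        fix i :: 'n
        have "\<bar>partial i f (z + v) - partial i f z\<bar> \<le> e'"
          using D(3)[of "z + v" z i] v dD[of i] by (simp add: dist_norm)
        then show "\<bar>w $ i * (partial i f (z + v) - partial i f z)\<bar> \<le> norm w * e'"
          unfolding abs_mult by (intro mult_mono component_le_norm_cart) auto
      qed
      also have "\<dots> = e * norm w" by (simp add: e'_def)
      finally show "norm (\<Sum>i\<in>UNIV. w $ i * (partial i f (z + v) - partial i f z)) \<le> e * norm w" by simp
    qed
    have "norm (G h - G 0) \<le> e * norm (h - 0)"
      by (rule differentiable_bound[OF _ DG on]) (use h dpos in auto)
    then show "\<bar>f (z + h) - f z - (\<Sum>i\<in>UNIV. h $ i * partial i f z)\<bar> \<le> e * norm h"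
      by (simp add: G_def algebra_simps)
  qed
qed

text \<open>The remainder of the first-order expansion of \<open>\<rho>\<close> is integrated
  against \<open>f\<close>. It is at most \<open>e' |h|\<close> and vanishes off one compact set for
  all small \<open>h\<close>, so local integrability of \<open>f\<close> is enough.\<close>

lemma conv_has_derivative:
  fixes f :: "real^'n::finite \<Rightarrow> real"
  assumes f: "locally_integrable f" and \<rho>: "test_function \<rho>"
  shows "(conv \<rho> f has_derivative (\<lambda>h. \<Sum>i\<in>UNIV. h $ i * conv (partial i \<rho>) f x)) (at x)"
  unfolding has_derivative_at_alt
proof (intro conjI allI impI)
  show "bounded_linear (\<lambda>h. \<Sum>i\<in>UNIV. h $ i * conv (partial i \<rho>) f x)"
    by (intro bounded_linear_sum bounded_linear_mult_const bounded_linear_vec_nth)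
  fix e :: real assume e: "0 < e"
  obtain K where K: "compact K" "\<And>x. x \<notin> K \<Longrightarrow> \<rho> x = 0" using test_functionE[OF \<rho>] by blast
  have C1: "C_k (Suc 0) \<rho>" using \<rho> unfolding test_function_def by blast
  have C0: "continuous_on UNIV \<rho>" "continuous_on UNIV (partial i \<rho>)" for i
    using C1 C_k_Suc_imp[OF C1] by auto
  define K1 where "K1 = {x + y |x y. x \<in> K \<and> y \<in> cball 0 1}"
  have K1: "compact K1" unfolding K1_def by (intro compact_sums K compact_cball)
  have KK1: "K \<subseteq> K1"
  proof
    fix y assume "y \<in> K"
    moreover have "y = y + 0" "(0::real^'n) \<in> cball 0 1" by auto
    ultimately show "y \<in> K1" unfolding K1_def by blast
  qed
  \<comment> \<open>For the fixed \<open>x\<close> and every increment of norm at most 1 the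
    remainder \<open>R\<close> below vanishes off this set.\<close>
  define K2 where "K2 = (\<lambda>z. x - z) ` K1"
  have K2: "compact K2" unfolding K2_def by (rule compact_reflect[OF K1])
  have int2: "integrable lborel (\<lambda>y. indicator K2 y *\<^sub>R f y)"
    using f K2 unfolding locally_integrable_def set_integrable_def by blast
  define M where "M = (LINT y|lborel. norm (indicator K2 y *\<^sub>R f y))"
  have M: "M \<ge> 0" unfolding M_def by (rule integral_nonneg_AE) simp
  define e' where "e' = e / (M + 1)"
  have e': "e' > 0" unfolding e'_def using e M by simp
  have e'M: "e' * M \<le> e" unfolding e'_def using e M by (simp add: field_simps)
  obtain d where d: "d > 0" "d \<le> 1"
    "\<And>z h. norm h < d \<Longrightarrow> \<bar>\<rho> (z + h) - \<rho> z - (\<Sum>i\<in>UNIV. h $ i * partial i \<rho> z)\<bar> \<le> e' * norm h"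
    using first_order_uniform[OF C1 K e'] by metis
  have ig: "integrable lborel (\<lambda>y. \<rho> (z - y) * f y)" for z
    by (rule conv_integrable[OF f C0(1) K])
  have igp: "integrable lborel (\<lambda>y. partial i \<rho> (z - y) * f y)" for i z
    by (rule conv_integrable[OF f C0(2) K(1)]) (rule partial_zero_outside[OF K])
  show "\<exists>d>0. \<forall>y. norm (y - x) < d \<longrightarrow>
      norm (conv \<rho> f y - conv \<rho> f x - (\<Sum>i\<in>UNIV. (y - x) $ i * conv (partial i \<rho>) f x)) \<le> e * norm (y - x)"
  proof (intro exI conjI allI impI)
    show "d > 0" by fact
    fix x' assume "norm (x' - x) < d"
    define h where "h = x' - x"
    have h: "norm h < d" "x' = x + h" unfolding h_def using \<open>norm (x' - x) < d\<close> by auto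
    define R where "R y = \<rho> (x + h - y) - \<rho> (x - y) - (\<Sum>i\<in>UNIV. h $ i * partial i \<rho> (x - y))" for y
    have eqi: "conv \<rho> f x' - conv \<rho> f x - (\<Sum>i\<in>UNIV. h $ i * conv (partial i \<rho>) f x) = (LINT y|lborel. R y * f y)"
    proof -
      have "(LINT y|lborel. R y * f y) = (LINT y|lborel. \<rho> (x + h - y) * f y - \<rho> (x - y) * f y - (\<Sum>i\<in>UNIV. h $ i * (partial i \<rho> (x - y) * f y)))"
        unfolding R_def by (simp add: left_diff_distrib sum_distrib_right mult.assoc)
      also have "\<dots> = conv \<rho> f x' - conv \<rho> f x - (\<Sum>i\<in>UNIV. h $ i * conv (partial i \<rho>) f x)"
        unfolding conv_def h(2)
        using ig igp by (simp add: Bochner_Integration.integral_diff Bochner_Integration.integral_sum Bochner_Integration.integrable_diff Bochner_Integration.integrable_sum integrable_mult_right)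
      finally show ?thesis by simp
    qed
    have igR: "integrable lborel (\<lambda>y. R y * f y)"
    proof -
      have "integrable lborel (\<lambda>y. \<rho> (x + h - y) * f y - \<rho> (x - y) * f y - (\<Sum>i\<in>UNIV. h $ i * (partial i \<rho> (x - y) * f y)))"
        by (intro Bochner_Integration.integrable_diff ig Bochner_Integration.integrable_sum integrable_mult_right igp)
      then show ?thesis unfolding R_def by (simp add: left_diff_distrib sum_distrib_right mult.assoc)
    qed
    have bd: "norm (R y * f y) \<le> e' * norm h * norm (indicator K2 y *\<^sub>R f y)" for y
    proof (cases "y \<in> K2")
      case True
      have "\<bar>R y\<bar> \<le> e' * norm h"
        using d(3)[OF h(1), of "x - y"] unfolding R_def by (simp add: algebra_simps)
      then show ?thesis using True by (auto simp: abs_mult intro: mult_right_mono)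
    next
      case False
      then have "x - y \<notin> K1" unfolding K2_def by (metis diff_diff_eq2 add_diff_cancel_left' image_eqI)
      moreover have "x + h - y \<notin> K"
      proof
        assume "x + h - y \<in> K"
        moreover have "x - y = (x + h - y) + (- h)" "- h \<in> cball 0 1" using h d by auto
        ultimately have "x - y \<in> K1" unfolding K1_def by blast
        with \<open>x - y \<notin> K1\<close> show False ..
      qed
      ultimately have "\<rho> (x - y) = 0" "\<rho> (x + h - y) = 0" "partial i \<rho> (x - y) = 0" for i
        using K(2) KK1 partial_zero_outside[where f = \<rho> and x = "x - y" and i = i, OF K] by auto
      then have "R y = 0" unfolding R_def by simp
      then show ?thesis using e' by simp
    qed
    have "norm (LINT y|lborel. R y * f y) \<le> (LINT y|lborel. norm (R y * f y))" by (rule integral_norm_bound)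
    also have "\<dots> \<le> (LINT y|lborel. e' * norm h * norm (indicator K2 y *\<^sub>R f y))"
      by (intro integral_mono integrable_norm igR integrable_mult_right int2 bd)
    also have "\<dots> = e' * M * norm h" unfolding M_def by simp
    also have "\<dots> \<le> e * norm h" using e'M by (intro mult_right_mono) auto
    finally show "norm (conv \<rho> f x' - conv \<rho> f x - (\<Sum>i\<in>UNIV. (x' - x) $ i * conv (partial i \<rho>) f x)) \<le> e * norm (x' - x)"
      using eqi unfolding h_def by simp
  qed
qed

lemma partial_conv:
  assumes "locally_integrable f" "test_function \<rho>"
  shows "partial i (conv \<rho> f) x = conv (partial i \<rho>) f x"
proof -
  have "partial i (conv \<rho> f) x = (\<Sum>j\<in>UNIV. axis i 1 $ j * conv (partial j \<rho>) f x)"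
    by (rule partial_eq[OF conv_has_derivative[OF assms]])
  also have "\<dots> = (\<Sum>j\<in>UNIV. if j = i then conv (partial j \<rho>) f x else 0)"
    by (rule sum.cong) (auto simp: axis_def)
  finally show ?thesis by simp
qed

lemma C_k_conv:
  assumes "locally_integrable f" "test_function \<rho>"
  shows "C_k k (conv \<rho> f)"
  using assms(2)
proof (induction k arbitrary: \<rho>)
  case 0
  have "conv \<rho> f differentiable (at x)" for x
    using conv_has_derivative[OF assms(1) 0] unfolding differentiable_def by blast
  then show ?case
    by (auto intro!: differentiable_imp_continuous_on simp: differentiable_on_def differentiable_at_withinI)
next
  case (Suc k)
  have "conv \<rho> f differentiable (at x)" for x
    using conv_has_derivative[OF assms(1) Suc.prems] unfolding differentiable_def by blast
  moreover have "partial i (conv \<rho> f) = conv (partial i \<rho>) f" for i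
    by (rule ext) (rule partial_conv[OF assms(1) Suc.prems])
  ultimately show ?case using Suc.IH[OF test_function_partial[OF Suc.prems]] by simp
qed

text \<open>As a function of y, \<open>\<rho> (x - y)\<close> is itself a test function. The sign
  from differentiating the reflected argument cancels the sign in the definition of a weak
  derivative.\<close>

lemma conv_weak_partial:
  assumes "has_weak_partial i u g" "test_function \<rho>"
  shows "conv (partial i \<rho>) u x = conv \<rho> g x"
proof -
  have d: "\<rho> differentiable (at z)" for z using assms(2) unfolding test_function_def by (metis C_k.simps(2))
  have "(LINT y|lborel. u y * partial i (\<lambda>y. \<rho> (x - y)) y) = - (LINT y|lborel. g y * \<rho> (x - y))"
    using assms(1) test_function_reflected[OF assms(2)] unfolding has_weak_partial_def by blast
  then show ?thesis unfolding conv_def by (simp add: partial_reflected[OF d] mult.commute)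
qed

lemma test_function_conv:
  assumes f: "continuous_on UNIV f" "compact L" "\<And>x. x \<notin> L \<Longrightarrow> f x = 0"
    and \<rho>: "test_function \<rho>" "compact K" "\<And>x. x \<notin> K \<Longrightarrow> \<rho> x = 0"
  shows "test_function (conv \<rho> f)" "\<And>x. x \<notin> {a + b |a b. a \<in> K \<and> b \<in> L} \<Longrightarrow> conv \<rho> f x = 0"
proof -
  show z: "conv \<rho> f x = 0" if x: "x \<notin> {a + b |a b. a \<in> K \<and> b \<in> L}" for x
  proof -
    have "\<rho> (x - y) * f y = 0" for y
    proof (rule ccontr)
      assume "\<rho> (x - y) * f y \<noteq> 0"
      then have "x - y \<in> K" "y \<in> L" using f(3) \<rho>(3) by auto
      moreover have "x = (x - y) + y" by simp
      ultimately show False using x by blast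
    qed
    then have "(\<lambda>y. \<rho> (x - y) * f y) = (\<lambda>y. 0)" by blast
    then show ?thesis unfolding conv_def by simp
  qed
  show "test_function (conv \<rho> f)"
    by (rule test_functionI[OF C_k_conv[OF continuous_locally_integrable[OF f(1)] \<rho>(1)] compact_sums[OF \<rho>(2) f(2)] z])
qed

section \<open>Mollification as averaging\<close>

lemma mollifierD:
  assumes "mollifier d \<rho>"
  shows "test_function \<rho>" "\<And>x. \<rho> x \<ge> 0" "\<And>x. norm x \<ge> d \<Longrightarrow> \<rho> x = 0" "(LINT x|lborel. \<rho> x) = 1"
    "\<And>x. x \<notin> cball 0 d \<Longrightarrow> \<rho> x = 0" "continuous_on UNIV \<rho>" "\<rho> \<in> borel_measurable borel" "integrable lborel \<rho>"
proof -
  show 1: "test_function \<rho>" "\<And>x. \<rho> x \<ge> 0" "\<And>x. norm x \<ge> d \<Longrightarrow> \<rho> x = 0" "(LINT x|lborel. \<rho> x) = 1"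
    using assms unfolding mollifier_def by auto
  show 2: "\<And>x. x \<notin> cball 0 d \<Longrightarrow> \<rho> x = 0" using 1(3) by simp
  show 3: "continuous_on UNIV \<rho>" using 1(1) unfolding test_function_def by (metis C_k.simps(1))
  then show "\<rho> \<in> borel_measurable borel" by (rule borel_measurable_continuous_onI)
  show "integrable lborel \<rho>" by (rule continuous_compact_support_integrable[OF 3 compact_cball 2])
qed

lemma mollifier_reflected:
  assumes "mollifier d \<rho>"
  shows "integrable lborel (\<lambda>y. \<rho> (x - y))" "(LINT y|lborel. \<rho> (x - y)) = 1"
proof -
  note m = mollifierD[OF assms]
  show "(LINT y|lborel. \<rho> (x - y)) = 1" using lborel_integral_reflect[OF m(7), of x] m(4) by simp
  show "integrable lborel (\<lambda>y. \<rho> (x - y))"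
    using conv_integrable[OF continuous_locally_integrable[OF continuous_on_const[of _ 1]] m(6) compact_cball[of 0 d], of x] m(5) by simp
qed

text \<open>The convolution is a weighted mean of \<open>f\<close> over a ball of radius
  \<open>d\<close>. With \<open>a = f x\<close> this is pointwise approximation governed by the
  oscillation of \<open>f\<close>; with \<open>a = 0\<close> it says that a bound on
  \<open>f\<close> is preserved.\<close>

lemma conv_approx:
  assumes f: "locally_integrable f" and \<rho>: "mollifier d \<rho>"
    and e: "\<And>y. dist x y < d \<Longrightarrow> \<bar>f y - a\<bar> \<le> e"
  shows "\<bar>conv \<rho> f x - a\<bar> \<le> e"
proof -
  note m = mollifierD[OF \<rho>]
  note r = mollifier_reflected[OF \<rho>, of x]
  have i: "integrable lborel (\<lambda>y. \<rho> (x - y) * f y)" by (rule conv_integrable[OF f m(6) compact_cball m(5)])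
  have "conv \<rho> f x - a = (LINT y|lborel. \<rho> (x - y) * f y - a * \<rho> (x - y))"
    unfolding conv_def using i r by simp
  moreover have "norm (LINT y|lborel. \<rho> (x - y) * f y - a * \<rho> (x - y)) \<le> (LINT y|lborel. e * \<rho> (x - y))"
  proof (rule order_trans[OF integral_norm_bound], rule integral_mono)
    show "integrable lborel (\<lambda>y. norm (\<rho> (x - y) * f y - a * \<rho> (x - y)))" "integrable lborel (\<lambda>y. e * \<rho> (x - y))"
      using i r by auto
    fix y
    show "norm (\<rho> (x - y) * f y - a * \<rho> (x - y)) \<le> e * \<rho> (x - y)"
    proof (cases "dist x y < d")
      case True
      have "norm (\<rho> (x - y) * f y - a * \<rho> (x - y)) = \<rho> (x - y) * \<bar>f y - a\<bar>"
        using m(2)[of "x - y"] by (simp add: abs_mult flip: left_diff_distrib) (metis abs_mult abs_of_nonneg right_diff_distrib mult.commute)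
      also have "\<dots> \<le> e * \<rho> (x - y)" using mult_left_mono[OF e[OF True] m(2)[of "x - y"]] by (simp add: mult.commute)
      finally show ?thesis .
    next
      case False
      then show ?thesis using m(3)[of "x - y"] by (simp add: dist_norm)
    qed
  qed
  ultimately show ?thesis using r by simp
qed

section \<open>Mollification in L^p\<close>

text \<open>Replaces the inequality of Hoelder; the proof distinguishes \<open>h \<le> \<delta> P\<close> from \<open>h > \<delta> P\<close>.\<close>
lemma powr_young:
  fixes P h :: real
  assumes "P \<ge> 0" "h \<ge> 0" "\<delta> > 0" "p > 1"
  shows "P powr (p - 1) * h \<le> \<delta> * P powr p + \<delta> powr (1 - p) * h powr p"
proof (cases "h \<le> \<delta> * P")
  case True
  have "P powr (p - 1) * h \<le> P powr (p - 1) * (\<delta> * P)" using True by (intro mult_left_mono) auto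
  also have "\<dots> = \<delta> * (P * P powr (p - 1))" by simp
  also have "P * P powr (p - 1) = P powr p" using assms by (simp add: powr_mult_base)
  finally show ?thesis using assms by (simp add: add_increasing2)
next
  case False
  then have "P \<le> h / \<delta>" using assms by (simp add: field_simps)
  then have "P powr (p - 1) * h \<le> (h / \<delta>) powr (p - 1) * h"
    using assms by (intro mult_right_mono powr_mono2) auto
  also have "\<dots> = \<delta> powr (1 - p) * (h * h powr (p - 1))"
  proof -
    have "(h / \<delta>) powr (p - 1) = h powr (p - 1) / \<delta> powr (p - 1)" by (rule powr_divide)
    moreover have "\<delta> powr (1 - p) = 1 / \<delta> powr (p - 1)" using powr_minus_divide[of \<delta> "p - 1"] by simp
    ultimately show ?thesis by simp
  qed
  also have "h * h powr (p - 1) = h powr p" using assms by (simp add: powr_mult_base)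
  finally show ?thesis using assms by (simp add: add_increasing)
qed

text \<open>The estimate \<open>a + b \<le> 2 max a b\<close> suffices; the constant
  \<open>2^p\<close> spares convexity and covers every nonnegative exponent.\<close>

lemma powr_add_le:
  fixes a b :: real
  assumes "a \<ge> 0" "b \<ge> 0" "p \<ge> 0"
  shows "(a + b) powr p \<le> 2 powr p * (a powr p + b powr p)"
proof -
  have "(a + b) powr p \<le> (2 * max a b) powr p" using assms by (intro powr_mono2) auto
  also have "\<dots> = 2 powr p * (max a b) powr p" using assms by (simp add: powr_mult)
  also have "(max a b) powr p \<le> a powr p + b powr p" by (simp add: max_def)
  finally show ?thesis by simp
qed

lemma powr_diff_le:
  fixes a b :: real
  assumes "p \<ge> 0"
  shows "\<bar>a - b\<bar> powr p \<le> 2 powr p * (\<bar>a\<bar> powr p + \<bar>b\<bar> powr p)"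
proof -
  have "\<bar>a - b\<bar> powr p \<le> (\<bar>a\<bar> + \<bar>b\<bar>) powr p" using assms by (intro powr_mono2) auto
  also have "\<dots> \<le> 2 powr p * (\<bar>a\<bar> powr p + \<bar>b\<bar> powr p)" using assms by (intro powr_add_le) auto
  finally show ?thesis .
qed

lemma tendsto_powr_abs_diff:
  fixes f :: "nat \<Rightarrow> real"
  assumes "f \<longlonglongrightarrow> a" "p > 0"
  shows "(\<lambda>k. \<bar>a - f k\<bar> powr p) \<longlonglongrightarrow> 0"
proof -
  have "(\<lambda>k. \<bar>a - f k\<bar>) \<longlonglongrightarrow> 0" using tendsto_rabs[OF tendsto_diff[OF tendsto_const assms(1), of a]] by simp
  then show ?thesis using assms(2) by (intro tendsto_zero_powrI[where b = p]) auto
qed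

section \<open>Density of continuous functions with compact support in L^p\<close>

lemma Lp_approx_truncated:
  fixes g :: "real^'n::finite \<Rightarrow> real"
  assumes g: "in_Lp p g" and p: "p > 0" and e: "e > 0"
  obtains M :: nat where
    "(LINT x|lborel. \<bar>g x - max 0 (min 1 (real M - norm x)) * max (- real M) (min (real M) (g x))\<bar> powr p) < e"
    "integrable lborel (\<lambda>x. \<bar>g x - max 0 (min 1 (real M - norm x)) * max (- real M) (min (real M) (g x))\<bar> powr p)"
proof -
  \<comment> \<open>A continuous cutoff in place of an indicator: the same truncation, applied to a
    continuous function, leaves it continuous.\<close>
  define c where "c M x = max 0 (min 1 (real M - norm x))" for M and x :: "real^'n"
  define h where "h M x = c M x * max (- real M) (min (real M) (g x))" for M x
  have gm[measurable]: "g \<in> borel_measurable lborel" and gi: "integrable lborel (\<lambda>x. \<bar>g x\<bar> powr p)"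
    using g unfolding in_Lp_def by auto
  have hm: "h M \<in> borel_measurable lborel" for M unfolding h_def c_def by measurable
  have hle: "\<bar>h M x\<bar> \<le> \<bar>g x\<bar>" for M x
  proof -
    have "\<bar>h M x\<bar> \<le> 1 * \<bar>g x\<bar>" unfolding h_def abs_mult by (intro mult_mono) (auto simp: c_def)
    then show ?thesis by simp
  qed
  have hlim: "(\<lambda>M. h M x) \<longlonglongrightarrow> g x" for x
  proof (rule tendsto_eventually)
    have "\<forall>\<^sub>F M in sequentially. real M \<ge> max (norm x + 1) \<bar>g x\<bar>"
      using filterlim_real_sequentially unfolding filterlim_at_top by blast
    then show "\<forall>\<^sub>F M in sequentially. h M x = g x"
      by eventually_elim (auto simp: h_def c_def)
  qed
  have bd: "\<bar>g x - h M x\<bar> powr p \<le> 2 powr p * (\<bar>g x\<bar> powr p + \<bar>g x\<bar> powr p)" for x M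
  proof -
    have "\<bar>g x - h M x\<bar> powr p \<le> 2 powr p * (\<bar>g x\<bar> powr p + \<bar>h M x\<bar> powr p)" using p by (intro powr_diff_le) auto
    also have "\<dots> \<le> 2 powr p * (\<bar>g x\<bar> powr p + \<bar>g x\<bar> powr p)"
      using hle p by (intro mult_left_mono add_left_mono powr_mono2) auto
    finally show ?thesis .
  qed
  have ib: "integrable lborel (\<lambda>x. 2 powr p * (\<bar>g x\<bar> powr p + \<bar>g x\<bar> powr p))" using gi by simp
  have lim: "(\<lambda>M. LINT x|lborel. \<bar>g x - h M x\<bar> powr p) \<longlonglongrightarrow> (LINT x|(lborel :: (real^'n) measure). 0)"
    by (rule integral_dominated_convergence[OF _ _ ib])
      (use bd tendsto_powr_abs_diff[OF hlim p] hm in auto)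
  have int: "integrable lborel (\<lambda>x. \<bar>g x - h M x\<bar> powr p)" for M
    by (rule Bochner_Integration.integrable_bound[OF ib]) (use bd hm in auto)
  obtain M where "(LINT x|lborel. \<bar>g x - h M x\<bar> powr p) < e"
    using order_tendstoD(2)[OF lim, of e] e by (auto dest: eventually_happens)
  then show ?thesis using that[of M] int unfolding h_def c_def by blast
qed

text \<open>A Lebesgue measurable function is almost everywhere a limit of continuous ones. The
  truncation that was applied to \<open>g\<close> is applied to these as well; it makes them
  uniformly bounded with support in one ball, so dominated convergence turns pointwise convergence
  into convergence in L^p.\<close>

lemma Lp_dense:
  fixes g :: "real^'n::finite \<Rightarrow> real"
  assumes g: "in_Lp p g" and p: "p > 0" and e: "e > 0"
  obtains f K where "continuous_on UNIV f" "compact K" "\<And>x. x \<notin> K \<Longrightarrow> f x = 0"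
    "(\<integral>\<^sup>+ x. ennreal (\<bar>g x - f x\<bar> powr p) \<partial>lborel) \<le> ennreal e"
proof -
  have gm[measurable]: "g \<in> borel_measurable lborel" using g unfolding in_Lp_def by auto
  define e' where "e' = e / (2 * 2 powr p)"
  have e': "e' > 0" unfolding e'_def using e by simp
  obtain M :: nat where M:
    "(LINT x|lborel. \<bar>g x - max 0 (min 1 (real M - norm x)) * max (- real M) (min (real M) (g x))\<bar> powr p) < e'"
    "integrable lborel (\<lambda>x. \<bar>g x - max 0 (min 1 (real M - norm x)) * max (- real M) (min (real M) (g x))\<bar> powr p)"
    using Lp_approx_truncated[OF g p e'] by blast
  define c where "c x = max 0 (min 1 (real M - norm x))" for x :: "real^'n"
  define cl where "cl t = max (- real M) (min (real M) t)" for t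
  define h where "h x = c x * cl (g x)" for x
  have M: "(LINT x|lborel. \<bar>g x - h x\<bar> powr p) < e'" "integrable lborel (\<lambda>x. \<bar>g x - h x\<bar> powr p)"
    using M unfolding h_def c_def cl_def by auto
  have hm[measurable]: "h \<in> borel_measurable lborel" unfolding h_def c_def cl_def by measurable
  have "g \<in> borel_measurable lebesgue" using gm by (simp add: measurable_completion)
  then have "g measurable_on UNIV" by (rule lebesgue_measurable_imp_measurable_on) simp
  then obtain N q where N: "negligible N" and q: "\<And>n. continuous_on UNIV (q n)" "\<And>x. x \<notin> N \<Longrightarrow> (\<lambda>n. q n x) \<longlonglongrightarrow> g x"
    unfolding measurable_on_def by auto
  define f where "f n x = c x * cl (q n x)" for n x
  have fc: "continuous_on UNIV (f n)" for n
    unfolding f_def c_def cl_def by (intro continuous_intros q)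
  have fz: "f n x = 0" if "x \<notin> cball 0 (real M)" for n x using that by (auto simp: f_def c_def)
  have fm: "f n \<in> borel_measurable lborel" for n using borel_measurable_continuous_onI[OF fc] by simp
  have "N \<in> null_sets lebesgue" using N by (simp add: negligible_iff_null_sets)
  then have "AE x in lebesgue. x \<notin> N" by (rule AE_not_in)
  then have "AE x in lborel. x \<notin> N" by (simp add: AE_completion_iff)
  then have lim1: "AE x in lborel. (\<lambda>n. \<bar>h x - f n x\<bar> powr p) \<longlonglongrightarrow> 0"
  proof eventually_elim
    fix x assume "x \<notin> N"
    then have "(\<lambda>n. f n x) \<longlonglongrightarrow> h x" unfolding f_def h_def cl_def by (intro tendsto_intros q)
    then show "(\<lambda>n. \<bar>h x - f n x\<bar> powr p) \<longlonglongrightarrow> 0" by (rule tendsto_powr_abs_diff[OF _ p])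
  qed
  have bd: "\<bar>h x - f n x\<bar> powr p \<le> (2 * real M) powr p * indicator (cball 0 (real M)) x" for x n
  proof (cases "x \<in> cball 0 (real M)")
    case True
    have "\<bar>h x - f n x\<bar> = c x * \<bar>cl (g x) - cl (q n x)\<bar>"
      unfolding h_def f_def by (simp add: abs_mult c_def flip: right_diff_distrib)
    also have "\<dots> \<le> 1 * (2 * real M)" by (intro mult_mono) (auto simp: c_def cl_def)
    finally show ?thesis using True p by (auto intro!: powr_mono2)
  next
    case False
    then show ?thesis by (auto simp: h_def f_def c_def p)
  qed
  have ib: "integrable lborel (\<lambda>x. (2 * real M) powr p * indicator (cball 0 (real M)) (x::real^'n) :: real)"
    using emeasure_lborel_cball_finite[of "0::real^'n" "real M"] by (intro integrable_mult_right integrable_real_indicator) auto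
  have lim: "(\<lambda>n. LINT x|lborel. \<bar>h x - f n x\<bar> powr p) \<longlonglongrightarrow> (LINT x|(lborel :: (real^'n) measure). 0)"
    by (rule integral_dominated_convergence[OF _ _ ib lim1]) (use bd fm hm in auto)
  have int: "integrable lborel (\<lambda>x. \<bar>h x - f n x\<bar> powr p)" for n
    by (rule Bochner_Integration.integrable_bound[OF ib]) (use bd fm hm in auto)
  obtain n where n: "(LINT x|lborel. \<bar>h x - f n x\<bar> powr p) < e'"
    using order_tendstoD(2)[OF lim, of e'] e' by (auto dest: eventually_happens)
  have "(\<integral>\<^sup>+ x. ennreal (\<bar>g x - f n x\<bar> powr p) \<partial>lborel)
    \<le> (\<integral>\<^sup>+ x. ennreal (2 powr p * (\<bar>g x - h x\<bar> powr p + \<bar>h x - f n x\<bar> powr p)) \<partial>lborel)"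
  proof (rule nn_integral_mono, rule ennreal_leI)
    fix x
    have "\<bar>g x - f n x\<bar> powr p \<le> (\<bar>g x - h x\<bar> + \<bar>h x - f n x\<bar>) powr p" using p by (intro powr_mono2) auto
    also have "\<dots> \<le> 2 powr p * (\<bar>g x - h x\<bar> powr p + \<bar>h x - f n x\<bar> powr p)" using p by (intro powr_add_le) auto
    finally show "\<bar>g x - f n x\<bar> powr p \<le> 2 powr p * (\<bar>g x - h x\<bar> powr p + \<bar>h x - f n x\<bar> powr p)" .
  qed
  also have "\<dots> = ennreal (LINT x|lborel. 2 powr p * (\<bar>g x - h x\<bar> powr p + \<bar>h x - f n x\<bar> powr p))"
    using M(2) int[of n] by (intro nn_integral_eq_integral) auto
  also have "(LINT x|lborel. 2 powr p * (\<bar>g x - h x\<bar> powr p + \<bar>h x - f n x\<bar> powr p))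
    = 2 powr p * ((LINT x|lborel. \<bar>g x - h x\<bar> powr p) + (LINT x|lborel. \<bar>h x - f n x\<bar> powr p))"
    using M(2) int[of n] by simp
  also have "\<dots> \<le> 2 powr p * (e' + e')" using M(1) n by (intro mult_left_mono) auto
  also have "\<dots> = e" unfolding e'_def by (simp add: field_simps)
  finally show ?thesis using that[of "f n" "cball 0 (real M)"] fc fz by (simp add: ennreal_leI)
qed

section \<open>Continuity of translations in L^p\<close>

lemma nn_integral_lborel_shift:
  fixes f :: "'a::euclidean_space \<Rightarrow> ennreal"
  assumes "f \<in> borel_measurable borel"
  shows "(\<integral>\<^sup>+ y. f (y - z) \<partial>lborel) = (\<integral>\<^sup>+ y. f y \<partial>lborel)"
proof -
  have "(\<integral>\<^sup>+ y. f y \<partial>lborel) = (\<integral>\<^sup>+ y. f y \<partial>distr lborel borel ((+) (- z)))" by (simp only: lborel_distr_plus)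
  also have "\<dots> = (\<integral>\<^sup>+ y. f (- z + y) \<partial>lborel)" by (rule nn_integral_distr) (use assms in auto)
  finally show ?thesis by simp
qed

text \<open>A continuous \<open>f\<close> with compact support is put between: of the three
  differences two are \<open>g - f\<close> and a translate of it, small by the choice of
  \<open>f\<close>, and the middle one is uniformly small and supported in \<open>K1\<close>, a set
  of finite measure that does not depend on the shift.\<close>

lemma Lp_translation_continuous:
  fixes g :: "real^'n::finite \<Rightarrow> real"
  assumes g: "in_Lp p g" and p: "p > 0" and e: "e > 0"
  obtains d where "d > 0"
    "\<And>z. norm z < d \<Longrightarrow> (\<integral>\<^sup>+ x. ennreal (\<bar>g (x - z) - g x\<bar> powr p) \<partial>lborel) \<le> ennreal e"
proof -
  have gm: "g \<in> borel_measurable borel" using g unfolding in_Lp_def by auto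
  \<comment> \<open>Three terms, and two applications of \<open>powr_add_le\<close>.\<close>
  define e' where "e' = e / (3 * (2 powr p * 2 powr p))"
  have e': "e' > 0" unfolding e'_def using e by simp
  obtain f K where f: "continuous_on UNIV f" "compact K" "\<And>x. x \<notin> K \<Longrightarrow> f x = 0"
    and gf: "(\<integral>\<^sup>+ x. ennreal (\<bar>g x - f x\<bar> powr p) \<partial>lborel) \<le> ennreal e'"
    using Lp_dense[OF g p e'] by blast
  have fm: "f \<in> borel_measurable borel" using f(1) borel_measurable_continuous_onI by blast
  define K1 where "K1 = {x + y |x y. x \<in> K \<and> y \<in> cball 0 1}"
  have K1: "compact K1" unfolding K1_def by (intro compact_sums f compact_cball)
  have K1fin: "emeasure lborel K1 < \<infinity>" by (rule emeasure_compact_finite[OF K1])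
  have K1b: "K1 \<in> sets lborel" using K1 by (simp add: borel_compact)
  define V where "V = measure lborel K1"
  have V: "V \<ge> 0" "emeasure lborel K1 = ennreal V" unfolding V_def using K1fin by (auto simp: emeasure_eq_ennreal_measure)
  \<comment> \<open>Chosen so that the middle term, at most \<open>\<eta>^p\<close> on a set of
    measure \<open>V\<close>, contributes at most \<open>e'\<close>.\<close>
  define \<eta> where "\<eta> = (e' / (V + 1)) powr (1/p)"
  have \<eta>: "\<eta> > 0" unfolding \<eta>_def using e' V by simp
  have \<eta>p: "\<eta> powr p * V \<le> e'"
  proof -
    have "\<eta> powr p = e' / (V + 1)" unfolding \<eta>_def using p e' V by (simp add: powr_powr)
    then have "\<eta> powr p * V + \<eta> powr p = e'" using e' V by (simp add: field_simps)
    then show ?thesis using powr_ge_zero[of \<eta> p] by linarith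
  qed
  obtain d where d: "d > 0" "d \<le> 1" "\<And>x y. dist x y < d \<Longrightarrow> \<bar>f x - f y\<bar> < \<eta>"
    using compact_support_uniformly_continuous[OF f \<eta>] by metis
  have main: "(\<integral>\<^sup>+ x. ennreal (\<bar>g (x - z) - g x\<bar> powr p) \<partial>lborel) \<le> ennreal e" if z: "norm z < d" for z
  proof -
    have pw: "\<bar>g (x - z) - g x\<bar> powr p \<le>
      (2 powr p * 2 powr p) * (\<bar>g (x - z) - f (x - z)\<bar> powr p + \<bar>f (x - z) - f x\<bar> powr p + \<bar>g x - f x\<bar> powr p)" for x
    proof -
      let ?a = "\<bar>g (x - z) - f (x - z)\<bar>" and ?b = "\<bar>f (x - z) - f x\<bar>" and ?c = "\<bar>g x - f x\<bar>"
      have "\<bar>g (x - z) - g x\<bar> powr p \<le> (?a + (?b + ?c)) powr p" using p by (intro powr_mono2) auto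
      also have "\<dots> \<le> 2 powr p * (?a powr p + (?b + ?c) powr p)" using p by (intro powr_add_le) auto
      also have "\<dots> \<le> 2 powr p * (?a powr p + 2 powr p * (?b powr p + ?c powr p))"
        using p by (intro mult_left_mono add_left_mono powr_add_le) auto
      also have "\<dots> \<le> 2 powr p * (2 powr p * ?a powr p + 2 powr p * (?b powr p + ?c powr p))"
      proof -
        have "1 * ?a powr p \<le> 2 powr p * ?a powr p" using p by (intro mult_right_mono ge_one_powr_ge_zero) auto
        then show ?thesis by (intro mult_left_mono add_right_mono) auto
      qed
      also have "\<dots> = (2 powr p * 2 powr p) * (?a powr p + ?b powr p + ?c powr p)" by (simp add: algebra_simps)
      finally show ?thesis .
    qed
    have A: "(\<integral>\<^sup>+ x. ennreal (\<bar>g (x - z) - f (x - z)\<bar> powr p) \<partial>lborel) \<le> ennreal e'"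
      using nn_integral_lborel_shift[of "\<lambda>x. ennreal (\<bar>g x - f x\<bar> powr p)" z] gf gm fm by simp
    have "(\<integral>\<^sup>+ x. ennreal (\<bar>f (x - z) - f x\<bar> powr p) \<partial>lborel) \<le> (\<integral>\<^sup>+ x. ennreal (\<eta> powr p) * indicator K1 x \<partial>lborel)"
    proof (rule nn_integral_mono)
      fix x :: "real^'n"
      show "ennreal (\<bar>f (x - z) - f x\<bar> powr p) \<le> ennreal (\<eta> powr p) * indicator K1 x"
      proof (cases "x \<in> K1")
        case True
        have "\<bar>f (x - z) - f x\<bar> \<le> \<eta>" using d(3)[of "x - z" x] z by (simp add: dist_norm)
        then have "\<bar>f (x - z) - f x\<bar> powr p \<le> \<eta> powr p" using p by (intro powr_mono2) auto
        then show ?thesis using True by (simp add: ennreal_leI)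
      next
        case False
        have "x = x + 0" "(0::real^'n) \<in> cball 0 1" by auto
        then have "x \<notin> K" using False unfolding K1_def by blast
        have "x = (x - z) + z" "z \<in> cball 0 1" using z d by auto
        then have "x - z \<notin> K" using False unfolding K1_def by blast
        then show ?thesis using \<open>x \<notin> K\<close> f(3) by simp
      qed
    qed
    also have "\<dots> = ennreal (\<eta> powr p) * ennreal V" using K1b V by (simp add: nn_integral_cmult_indicator)
    also have "\<dots> \<le> ennreal e'" using \<eta>p V by (simp add: ennreal_leI flip: ennreal_mult')
    finally have B: "(\<integral>\<^sup>+ x. ennreal (\<bar>f (x - z) - f x\<bar> powr p) \<partial>lborel) \<le> ennreal e'" .
    have "(\<integral>\<^sup>+ x. ennreal (\<bar>g (x - z) - g x\<bar> powr p) \<partial>lborel)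
      \<le> (\<integral>\<^sup>+ x. ennreal (2 powr p * 2 powr p) * (ennreal (\<bar>g (x - z) - f (x - z)\<bar> powr p)
          + ennreal (\<bar>f (x - z) - f x\<bar> powr p) + ennreal (\<bar>g x - f x\<bar> powr p)) \<partial>lborel)"
      using pw by (intro nn_integral_mono) (simp add: ennreal_leI flip: ennreal_mult' ennreal_plus)
    also have "\<dots> = ennreal (2 powr p * 2 powr p) * ((\<integral>\<^sup>+ x. ennreal (\<bar>g (x - z) - f (x - z)\<bar> powr p) \<partial>lborel)
          + (\<integral>\<^sup>+ x. ennreal (\<bar>f (x - z) - f x\<bar> powr p) \<partial>lborel) + (\<integral>\<^sup>+ x. ennreal (\<bar>g x - f x\<bar> powr p) \<partial>lborel))"
      using gm fm by (simp add: nn_integral_cmult nn_integral_add)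
    also have "\<dots> \<le> ennreal (2 powr p * 2 powr p) * (ennreal e' + ennreal e' + ennreal e')"
      by (intro mult_left_mono add_mono A B gf) auto
    also have "\<dots> = ennreal ((2 powr p * 2 powr p) * (e' + e' + e'))"
      using e' by (simp flip: ennreal_mult' ennreal_plus)
    also have "(2 powr p * 2 powr p) * (e' + e' + e') = e" unfolding e'_def by (simp add: field_simps)
    finally show ?thesis .
  qed
  show ?thesis using that[OF d(1) main] .
qed

section \<open>The mollification error paired with an L^p weight\<close>

lemma mollifier_mono: "mollifier d \<rho> \<Longrightarrow> d \<le> d' \<Longrightarrow> mollifier d' \<rho>"
  unfolding mollifier_def by force

text \<open>The error at \<open>x\<close> is at most a mean of translation differences of
  \<open>g\<close>. After exchanging the integrals, \<open>powr_young\<close> bounds the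
  contribution of each shift \<open>z\<close> by \<open>e\<close>, and the total mass 1 of
  \<open>\<rho>\<close> finishes. The radius is uniform in \<open>\<rho>\<close>, so that one
  mollifier can later serve all components of a gradient.\<close>

lemma conv_Lp_pairing:
  fixes g P :: "real^'n::finite \<Rightarrow> real"
  assumes p: "p > 1" and g: "in_Lp p g" "locally_integrable g"
    and P: "P \<in> borel_measurable borel" "\<And>x. P x \<ge> 0" "integrable lborel (\<lambda>x. P x powr p)" and e: "e > 0"
  obtains d where "d > 0"
    "\<And>\<rho>. mollifier d \<rho> \<Longrightarrow> integrable lborel (\<lambda>x. P x powr (p - 1) * \<bar>conv \<rho> g x - g x\<bar>)"
    "\<And>\<rho>. mollifier d \<rho> \<Longrightarrow> (LINT x|lborel. P x powr (p - 1) * \<bar>conv \<rho> g x - g x\<bar>) \<le> e"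
proof -
  have gm: "g \<in> borel_measurable borel" using g unfolding in_Lp_def by auto
  define I where "I = (LINT x|lborel. P x powr p)"
  have I: "I \<ge> 0" unfolding I_def by (rule integral_nonneg_AE) simp
  \<comment> \<open>The two terms of \<open>powr_young\<close> integrate to
    \<open>\<delta> I\<close> and at most \<open>\<delta>^(1-p) e1\<close>; each is allotted half of
    \<open>e\<close>.\<close>
  define \<delta> where "\<delta> = e / (2 * (I + 1))"
  have \<delta>: "\<delta> > 0" "\<delta> * I \<le> e / 2" unfolding \<delta>_def using e I by (auto simp: field_simps)
  define e1 where "e1 = e / (2 * \<delta> powr (1 - p))"
  have e1: "e1 > 0" "\<delta> powr (1 - p) * e1 = e / 2" unfolding e1_def using e \<delta> by auto
  obtain d where d: "d > 0" "\<And>z. norm z < d \<Longrightarrow> (\<integral>\<^sup>+ x. ennreal (\<bar>g (x - z) - g x\<bar> powr p) \<partial>lborel) \<le> ennreal e1"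
    using Lp_translation_continuous[OF g(1) _ e1(1)] p by auto
  have main: "(\<integral>\<^sup>+ x. ennreal (P x powr (p - 1) * \<bar>conv \<rho> g x - g x\<bar>) \<partial>lborel) \<le> ennreal e" if \<rho>: "mollifier d \<rho>" for \<rho>
  proof -
    note m = mollifierD[OF \<rho>]
    have pw: "ennreal \<bar>conv \<rho> g x - g x\<bar> \<le> (\<integral>\<^sup>+ z. ennreal (\<rho> z * \<bar>g (x - z) - g x\<bar>) \<partial>lborel)" for x
    proof -
      note r = mollifier_reflected[OF \<rho>, of x]
      have i: "integrable lborel (\<lambda>y. \<rho> (x - y) * g y)" by (rule conv_integrable[OF g(2) m(6) compact_cball m(5)])
      have e: "conv \<rho> g x - g x = (LINT y|lborel. \<rho> (x - y) * g y - g x * \<rho> (x - y))"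
        unfolding conv_def using i r by simp
      have "ennreal (norm (LINT y|lborel. \<rho> (x - y) * g y - g x * \<rho> (x - y))) \<le> (\<integral>\<^sup>+ y. ennreal (norm (\<rho> (x - y) * g y - g x * \<rho> (x - y))) \<partial>lborel)"
        using i r by (intro integral_norm_bound_ennreal) auto
      also have "\<dots> = (\<integral>\<^sup>+ y. ennreal (\<rho> (x - y) * \<bar>g y - g x\<bar>) \<partial>lborel)"
      proof (intro nn_integral_cong arg_cong[where f = ennreal])
        fix y
        have "\<rho> (x - y) * g y - g x * \<rho> (x - y) = \<rho> (x - y) * (g y - g x)" by (simp add: algebra_simps)
        then show "norm (\<rho> (x - y) * g y - g x * \<rho> (x - y)) = \<rho> (x - y) * \<bar>g y - g x\<bar>"
          using m(2)[of "x - y"] by (simp add: abs_mult)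
      qed
      also have "\<dots> = (\<integral>\<^sup>+ z. ennreal (\<rho> (x - (x - z)) * \<bar>g (x - z) - g x\<bar>) \<partial>lborel)"
        by (rule nn_integral_lborel_reflect[symmetric]) (use gm m(7) in measurable)
      finally show ?thesis unfolding e by simp
    qed
    have "(\<integral>\<^sup>+ x. ennreal (P x powr (p - 1) * \<bar>conv \<rho> g x - g x\<bar>) \<partial>lborel)
      \<le> (\<integral>\<^sup>+ x. \<integral>\<^sup>+ z. ennreal (P x powr (p - 1)) * ennreal (\<rho> z * \<bar>g (x - z) - g x\<bar>) \<partial>lborel \<partial>lborel)"
    proof (rule nn_integral_mono)
      fix x
      have "ennreal (P x powr (p - 1) * \<bar>conv \<rho> g x - g x\<bar>) \<le> ennreal (P x powr (p - 1)) * (\<integral>\<^sup>+ z. ennreal (\<rho> z * \<bar>g (x - z) - g x\<bar>) \<partial>lborel)"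
        using pw[of x] by (simp add: ennreal_mult' mult_left_mono)
      also have "\<dots> = (\<integral>\<^sup>+ z. ennreal (P x powr (p - 1)) * ennreal (\<rho> z * \<bar>g (x - z) - g x\<bar>) \<partial>lborel)"
        by (rule nn_integral_cmult[symmetric]) (use gm m(7) in measurable)
      finally show "ennreal (P x powr (p - 1) * \<bar>conv \<rho> g x - g x\<bar>) \<le> (\<integral>\<^sup>+ z. ennreal (P x powr (p - 1)) * ennreal (\<rho> z * \<bar>g (x - z) - g x\<bar>) \<partial>lborel)" .
    qed
    also have "\<dots> = (\<integral>\<^sup>+ z. \<integral>\<^sup>+ x. ennreal (P x powr (p - 1)) * ennreal (\<rho> z * \<bar>g (x - z) - g x\<bar>) \<partial>lborel \<partial>lborel)"
      by (rule lborel_pair.Fubini') (use gm m(7) P(1) in measurable)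
    also have "\<dots> \<le> (\<integral>\<^sup>+ z. ennreal e * ennreal (\<rho> z) \<partial>lborel)"
    proof (rule nn_integral_mono)
      fix z :: "real^'n"
      show "(\<integral>\<^sup>+ x. ennreal (P x powr (p - 1)) * ennreal (\<rho> z * \<bar>g (x - z) - g x\<bar>) \<partial>lborel) \<le> ennreal e * ennreal (\<rho> z)"
      proof (cases "norm z < d")
        case True
        have "(\<integral>\<^sup>+ x. ennreal (P x powr (p - 1)) * ennreal (\<rho> z * \<bar>g (x - z) - g x\<bar>) \<partial>lborel)
          \<le> (\<integral>\<^sup>+ x. ennreal (\<rho> z) * (ennreal \<delta> * ennreal (P x powr p) + ennreal (\<delta> powr (1 - p)) * ennreal (\<bar>g (x - z) - g x\<bar> powr p)) \<partial>lborel)"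
        proof (rule nn_integral_mono)
          fix x
          have "P x powr (p - 1) * \<bar>g (x - z) - g x\<bar> \<le> \<delta> * P x powr p + \<delta> powr (1 - p) * \<bar>g (x - z) - g x\<bar> powr p"
            by (rule powr_young) (use P \<delta> p in auto)
          then have "\<rho> z * (P x powr (p - 1) * \<bar>g (x - z) - g x\<bar>) \<le> \<rho> z * (\<delta> * P x powr p + \<delta> powr (1 - p) * \<bar>g (x - z) - g x\<bar> powr p)"
            by (rule mult_left_mono) (rule m(2))
          then show "ennreal (P x powr (p - 1)) * ennreal (\<rho> z * \<bar>g (x - z) - g x\<bar>)
            \<le> ennreal (\<rho> z) * (ennreal \<delta> * ennreal (P x powr p) + ennreal (\<delta> powr (1 - p)) * ennreal (\<bar>g (x - z) - g x\<bar> powr p))"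
            using m(2)[of z] \<delta> by (simp add: ennreal_leI mult.left_commute flip: ennreal_mult' ennreal_plus)
        qed
        also have "\<dots> = ennreal (\<rho> z) * (ennreal \<delta> * (\<integral>\<^sup>+ x. ennreal (P x powr p) \<partial>lborel)
            + ennreal (\<delta> powr (1 - p)) * (\<integral>\<^sup>+ x. ennreal (\<bar>g (x - z) - g x\<bar> powr p) \<partial>lborel))"
          using gm P(1) by (simp add: nn_integral_cmult nn_integral_add)
        also have "(\<integral>\<^sup>+ x. ennreal (P x powr p) \<partial>lborel) = ennreal I"
          unfolding I_def by (rule nn_integral_eq_integral[OF P(3)]) simp
        also have "ennreal (\<rho> z) * (ennreal \<delta> * ennreal I + ennreal (\<delta> powr (1 - p)) * (\<integral>\<^sup>+ x. ennreal (\<bar>g (x - z) - g x\<bar> powr p) \<partial>lborel))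
          \<le> ennreal (\<rho> z) * (ennreal \<delta> * ennreal I + ennreal (\<delta> powr (1 - p)) * ennreal e1)"
          by (intro mult_left_mono add_left_mono d True) auto
        also have "\<dots> = ennreal (\<rho> z * (\<delta> * I + \<delta> powr (1 - p) * e1))"
          using m(2)[of z] \<delta> I e1 by (simp flip: ennreal_mult' ennreal_plus)
        also have "\<dots> \<le> ennreal (\<rho> z * e)"
          using m(2)[of z] \<delta> e1 by (intro ennreal_leI mult_left_mono) auto
        also have "\<dots> = ennreal e * ennreal (\<rho> z)" using m(2)[of z] e by (simp add: ennreal_mult' mult.commute)
        finally show ?thesis .
      next
        case False
        then show ?thesis using m(3)[of z] by simp
      qed
    qed
    also have "\<dots> = ennreal e * (\<integral>\<^sup>+ z. ennreal (\<rho> z) \<partial>lborel)" using m(7) by (intro nn_integral_cmult) auto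
    also have "(\<integral>\<^sup>+ z. ennreal (\<rho> z) \<partial>lborel) = ennreal 1"
      using m(2,4,8) by (subst nn_integral_eq_integral) auto
    finally show ?thesis by simp
  qed
  have meas: "(\<lambda>x. P x powr (p - 1) * \<bar>conv \<rho> g x - g x\<bar>) \<in> borel_measurable lborel" if "mollifier d \<rho>" for \<rho>
  proof -
    have "continuous_on UNIV (conv \<rho> g)" using C_k_conv[OF g(2) mollifierD(1)[OF that], of 0] by simp
    then have "conv \<rho> g \<in> borel_measurable borel" by (rule borel_measurable_continuous_onI)
    then show ?thesis using P(1) gm by measurable
  qed
  show ?thesis
  proof (rule that[OF d(1)])
    fix \<rho> :: "real^'n \<Rightarrow> real" assume \<rho>: "mollifier d \<rho>"
    show 1: "integrable lborel (\<lambda>x. P x powr (p - 1) * \<bar>conv \<rho> g x - g x\<bar>)"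
      using main[OF \<rho>] by (intro integrableI_nonneg meas[OF \<rho>]) (auto simp: le_less_trans)
    have "ennreal (LINT x|lborel. P x powr (p - 1) * \<bar>conv \<rho> g x - g x\<bar>) \<le> ennreal e"
      using main[OF \<rho>] by (subst (asm) nn_integral_eq_integral[OF 1]) auto
    then show "(LINT x|lborel. P x powr (p - 1) * \<bar>conv \<rho> g x - g x\<bar>) \<le> e" using e by (simp add: ennreal_le_iff2)
  qed
qed

section \<open>Weak equations tested with C^1 functions\<close>

lemma eq_zero_if_le_epsilon_mult:
  fixes a V :: real
  assumes "V \<ge> 0" "\<And>e. e > 0 \<Longrightarrow> \<bar>a\<bar> \<le> e * V"
  shows "a = 0"
proof (rule ccontr)
  assume a: "a \<noteq> 0"
  define e where "e = \<bar>a\<bar> / (2 * (V + 1))"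
  have e: "e > 0" unfolding e_def using a assms(1) by simp
  have "e * (2 * (V + 1)) = \<bar>a\<bar>" unfolding e_def using assms(1) by simp
  then have "2 * (e * V) + 2 * e = \<bar>a\<bar>" by (simp add: algebra_simps)
  moreover have "e * V \<ge> 0" using e assms(1) by simp
  ultimately show False using assms(2)[OF e] e by linarith
qed

section \<open>Gradients and gluing of C^1 functions\<close>

lemma gradient_nth: "gradient f x $ i = partial i f x"
  by (simp add: gradient_def)

lemma gradient_eq:
  assumes "(f has_derivative (\<lambda>h. v \<bullet> h)) (at x)"
  shows "gradient f x = v"
  unfolding gradient_def vec_eq_iff using partial_eq[OF assms] by (simp add: inner_axis)

lemma has_derivative_gradient:
  fixes f :: "real^'n::finite \<Rightarrow> real"
  assumes "f differentiable (at x)"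
  shows "(f has_derivative (\<lambda>h. gradient f x \<bullet> h)) (at x)"
  using has_derivative_partials[OF assms] by (simp add: inner_vec_def gradient_nth mult.commute)

lemma C1_continuous_gradient:
  assumes "C_k (Suc 0) f" shows "continuous_on UNIV (gradient f)"
  unfolding gradient_def using assms by (intro continuous_on_vec_lambda) auto

lemma C1_continuous: "C_k (Suc 0) f \<Longrightarrow> continuous_on UNIV f"
  using C_k_Suc_imp[of 0 f] by simp

text \<open>\<open>D\<close> and the complement of \<open>K\<close> are open and cover the space. In
  this way test functions that contain the barrier, whose derivative is controlled only on
  \<open>D\<close>, become global C^1 functions.\<close>

lemma C1_glue:
  fixes \<psi> :: "real^'n::finite \<Rightarrow> real"
  assumes D: "open D" and K: "compact K" "K \<subseteq> D" "\<And>x. x \<notin> K \<Longrightarrow> \<psi> x = 0"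
    and der: "\<And>x. x \<in> D \<Longrightarrow> (\<psi> has_derivative (\<lambda>h. V x \<bullet> h)) (at x)"
    and cont: "continuous_on D V"
  shows "C_k (Suc 0) \<psi>" "\<And>x. x \<in> D \<Longrightarrow> gradient \<psi> x = V x" "\<And>x. x \<notin> K \<Longrightarrow> gradient \<psi> x = 0"
proof -
  show g1: "gradient \<psi> x = V x" if "x \<in> D" for x using gradient_eq[OF der[OF that]] .
  have oK: "open (- K)" using K(1) by (simp add: compact_imp_closed open_Compl)
  have der0: "(\<psi> has_derivative (\<lambda>h. 0 \<bullet> h)) (at x)" if "x \<notin> K" for x
  proof -
    have "(\<psi> has_derivative (\<lambda>h. 0)) (at x)"
      by (rule has_derivative_transform_within_open[OF has_derivative_const oK]) (use that K(3) in auto)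
    then show ?thesis by simp
  qed
  show g2: "gradient \<psi> x = 0" if "x \<notin> K" for x using gradient_eq[OF der0[OF that]] .
  have cg: "continuous_on (D \<union> - K) (gradient \<psi>)"
  proof (rule continuous_on_open_Un[OF D oK])
    show "continuous_on D (gradient \<psi>)" using cont g1 continuous_on_cong[of D D "gradient \<psi>" V] by simp
    show "continuous_on (- K) (gradient \<psi>)" using g2 continuous_on_cong[of "- K" "- K" "gradient \<psi>" "\<lambda>_. 0"] by simp
  qed
  have U: "D \<union> - K = UNIV" using K(2) by blast
  have "continuous_on UNIV (partial i \<psi>)" for i
  proof -
    have "continuous_on UNIV (\<lambda>x. gradient \<psi> x $ i)" using cg unfolding U by (intro continuous_intros)
    then show ?thesis by (simp add: gradient_nth)
  qed
  moreover have "\<psi> differentiable (at x)" for x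
    using der[of x] der0[of x] K(2) unfolding differentiable_def by blast
  ultimately show "C_k (Suc 0) \<psi>" by simp
qed

text \<open>Translation invariance replaces an iterated integral: \<open>h (z + v) - h z\<close>
  integrates to zero, while it equals \<open>t\<close> times the partial derivative up to an error
  \<open>e t\<close> on a fixed compact set. Dividing by \<open>t\<close> leaves \<open>e V\<close>
  for every \<open>e\<close>.\<close>

lemma integral_partial_zero:
  fixes h :: "real^'n::finite \<Rightarrow> real"
  assumes h: "C_k (Suc 0) h" and K: "compact K" "\<And>x. x \<notin> K \<Longrightarrow> h x = 0"
  shows "(LINT x|lborel. partial i h x) = 0"
proof -
  define K1 where "K1 = {x + y |x y. x \<in> K \<and> y \<in> cball 0 1}"
  have K1: "compact K1" unfolding K1_def by (intro compact_sums K compact_cball)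
  define V where "V = measure lborel K1"
  have V: "V \<ge> 0" unfolding V_def by simp
  have c: "continuous_on UNIV h" "continuous_on UNIV (partial i h)" using h C1_continuous by auto
  have int: "integrable lborel h" "integrable lborel (partial i h)"
  proof -
    show "integrable lborel h" by (rule continuous_compact_support_integrable[OF c(1) K])
    show "integrable lborel (partial i h)"
      by (rule continuous_compact_support_integrable[OF c(2) K(1)]) (rule partial_zero_outside[OF K])
  qed
  have est: "\<bar>LINT x|lborel. partial i h x\<bar> \<le> e * V" if e: "e > 0" for e
  proof -
    obtain d where d: "d > 0" "d \<le> 1"
      "\<And>z v. norm v < d \<Longrightarrow> \<bar>h (z + v) - h z - (\<Sum>i\<in>UNIV. v $ i * partial i h z)\<bar> \<le> e * norm v"
      using first_order_uniform[OF h K e] by metis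
    define t where "t = d / 2"
    define v :: "real^'n" where "v = t *\<^sub>R axis i 1"
    have t: "t > 0" and nv: "norm v = t" "norm v < d" "norm v \<le> 1" unfolding t_def v_def using d by (auto simp: norm_axis_1)
    define R where "R z = h (z + v) - h z - t * partial i h z" for z
    have sumv: "(\<Sum>j\<in>UNIV. v $ j * partial j h z) = t * partial i h z" for z
    proof -
      have "(\<Sum>j\<in>UNIV. v $ j * partial j h z) = (\<Sum>j\<in>UNIV. if j = i then t * partial j h z else 0)"
        by (rule sum.cong) (auto simp: axis_def v_def)
      then show ?thesis by simp
    qed
    have Rb: "\<bar>R z\<bar> \<le> e * t * indicator K1 z" for z
    proof (cases "z \<in> K1")
      case True
      then show ?thesis using d(3)[OF nv(2), of z] unfolding R_def sumv nv(1) by simp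
    next
      case False
      have "z = z + 0" "(0::real^'n) \<in> cball 0 1" by auto
      then have a: "z \<notin> K" using False unfolding K1_def by blast
      have "z = (z + v) + (- v)" "- v \<in> cball 0 1" using nv by auto
      then have "z + v \<notin> K" using False unfolding K1_def by blast
      then show ?thesis using a K(2) partial_zero_outside[where f = h and x = z and i = i, OF K] e t by (simp add: R_def)
    qed
    have sh: "integrable lborel (\<lambda>z. h (z + v))" "(LINT z|lborel. h (z + v)) = (LINT z|lborel. h z)"
    proof -
      have hm: "h \<in> borel_measurable borel" using c(1) by (rule borel_measurable_continuous_onI)
      have "integrable (distr lborel borel ((+) v)) h" using int by (simp add: lborel_distr_plus)
      then show "integrable lborel (\<lambda>z. h (z + v))" using hm by (subst (asm) integrable_distr_eq) (auto simp: add.commute)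
      have "(LINT z|lborel. h z) = (LINT z|distr lborel borel ((+) v). h z)" by (simp add: lborel_distr_plus)
      also have "\<dots> = (LINT z|lborel. h (v + z))" by (rule integral_distr) (use hm in auto)
      finally show "(LINT z|lborel. h (z + v)) = (LINT z|lborel. h z)" by (simp add: add.commute)
    qed
    have "(LINT z|lborel. R z) = - t * (LINT z|lborel. partial i h z)"
      unfolding R_def using int sh by simp
    moreover have "norm (LINT z|lborel. R z) \<le> (LINT z|lborel. e * t * indicator K1 z)"
    proof (rule order_trans[OF integral_norm_bound], rule integral_mono)
      show "integrable lborel (\<lambda>z. norm (R z))" unfolding R_def using int sh by simp
      show "integrable lborel (\<lambda>z. e * t * indicator K1 z :: real)"
        using K1 emeasure_compact_finite[OF K1] by (intro integrable_mult_right integrable_real_indicator) (auto simp: borel_compact)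
      show "norm (R z) \<le> e * t * indicator K1 z" for z using Rb by simp
    qed
    moreover have "(LINT z|lborel. e * t * indicator K1 z) = e * t * V" using K1 by (simp add: V_def borel_compact)
    ultimately have "t * \<bar>LINT z|lborel. partial i h z\<bar> \<le> t * (e * V)" using t e by (simp add: abs_mult mult_ac)
    then show ?thesis using t by simp
  qed
  show ?thesis by (rule eq_zero_if_le_epsilon_mult[OF V est])
qed

lemma C1_mult:
  "C_k (Suc 0) f \<Longrightarrow> C_k (Suc 0) g \<Longrightarrow> partial i (\<lambda>x. f x * g x) x = f x * partial i g x + partial i f x * g x"
  by (rule partial_mult) auto

lemma C1_has_weak_partial:
  fixes f :: "real^'n::finite \<Rightarrow> real"
  assumes f: "C_k (Suc 0) f"
  shows "has_weak_partial i f (partial i f)"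
  unfolding has_weak_partial_def
proof (intro conjI allI impI)
  have c: "continuous_on UNIV f" "continuous_on UNIV (partial i f)" using f C1_continuous by auto
  show l: "locally_integrable f" "locally_integrable (partial i f)" using c by (auto intro: continuous_locally_integrable)
  fix \<phi> :: "real^'n \<Rightarrow> real" assume \<phi>: "test_function \<phi>"
  obtain K where K: "compact K" "\<And>x. x \<notin> K \<Longrightarrow> \<phi> x = 0" using test_functionE[OF \<phi>] by blast
  have C1: "C_k (Suc 0) \<phi>" using \<phi> unfolding test_function_def by blast
  have "(LINT x|lborel. partial i (\<lambda>x. f x * \<phi> x) x) = 0"
    by (rule integral_partial_zero[OF C_k_mult[OF f C1] K(1)]) (simp add: K)
  then have "(LINT x|lborel. f x * partial i \<phi> x + partial i f x * \<phi> x) = 0" by (simp add: C1_mult[OF f C1])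
  moreover have "integrable lborel (\<lambda>x. partial i \<phi> x * f x)"
    by (rule locint_mult_integrable[OF l(1) _ K(1)]) (use C1 partial_zero_outside[OF K] in auto)
  moreover have "integrable lborel (\<lambda>x. \<phi> x * partial i f x)"
    by (rule locint_mult_integrable[OF l(2) _ K(1)]) (use C1_continuous[OF C1] K in auto)
  ultimately show "(LINT x|lborel. f x * partial i \<phi> x) = - (LINT x|lborel. partial i f x * \<phi> x)"
    by (simp add: mult.commute)
qed

text \<open>Convolving \<open>\<psi>\<close> at a scale small enough to stay inside \<open>D\<close>
  gives an admissible smooth test function. Its partial derivatives are the mollified partial
  derivatives of \<open>\<psi>\<close>, hence uniformly close to them. The error is measured by the
  integral of the components of \<open>A\<close> over \<open>K1\<close>, a set fixed before the
  scale is chosen.\<close>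

lemma weak_equation_C1:
  fixes A :: "real^'n::finite \<Rightarrow> real^'n"
  assumes A: "\<And>i. locally_integrable (\<lambda>x. A x $ i)" and D: "open D"
    and eq: "\<And>\<phi> L. test_function \<phi> \<Longrightarrow> compact L \<Longrightarrow> L \<subseteq> D \<Longrightarrow> (\<And>x. x \<notin> L \<Longrightarrow> \<phi> x = 0) \<Longrightarrow>
      (LINT x|lborel. A x \<bullet> gradient \<phi> x) = 0"
    and \<psi>: "C_k (Suc 0) \<psi>" and K: "compact K" "K \<subseteq> D" "\<And>x. x \<notin> K \<Longrightarrow> \<psi> x = 0"
  shows "(LINT x|lborel. A x \<bullet> gradient \<psi> x) = 0"
proof -
  have sumA: "A x \<bullet> gradient \<phi> x = (\<Sum>i\<in>UNIV. partial i \<phi> x * A x $ i)" for \<phi> x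
    by (simp add: inner_vec_def gradient_nth mult.commute)
  obtain r where r: "r > 0" "(\<Union>x\<in>K. ball x r) \<subseteq> D"
    using compact_subset_open_imp_ball_epsilon_subset[OF K(1) D K(2)] by blast
  define K1 where "K1 = {x + y |x y. x \<in> cball 0 1 \<and> y \<in> K}"
  have K1: "compact K1" unfolding K1_def by (intro compact_sums K compact_cball)
  have KK1: "K \<subseteq> K1"
  proof
    fix y assume "y \<in> K"
    moreover have "y = 0 + y" "(0::real^'n) \<in> cball 0 1" by auto
    ultimately show "y \<in> K1" unfolding K1_def by blast
  qed
  have intA: "integrable lborel (\<lambda>x. indicator K1 x *\<^sub>R A x $ i)" for i
    using A[of i] K1 unfolding locally_integrable_def set_integrable_def by blast
  define V where "V = (\<Sum>i\<in>UNIV. LINT x|lborel. \<bar>indicator K1 x *\<^sub>R A x $ i\<bar>)"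
  have V: "V \<ge> 0" unfolding V_def by (intro sum_nonneg integral_nonneg_AE) auto
  have est: "\<bar>LINT x|lborel. A x \<bullet> gradient \<psi> x\<bar> \<le> e * V" if e: "e > 0" for e
  proof -
    have "\<exists>d>0. d \<le> 1 \<and> (\<forall>x y. dist x y < d \<longrightarrow> \<bar>partial i \<psi> x - partial i \<psi> y\<bar> < e)" for i
      by (rule compact_support_uniformly_continuous[of "partial i \<psi>" K e])
        (use \<psi> K e partial_zero_outside[OF K(1,3)] in \<open>auto\<close>)
    then obtain Di where Di: "\<And>i. Di i > 0" "\<And>i. Di i \<le> 1" "\<And>i x y. dist x y < Di i \<Longrightarrow> \<bar>partial i \<psi> x - partial i \<psi> y\<bar> < e"
      by metis
    \<comment> \<open>Half of \<open>r\<close> keeps the closed \<open>d\<close>-neighbourhood of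
      \<open>K\<close> inside the open balls contained in \<open>D\<close>.\<close>
    define d where "d = min (r / 2) (Min (range Di))"
    have d: "d > 0" "d < r" "\<And>i. d \<le> Di i"
      unfolding d_def using Di(1) r by (auto simp: Min_gr_iff intro: min.coboundedI2)
    have d1: "d \<le> 1" using d(3) Di(2) by (meson order_trans)
    obtain \<rho> :: "real^'n \<Rightarrow> real" where \<rho>: "mollifier d \<rho>" using mollifier_exists[OF d(1)] by blast
    note m = mollifierD[OF \<rho>]
    define \<phi> where "\<phi> = conv \<rho> \<psi>"
    define L where "L = {a + b |a b. a \<in> cball 0 d \<and> b \<in> K}"
    have L: "compact L" unfolding L_def by (intro compact_sums K compact_cball)
    have LD: "L \<subseteq> D"
    proof
      fix x assume "x \<in> L"
      then obtain a b where "x = a + b" "norm a \<le> d" "b \<in> K" unfolding L_def by auto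
      then have "x \<in> ball b r" using d by (simp add: dist_norm)
      then show "x \<in> D" using r \<open>b \<in> K\<close> by blast
    qed
    have LK1: "L \<subseteq> K1"
    proof
      fix x assume "x \<in> L"
      then obtain a b where "x = a + b" "a \<in> cball 0 d" "b \<in> K" unfolding L_def by auto
      moreover then have "a \<in> cball 0 1" using d1 by simp
      ultimately show "x \<in> K1" unfolding K1_def by blast
    qed
    have t: "test_function \<phi>" "\<And>x. x \<notin> L \<Longrightarrow> \<phi> x = 0"
      using test_function_conv[OF C1_continuous[OF \<psi>] K(1,3) m(1) compact_cball m(5)] unfolding \<phi>_def L_def by blast+
    have p\<phi>: "partial i \<phi> x = conv \<rho> (partial i \<psi>) x" for i x
      unfolding \<phi>_def using partial_conv[OF continuous_locally_integrable[OF C1_continuous[OF \<psi>]] m(1)]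
        conv_weak_partial[OF C1_has_weak_partial[OF \<psi>] m(1)] by simp
    have close: "\<bar>partial i \<psi> x - partial i \<phi> x\<bar> \<le> e" for i x
    proof -
      have "\<bar>conv \<rho> (partial i \<psi>) x - partial i \<psi> x\<bar> \<le> e"
      proof (rule conv_approx[OF _ \<rho>])
        show "locally_integrable (partial i \<psi>)" using \<psi> by (intro continuous_locally_integrable) auto
        show "\<bar>partial i \<psi> y - partial i \<psi> x\<bar> \<le> e" if "dist x y < d" for y
          using Di(3)[of y x i] that d(3)[of i] by (simp add: dist_commute)
      qed
      then show ?thesis unfolding p\<phi> by linarith
    qed
    have int1: "integrable lborel (\<lambda>x. partial i \<psi> x * A x $ i)" for i
      by (rule locint_mult_integrable[OF A _ K(1)]) (use \<psi> partial_zero_outside[OF K(1,3)] in auto)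
    have C1\<phi>: "C_k (Suc 0) \<phi>" using t(1) unfolding test_function_def by blast
    have int2: "integrable lborel (\<lambda>x. partial i \<phi> x * A x $ i)" for i
      by (rule locint_mult_integrable[OF A _ L]) (use C1\<phi> partial_zero_outside[OF L t(2)] in auto)
    have z: "(LINT x|lborel. A x \<bullet> gradient \<phi> x) = 0" by (rule eq[OF t(1) L LD t(2)])
    have i1: "integrable lborel (\<lambda>x. A x \<bullet> gradient \<psi> x)" unfolding sumA using int1 by (intro Bochner_Integration.integrable_sum)
    have i2: "integrable lborel (\<lambda>x. A x \<bullet> gradient \<phi> x)" unfolding sumA using int2 by (intro Bochner_Integration.integrable_sum)
    have "(LINT x|lborel. A x \<bullet> gradient \<psi> x) = (LINT x|lborel. A x \<bullet> gradient \<psi> x - A x \<bullet> gradient \<phi> x)"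
      using z i1 i2 by simp
    moreover have "norm (LINT x|lborel. A x \<bullet> gradient \<psi> x - A x \<bullet> gradient \<phi> x) \<le> (LINT x|lborel. (\<Sum>i\<in>UNIV. e * \<bar>indicator K1 x *\<^sub>R A x $ i\<bar>))"
    proof (rule order_trans[OF integral_norm_bound], rule integral_mono)
      show "integrable lborel (\<lambda>x. norm (A x \<bullet> gradient \<psi> x - A x \<bullet> gradient \<phi> x))" using i1 i2 by simp
      show "integrable lborel (\<lambda>x. \<Sum>i\<in>UNIV. e * \<bar>indicator K1 x *\<^sub>R A x $ i\<bar>)"
        by (intro Bochner_Integration.integrable_sum integrable_mult_right integrable_abs intA)
      fix x
      have "A x \<bullet> gradient \<psi> x - A x \<bullet> gradient \<phi> x = (\<Sum>i\<in>UNIV. (partial i \<psi> x - partial i \<phi> x) * A x $ i)"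
        unfolding sumA by (simp add: sum_subtractf left_diff_distrib)
      also have "norm \<dots> \<le> (\<Sum>i\<in>UNIV. e * \<bar>indicator K1 x *\<^sub>R A x $ i\<bar>)"
      proof (rule sum_norm_le)
        fix i
        show "norm ((partial i \<psi> x - partial i \<phi> x) * A x $ i) \<le> e * \<bar>indicator K1 x *\<^sub>R A x $ i\<bar>"
        proof (cases "x \<in> K1")
          case True
          then show ?thesis using close[of i x] by (auto simp: abs_mult intro: mult_right_mono)
        next
          case False
          then have "x \<notin> K" "x \<notin> L" using KK1 LK1 by auto
          then show ?thesis using partial_zero_outside[where f = \<psi> and x = x and i = i, OF K(1,3)]
              partial_zero_outside[where f = \<phi> and x = x and i = i, OF L t(2)] e by simp
        qed
      qed
      finally show "norm (A x \<bullet> gradient \<psi> x - A x \<bullet> gradient \<phi> x) \<le> (\<Sum>i\<in>UNIV. e * \<bar>indicator K1 x *\<^sub>R A x $ i\<bar>)" .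
    qed
    moreover have "(LINT x|lborel. (\<Sum>i\<in>UNIV. e * \<bar>indicator K1 x *\<^sub>R A x $ i\<bar>)) = e * V"
      unfolding V_def using intA by (simp add: Bochner_Integration.integral_sum sum_distrib_left)
    ultimately show ?thesis by simp
  qed
  show ?thesis by (rule eq_zero_if_le_epsilon_mult[OF V est])
qed

text \<open>Each product of \<open>\<psi>\<close> with a component of \<open>X\<close> has a partial
  derivative of integral zero; the product rule and summation give the identity. \<open>X\<close> is
  differentiable on \<open>D\<close> only, so the products are extended by zero with
  \<open>C1_glue\<close>.\<close>

lemma divergence_identity:
  fixes X :: "real^'n::finite \<Rightarrow> real^'n" and V :: "'n \<Rightarrow> real^'n \<Rightarrow> real^'n"
  assumes D: "open D"
    and der: "\<And>x i. x \<in> D \<Longrightarrow> ((\<lambda>x. X x $ i) has_derivative (\<lambda>h. V i x \<bullet> h)) (at x)"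
    and cont: "\<And>i. continuous_on D (V i)"
    and \<psi>: "C_k (Suc 0) \<psi>" and K: "compact K" "K \<subseteq> D" "\<And>x. x \<notin> K \<Longrightarrow> \<psi> x = 0"
  shows "(LINT x|lborel. X x \<bullet> gradient \<psi> x) = (LINT x|lborel. - (\<Sum>i\<in>UNIV. V i x $ i) * \<psi> x)"
proof -
  have contX: "continuous_on D (\<lambda>x. X x $ i)" for i
    using der by (intro differentiable_imp_continuous_on) (auto simp: differentiable_on_def differentiable_def intro: has_derivative_at_withinI)
  have d\<psi>: "(\<psi> has_derivative (\<lambda>h. gradient \<psi> x \<bullet> h)) (at x)" for x
    using \<psi> by (intro has_derivative_gradient) auto
  define h where "h i x = X x $ i * \<psi> x" for i x
  have dh: "(h i has_derivative (\<lambda>v. (X x $ i *\<^sub>R gradient \<psi> x + \<psi> x *\<^sub>R V i x) \<bullet> v)) (at x)" if "x \<in> D" for i x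
    unfolding h_def using has_derivative_mult[OF der[OF that, of i] d\<psi>[of x]] by (simp add: inner_add_left mult.commute)
  have ch: "continuous_on D (\<lambda>x. X x $ i *\<^sub>R gradient \<psi> x + \<psi> x *\<^sub>R V i x)" for i
    using C1_continuous_gradient[OF \<psi>] C1_continuous[OF \<psi>]
    by (intro continuous_intros contX cont) (auto intro: continuous_on_subset)
  have z: "h i x = 0" if "x \<notin> K" for i x using K(3)[OF that] by (simp add: h_def)
  have glue: "C_k (Suc 0) (h i)" "\<And>x. x \<in> D \<Longrightarrow> gradient (h i) x = X x $ i *\<^sub>R gradient \<psi> x + \<psi> x *\<^sub>R V i x"
      "\<And>x. x \<notin> K \<Longrightarrow> gradient (h i) x = 0" for i
    using C1_glue[where V = "\<lambda>x. X x $ i *\<^sub>R gradient \<psi> x + \<psi> x *\<^sub>R V i x", OF D K(1,2) z dh ch] by blast+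
  have int0: "(LINT x|lborel. partial i (h i) x) = 0" for i
    by (rule integral_partial_zero[OF glue(1) K(1)]) (rule z)
  have ig: "integrable lborel (partial i (h i))" for i
  proof (rule continuous_compact_support_integrable[OF _ K(1)])
    show "continuous_on UNIV (partial i (h i))" using glue(1)[of i] by simp
    show "partial i (h i) x = 0" if "x \<notin> K" for x
      using glue(3)[OF that] gradient_nth[of "h i" x i] by simp
  qed
  have pw: "(\<Sum>i\<in>UNIV. partial i (h i) x) = X x \<bullet> gradient \<psi> x - (- (\<Sum>i\<in>UNIV. V i x $ i) * \<psi> x)" for x
  proof (cases "x \<in> D")
    case True
    have "partial i (h i) x = X x $ i * gradient \<psi> x $ i + \<psi> x * V i x $ i" for i
      using glue(2)[OF True] gradient_nth[of "h i" x i] by simp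
    then show ?thesis by (simp add: sum.distrib inner_vec_def sum_distrib_left sum_distrib_right mult.commute)
  next
    case False
    then have xK: "x \<notin> K" using K(2) by blast
    have "gradient \<psi> x = 0"
      unfolding vec_eq_iff gradient_nth using partial_zero_outside[where f = \<psi> and x = x, OF K(1,3) xK] by simp
    moreover have "partial i (h i) x = 0" for i using glue(3)[OF xK] gradient_nth[of "h i" x i] by simp
    ultimately show ?thesis using K(3)[OF xK] by simp
  qed
  have i1: "integrable lborel (\<lambda>x. X x \<bullet> gradient \<psi> x)"
  proof -
    have "integrable lborel (\<lambda>x. indicator K x *\<^sub>R (X x \<bullet> gradient \<psi> x))"
    proof (rule borel_integrable_compact[OF K(1)])
      have "continuous_on D (\<lambda>x. \<Sum>i\<in>UNIV. X x $ i * gradient \<psi> x $ i)"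
        by (intro continuous_intros contX continuous_on_subset[OF C1_continuous_gradient[OF \<psi>]]) auto
      then show "continuous_on K (\<lambda>x. X x \<bullet> gradient \<psi> x)"
        using K(2) by (auto simp: inner_vec_def intro: continuous_on_subset)
    qed
    moreover have "indicator K x *\<^sub>R (X x \<bullet> gradient \<psi> x) = X x \<bullet> gradient \<psi> x" for x
    proof (cases "x \<in> K")
      case False
      then have "gradient \<psi> x = 0"
        unfolding vec_eq_iff gradient_nth using partial_zero_outside[where f = \<psi> and x = x, OF K(1,3)] by simp
      then show ?thesis by simp
    qed simp
    ultimately show ?thesis by (simp only:)
  qed
  have i2: "integrable lborel (\<lambda>x. - (\<Sum>i\<in>UNIV. V i x $ i) * \<psi> x)"
  proof -
    have "integrable lborel (\<lambda>x. X x \<bullet> gradient \<psi> x - (\<Sum>i\<in>UNIV. partial i (h i) x))"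
      using i1 ig by (intro Bochner_Integration.integrable_diff Bochner_Integration.integrable_sum)
    then show ?thesis unfolding pw by simp
  qed
  have "(LINT x|lborel. (\<Sum>i\<in>UNIV. partial i (h i) x)) = 0"
    using ig int0 by (simp add: Bochner_Integration.integral_sum)
  then show ?thesis unfolding pw using i1 i2 by simp
qed

section \<open>Comparison principle\<close>

text \<open>Squaring the positive part removes its corner; this is what keeps the truncated
  difference in the test function continuously differentiable.\<close>

lemma quadratic_ramp_deriv:
  "((\<lambda>t. (max 0 (t - c))\<^sup>2) has_real_derivative 2 * max 0 (t - c)) (at (t::real))"
proof -
  consider "t > c" | "t < c" | "t = c" by linarith
  then show ?thesis
  proof cases
    case 1
    have "((\<lambda>t. (t - c)\<^sup>2) has_real_derivative 2 * max 0 (t - c)) (at t)"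
      using 1 by (auto intro!: derivative_eq_intros)
    moreover have "eventually (\<lambda>x. x \<in> {c<..}) (nhds t)" using 1 by (intro eventually_nhds_in_open) auto
    then have "eventually (\<lambda>x. (x - c)\<^sup>2 = (max 0 (x - c))\<^sup>2) (nhds t)" by eventually_elim simp
    ultimately show ?thesis by (rule DERIV_cong_ev[OF refl _ refl, THEN iffD1, rotated])
  next
    case 2
    have "((\<lambda>t. 0) has_real_derivative 2 * max 0 (t - c)) (at t)"
      using 2 by simp
    moreover have "eventually (\<lambda>x. x \<in> {..<c}) (nhds t)" using 2 by (intro eventually_nhds_in_open) auto
    then have "eventually (\<lambda>x. 0 = (max 0 (x - c))\<^sup>2) (nhds t)" by eventually_elim simp
    ultimately show ?thesis by (rule DERIV_cong_ev[OF refl _ refl, THEN iffD1, rotated])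
  next
    case 3
    have "((\<lambda>h. ((max 0 (c + h - c))\<^sup>2 - (max 0 (c - c))\<^sup>2) / h) \<longlongrightarrow> 0) (at 0)"
    proof (rule Lim_null_comparison)
      show "\<forall>\<^sub>F h in at 0. norm (((max 0 (c + h - c))\<^sup>2 - (max 0 (c - c))\<^sup>2) / h) \<le> \<bar>h\<bar>"
        by (intro always_eventually allI) (auto simp: max_def power2_eq_square)
      show "((\<lambda>h::real. \<bar>h\<bar>) \<longlongrightarrow> 0) (at 0)" by (auto intro!: tendsto_eq_intros)
    qed
    then show ?thesis unfolding DERIV_def using 3 by simp
  qed
qed

text \<open>Composing two quadratic ramps in \<open>t = |x|^2 / R^2\<close> avoids the corner of the
  norm at the origin: \<open>c\<close> is 1 for \<open>t \<le> 1\<close> and 0 for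
  \<open>t \<ge> 2\<close>. Where \<open>t < 2\<close> one has \<open>|c'| \<le> 4\<close> and
  \<open>|x| < 2 R\<close>, which yields \<open>4 (2 / R^2) (2 R) = 16 / R\<close>.\<close>

lemma cutoff_exists:
  assumes R: "R > 0"
  obtains \<eta> :: "real^'n::finite \<Rightarrow> real" where "C_k (Suc 0) \<eta>" "\<And>x. 0 \<le> \<eta> x" "\<And>x. \<eta> x \<le> 1"
    "\<And>x. norm x \<le> R \<Longrightarrow> \<eta> x = 1" "\<And>x. norm x \<ge> 2 * R \<Longrightarrow> \<eta> x = 0"
    "\<And>x. norm (gradient \<eta> x) \<le> 16 / R" "\<And>x. norm x < R \<Longrightarrow> gradient \<eta> x = 0"
    "\<And>x. norm x \<ge> 2 * R \<Longrightarrow> gradient \<eta> x = 0"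
proof -
  define q where "q t = (max 0 (t - 1))\<^sup>2" for t :: real
  \<comment> \<open>The inner expression is \<open>1 - q t\<close>, written as a ramp in
    \<open>- q t\<close> with threshold -1 to match \<open>quadratic_ramp_deriv\<close>.\<close>
  define c where "c t = (max 0 (- q t - (-1)))\<^sup>2" for t
  define c' where "c' t = 2 * max 0 (1 - q t) * (- (2 * max 0 (t - 1)))" for t
  have Dq: "(q has_real_derivative 2 * max 0 (t - 1)) (at t)" for t
    unfolding q_def by (rule quadratic_ramp_deriv)
  have Dc: "(c has_real_derivative c' t) (at t)" for t
    unfolding c_def c'_def
    by (rule DERIV_cong[OF DERIV_chain2[OF quadratic_ramp_deriv DERIV_minus[OF Dq]]]) simp
  define \<eta> where "\<eta> x = c ((x \<bullet> x) / R\<^sup>2)" for x :: "real^'n"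
  define V where "V x = (c' ((x \<bullet> x) / R\<^sup>2) * (2 / R\<^sup>2)) *\<^sub>R x" for x :: "real^'n"
  have D\<eta>: "(\<eta> has_derivative (\<lambda>h. V x \<bullet> h)) (at x)" for x
  proof -
    have "((\<lambda>x. (x \<bullet> x) / R\<^sup>2) has_derivative (\<lambda>h. (x \<bullet> h + h \<bullet> x) / R\<^sup>2)) (at x)"
      using has_derivative_mult_left[OF has_derivative_inner[OF has_derivative_ident has_derivative_ident], of "1 / R\<^sup>2" x UNIV]
      by simp
    from DERIV_compose_FDERIV[OF Dc this] show ?thesis
      unfolding \<eta>_def V_def by (simp add: inner_commute field_simps)
  qed
  have cV: "continuous_on UNIV V"
    unfolding V_def c'_def q_def by (intro continuous_intros)  (use R in auto)
  have g: "gradient \<eta> x = V x" for x by (rule gradient_eq[OF D\<eta>])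
  have C1: "C_k (Suc 0) \<eta>"
  proof -
    have "continuous_on UNIV (partial i \<eta>)" for i
    proof -
      have "continuous_on UNIV (\<lambda>x. V x $ i)" by (intro continuous_intros cV)
      moreover have "(\<lambda>x. V x $ i) = partial i \<eta>" using g by (auto simp flip: gradient_nth)
      ultimately show ?thesis by (simp only:)
    qed
    moreover have "\<eta> differentiable (at x)" for x using D\<eta> unfolding differentiable_def by blast
    ultimately show ?thesis by simp
  qed
  have nx: "(x \<bullet> x) / R\<^sup>2 = (norm x / R)\<^sup>2" for x :: "real^'n" by (simp add: power_divide power2_norm_eq_inner)
  have q0: "q t \<ge> 0" for t unfolding q_def by simp
  have small: "(norm x / R)\<^sup>2 \<le> 1" if "norm x \<le> R" for x :: "real^'n"
    using that R by (simp add: power_le_one)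
  have big: "(norm x / R)\<^sup>2 \<ge> 4" if "norm x \<ge> 2 * R" for x :: "real^'n"
  proof -
    have "norm x / R \<ge> 2" using that R by (simp add: field_simps)
    then have "(norm x / R)\<^sup>2 \<ge> 2\<^sup>2" by (intro power_mono) auto
    then show ?thesis by simp
  qed
  have c'0: "c' t = 0" if "t \<le> 1" for t using that unfolding c'_def by simp
  have big0: "c t = 0" "c' t = 0" if "t \<ge> 2" for t
  proof -
    have "(t - 1)\<^sup>2 \<ge> 1\<^sup>2" using that by (intro power_mono) auto
    then have "q t \<ge> 1" unfolding q_def using that by simp
    then show "c t = 0" "c' t = 0" unfolding c_def c'_def by auto
  qed
  show ?thesis
  proof (rule that[OF C1])
    show "0 \<le> \<eta> x" for x unfolding \<eta>_def c_def by simp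
    show "\<eta> x \<le> 1" for x unfolding \<eta>_def c_def using q0 by (intro power_le_one) auto
    show "\<eta> x = 1" if "norm x \<le> R" for x
      unfolding \<eta>_def nx c_def q_def using small[OF that] by simp
    show "\<eta> x = 0" if "norm x \<ge> 2 * R" for x unfolding \<eta>_def nx using big[OF that] big0 by simp
    show "gradient \<eta> x = 0" if "norm x < R" for x
      unfolding g V_def nx using small[of x] that c'0 by simp
    show "gradient \<eta> x = 0" if "norm x \<ge> 2 * R" for x
      unfolding g V_def nx using big[OF that] big0 by simp
    show "norm (gradient \<eta> x) \<le> 16 / R" for x
    proof (cases "(norm x / R)\<^sup>2 < 2")
      case True
      let ?t = "(norm x / R)\<^sup>2"
      have "norm x < 2 * R" using big[of x] True by fastforce
      have "\<bar>c' ?t\<bar> = 2 * max 0 (1 - q ?t) * (2 * max 0 (?t - 1))" unfolding c'_def by (simp add: abs_mult)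
      also have "\<dots> \<le> 2 * 1 * (2 * 1)" using True q0[of ?t] by (intro mult_mono) auto
      finally have c4: "\<bar>c' ?t\<bar> \<le> 4" by simp
      have "norm (gradient \<eta> x) = \<bar>c' ?t\<bar> * (2 / R\<^sup>2 * norm x)" unfolding g V_def nx by (simp add: abs_mult)
      also have "\<dots> \<le> 4 * (2 / R\<^sup>2 * (2 * R))"
        using c4 \<open>norm x < 2 * R\<close> by (intro mult_mono) (auto intro!: divide_right_mono)
      also have "\<dots> = 16 / R" using R by (simp add: power2_eq_square)
      finally show ?thesis .
    next
      case False
      then show ?thesis unfolding g V_def nx using big0[of "(norm x / R)\<^sup>2"] R by simp
    qed
  qed
qed

text \<open>\<open>powr_young\<close> splits the integrand. The part with \<open>a\<close> has mass
  at most \<open>\<delta> 2^p I\<close>, small by the choice of \<open>\<delta>\<close>; the rest is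
  a constant times \<open>R^(-p)\<close> on a ball of volume of order \<open>R^n\<close>, hence of
  order \<open>R^(n-p)\<close>. Because \<open>\<delta>\<close> is small, integrating over the whole
  ball and not just over the annulus where the cutoff varies does no harm.\<close>

lemma annulus_estimate:
  fixes a :: "real^'n::finite \<Rightarrow> real"
  assumes p: "p > real CARD('n)" and a: "a \<in> borel_measurable borel" "\<And>x. a x \<ge> 0" "integrable lborel (\<lambda>x. a x powr p)"
    and C: "C \<ge> 0" and e: "e > 0"
  obtains R0 where "R0 > 0"
    "\<And>R. R \<ge> R0 \<Longrightarrow> integrable lborel (\<lambda>x. (a x + C / R) powr (p - 1) * (16 / R) * indicator (cball 0 (2 * R)) x)"
    "\<And>R. R \<ge> R0 \<Longrightarrow> (LINT x|lborel. (a x + C / R) powr (p - 1) * (16 / R) * indicator (cball 0 (2 * R)) x) \<le> e"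
proof -
  have n1: "real CARD('n) \<ge> 1" by (simp add: Suc_leI)
  have p1: "p > 1" using p n1 by linarith
  define I where "I = (LINT x|lborel. a x powr p)"
  have I: "I \<ge> 0" unfolding I_def by (rule integral_nonneg_AE) simp
  define J where "J = I + 1"
  have J: "J > 0" "I \<le> J" unfolding J_def using I by auto
  define \<delta> where "\<delta> = e / (2 * (2 powr p * J))"
  have \<delta>: "\<delta> > 0" unfolding \<delta>_def using e J by simp
  have "\<delta> * 2 powr p * J = e / 2" unfolding \<delta>_def using J by simp
  moreover have "\<delta> * 2 powr p * I \<le> \<delta> * 2 powr p * J" by (rule mult_left_mono[OF J(2)]) (use \<delta> in simp)
  ultimately have \<delta>I: "\<delta> * 2 powr p * I \<le> e / 2" by (simp only:)
  define \<omega> where "\<omega> = unit_ball_vol (real DIM(real^'n)) * 2 ^ CARD('n)"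
  define Q where "Q = \<delta> * 2 powr p * C powr p + \<delta> powr (1 - p) * 16 powr p"
  have "((\<lambda>R. Q * \<omega> * R powr (real CARD('n) - p)) \<longlongrightarrow> Q * \<omega> * 0) at_top"
    by (intro tendsto_intros tendsto_neg_powr) (use p in \<open>auto intro: filterlim_ident\<close>)
  then have "\<forall>\<^sub>F R in at_top. Q * \<omega> * R powr (real CARD('n) - p) < e / 2"
    by (rule order_tendstoD(2)) (use e in simp)
  then obtain R0 where R0: "\<And>R. R \<ge> R0 \<Longrightarrow> Q * \<omega> * R powr (real CARD('n) - p) < e / 2"
    unfolding eventually_at_top_linorder by blast
  have main: "integrable lborel (\<lambda>x. (a x + C / R) powr (p - 1) * (16 / R) * indicator (cball 0 (2 * R)) x)
    \<and> (LINT x|lborel. (a x + C / R) powr (p - 1) * (16 / R) * indicator (cball 0 (2 * R)) x) \<le> e" if R: "R \<ge> max 1 R0" for R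
  proof -
    have Rpos: "R > 0" using R by simp
    let ?B = "\<lambda>x::real^'n. indicator (cball 0 (2 * R)) x :: real"
    define q where "q = \<delta> * 2 powr p * (C / R) powr p + \<delta> powr (1 - p) * (16 / R) powr p"
    have pw: "(a x + C / R) powr (p - 1) * (16 / R) * ?B x \<le> \<delta> * 2 powr p * a x powr p + q * ?B x" for x
    proof (cases "x \<in> cball 0 (2 * R)")
      case True
      have "(a x + C / R) powr (p - 1) * (16 / R) \<le> \<delta> * (a x + C / R) powr p + \<delta> powr (1 - p) * (16 / R) powr p"
        using a(2)[of x] C Rpos \<delta> p1 by (intro powr_young) auto
      also have "\<dots> \<le> \<delta> * (2 powr p * (a x powr p + (C / R) powr p)) + \<delta> powr (1 - p) * (16 / R) powr p"
        using a(2)[of x] C Rpos \<delta> p1 by (intro add_right_mono mult_left_mono powr_add_le) auto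
      finally show ?thesis using True unfolding q_def by (simp add: algebra_simps)
    next
      case False
      then show ?thesis using \<delta> by simp
    qed
    have iB: "integrable lborel ?B"
      using emeasure_lborel_cball_finite[of "0::real^'n" "2 * R"] by (intro integrable_real_indicator) auto
    have ib: "integrable lborel (\<lambda>x. \<delta> * 2 powr p * a x powr p + q * ?B x)"
      using a(3) iB by (intro Bochner_Integration.integrable_add integrable_mult_right)
    have meas: "(\<lambda>x. (a x + C / R) powr (p - 1) * (16 / R) * ?B x) \<in> borel_measurable lborel"
      by (rule borel_measurable_times[OF _ borel_measurable_integrable[OF iB]]) (use a(1) in measurable)
    have int: "integrable lborel (\<lambda>x. (a x + C / R) powr (p - 1) * (16 / R) * ?B x)"
    proof (rule Bochner_Integration.integrable_bound[OF ib meas], intro always_eventually allI)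
      fix x
      have "0 \<le> (a x + C / R) powr (p - 1) * (16 / R) * ?B x" using Rpos by simp
      then show "norm ((a x + C / R) powr (p - 1) * (16 / R) * ?B x) \<le> norm (\<delta> * 2 powr p * a x powr p + q * ?B x)"
        using pw[of x] by simp
    qed
    have "(LINT x|lborel. (a x + C / R) powr (p - 1) * (16 / R) * ?B x) \<le> (LINT x|lborel. \<delta> * 2 powr p * a x powr p + q * ?B x)"
      by (rule integral_mono[OF int ib pw])
    also have "\<dots> = \<delta> * 2 powr p * I + q * measure lborel (cball (0::real^'n) (2 * R))"
      using a(3) iB unfolding I_def by simp
    also have "measure lborel (cball (0::real^'n) (2 * R)) = \<omega> * R ^ CARD('n)"
      using content_cball[of "2 * R" "0::real^'n"] Rpos by (simp add: \<omega>_def power_mult_distrib)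
    also have "q * (\<omega> * R ^ CARD('n)) = Q * \<omega> * R powr (real CARD('n) - p)"
    proof -
      have "q = Q * R powr (- p)"
      proof -
        have "(C / R) powr p = C powr p * R powr (- p)" "(16 / R) powr p = 16 powr p * R powr (- p)"
          by (simp_all add: powr_divide powr_minus_divide)
        then show ?thesis unfolding q_def Q_def by (simp add: algebra_simps)
      qed
      moreover have "R powr (- p) * R ^ CARD('n) = R powr (real CARD('n) - p)"
        using Rpos by (simp add: powr_realpow[symmetric] flip: powr_add)
      ultimately show ?thesis by (simp add: mult_ac)
    qed
    also have "\<delta> * 2 powr p * I + Q * \<omega> * R powr (real CARD('n) - p) \<le> e"
      using \<delta>I R0[of R] R by simp
    finally show ?thesis using int by blast
  qed
  show ?thesis by (rule that[of "max 1 R0"]) (use main in auto)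
qed

section \<open>Monotonicity and growth of the p-flux\<close>

lemma p_flux_monotone:
  fixes a b :: "'a::real_inner"
  assumes "p \<ge> 2"
  shows "((norm a powr (p - 2)) *\<^sub>R a - (norm b powr (p - 2)) *\<^sub>R b) \<bullet> (a - b) \<ge> 0"
proof -
  let ?A = "norm a powr (p - 2)" and ?B = "norm b powr (p - 2)"
  \<comment> \<open>Cauchy-Schwarz reduces the claim to the norms, where it says that
    \<open>t^(p-1)\<close> is increasing.\<close>
  have ab: "a \<bullet> b \<le> norm a * norm b" by (rule norm_cauchy_schwarz)
  have "(?A *\<^sub>R a - ?B *\<^sub>R b) \<bullet> (a - b) = ?A * (norm a)\<^sup>2 + ?B * (norm b)\<^sup>2 - (?A + ?B) * (a \<bullet> b)"
    by (simp add: inner_diff_left inner_diff_right inner_commute power2_norm_eq_inner algebra_simps)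
  also have "\<dots> \<ge> ?A * (norm a)\<^sup>2 + ?B * (norm b)\<^sup>2 - (?A + ?B) * (norm a * norm b)"
    using ab by (intro diff_left_mono mult_left_mono) auto
  also have "?A * (norm a)\<^sup>2 + ?B * (norm b)\<^sup>2 - (?A + ?B) * (norm a * norm b) = (?A * norm a - ?B * norm b) * (norm a - norm b)"
    by (simp add: algebra_simps power2_eq_square)
  finally have 1: "(?A *\<^sub>R a - ?B *\<^sub>R b) \<bullet> (a - b) \<ge> (?A * norm a - ?B * norm b) * (norm a - norm b)" .
  have mono: "x powr (p - 2) * x \<le> y powr (p - 2) * y" if "0 \<le> x" "x \<le> y" for x y :: real
    using that assms by (intro mult_mono powr_mono2) auto
  have "(?A * norm a - ?B * norm b) * (norm a - norm b) \<ge> 0"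
  proof (cases "norm a \<le> norm b")
    case True
    then show ?thesis using mono[of "norm a" "norm b"] by (simp add: mult_nonpos_nonpos)
  next
    case False
    then show ?thesis using mono[of "norm b" "norm a"] by simp
  qed
  with 1 show ?thesis by linarith
qed

lemma p_flux_norm:
  fixes a :: "'a::real_inner"
  assumes "p \<ge> 2"
  shows "norm ((norm a powr (p - 2)) *\<^sub>R a) = norm a powr (p - 1)"
  using powr_mult_base[of "norm a" "p - 2"] by (simp add: mult.commute)

lemma p_flux_diff_norm:
  fixes a b :: "'a::real_inner"
  assumes "p \<ge> 2"
  shows "norm ((norm a powr (p - 2)) *\<^sub>R a - (norm b powr (p - 2)) *\<^sub>R b) \<le> 2 * (norm a + norm b) powr (p - 1)"
proof -
  have "norm ((norm a powr (p - 2)) *\<^sub>R a - (norm b powr (p - 2)) *\<^sub>R b) \<le> norm a powr (p - 1) + norm b powr (p - 1)"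
    using norm_triangle_ineq4[of "(norm a powr (p - 2)) *\<^sub>R a" "(norm b powr (p - 2)) *\<^sub>R b"] unfolding p_flux_norm[OF assms] .
  also have "\<dots> \<le> (norm a + norm b) powr (p - 1) + (norm a + norm b) powr (p - 1)"
    using assms by (intro add_mono powr_mono2) auto
  finally show ?thesis by simp
qed

section \<open>Vector fields with components in L^p\<close>

lemma borel_measurable_cart:
  fixes f :: "real^'n::finite \<Rightarrow> real^'n"
  assumes "\<And>i. (\<lambda>x. f x $ i) \<in> borel_measurable borel"
  shows "f \<in> borel_measurable borel"
proof (subst borel_measurable_euclidean_space, rule ballI)
  fix b :: "real^'n" assume "b \<in> Basis"
  then obtain i where "b = axis i 1" unfolding Basis_vec_def by auto
  then show "(\<lambda>x. f x \<bullet> b) \<in> borel_measurable borel" using assms[of i] by (simp add: inner_axis)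
qed

lemma sum_powr_le:
  fixes f :: "'i \<Rightarrow> real"
  assumes "finite I" "\<And>i. i \<in> I \<Longrightarrow> f i \<ge> 0" "p \<ge> 0"
  shows "(\<Sum>i\<in>I. f i) powr p \<le> (real (card I)) powr p * (\<Sum>i\<in>I. f i powr p)"
proof (cases "I = {}")
  case False
  define M where "M = Max (f ` I)"
  have M: "M \<in> f ` I" "\<And>i. i \<in> I \<Longrightarrow> f i \<le> M" unfolding M_def using assms(1) False by auto
  then obtain j where j: "j \<in> I" "f j = M" by auto
  have "(\<Sum>i\<in>I. f i) \<le> real (card I) * M" using sum_mono[of I f "\<lambda>_. M"] M by simp
  then have "(\<Sum>i\<in>I. f i) powr p \<le> (real (card I) * M) powr p" using assms by (intro powr_mono2 sum_nonneg) auto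
  also have "\<dots> = real (card I) powr p * f j powr p" using j assms by (simp add: powr_mult)
  also have "\<dots> \<le> real (card I) powr p * (\<Sum>i\<in>I. f i powr p)"
    using j assms(1) by (intro mult_left_mono member_le_sum) auto
  finally show ?thesis .
qed simp

lemma norm_Lp:
  fixes f :: "real^'n::finite \<Rightarrow> real^'n"
  assumes "\<And>i. in_Lp p (\<lambda>x. f x $ i)" "p \<ge> 0"
  shows "f \<in> borel_measurable borel" "integrable lborel (\<lambda>x. norm (f x) powr p)"
proof -
  have m: "(\<lambda>x. f x $ i) \<in> borel_measurable borel" for i using assms(1)[of i] unfolding in_Lp_def by simp
  show fm: "f \<in> borel_measurable borel" by (rule borel_measurable_cart[OF m])
  have ib: "integrable lborel (\<lambda>x. real CARD('n) powr p * (\<Sum>i\<in>UNIV. \<bar>f x $ i\<bar> powr p))"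
    using assms(1) unfolding in_Lp_def by (intro integrable_mult_right Bochner_Integration.integrable_sum) auto
  show "integrable lborel (\<lambda>x. norm (f x) powr p)"
  proof (rule Bochner_Integration.integrable_bound[OF ib])
    show "(\<lambda>x. norm (f x) powr p) \<in> borel_measurable lborel" using fm by measurable
    show "AE x in lborel. norm (norm (f x) powr p) \<le> norm (real CARD('n) powr p * (\<Sum>i\<in>UNIV. \<bar>f x $ i\<bar> powr p))"
    proof (intro always_eventually allI)
      fix x
      have "norm (f x) powr p \<le> (\<Sum>i\<in>UNIV. \<bar>f x $ i\<bar>) powr p"
        using assms(2) norm_le_l1_cart by (intro powr_mono2) auto
      also have "\<dots> \<le> real CARD('n) powr p * (\<Sum>i\<in>UNIV. \<bar>f x $ i\<bar> powr p)"
        using assms(2) sum_powr_le[of UNIV "\<lambda>i. \<bar>f x $ i\<bar>" p] by simp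
      finally show "norm (norm (f x) powr p) \<le> norm (real CARD('n) powr p * (\<Sum>i\<in>UNIV. \<bar>f x $ i\<bar> powr p))"
        by (simp add: sum_nonneg)
    qed
  qed
qed

text \<open>The flux has norm \<open>|f|^(p-1)\<close>, which is at most
  \<open>1 + |f|^p\<close>.\<close>

lemma flux_locally_integrable:
  fixes f :: "real^'n::finite \<Rightarrow> real^'n"
  assumes p: "p \<ge> 2" and f: "\<And>i. in_Lp p (\<lambda>x. f x $ i)"
  shows "locally_integrable (\<lambda>x. ((norm (f x) powr (p - 2)) *\<^sub>R f x) $ i)"
  unfolding locally_integrable_def set_integrable_def
proof (intro allI impI)
  fix K :: "(real^'n) set" assume K: "compact K"
  have fL: "f \<in> borel_measurable borel" "integrable lborel (\<lambda>x. norm (f x) powr p)" using norm_Lp[OF f] p by auto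
  have m: "(\<lambda>x. f x $ i) \<in> borel_measurable borel" using f[of i] unfolding in_Lp_def by simp
  have Kb: "K \<in> sets borel" using K by (simp add: borel_compact)
  have ib: "integrable lborel (\<lambda>x. indicator K x + norm (f x) powr p)"
    using K emeasure_compact_finite[OF K] fL(2) by (intro Bochner_Integration.integrable_add integrable_real_indicator) (auto simp: borel_compact)
  show "integrable lborel (\<lambda>x. indicator K x *\<^sub>R ((norm (f x) powr (p - 2)) *\<^sub>R f x) $ i)"
  proof (rule Bochner_Integration.integrable_bound[OF ib])
    show "(\<lambda>x. indicator K x *\<^sub>R ((norm (f x) powr (p - 2)) *\<^sub>R f x) $ i) \<in> borel_measurable lborel"
      using fL(1) m Kb by simp
    show "AE x in lborel. norm (indicator K x *\<^sub>R ((norm (f x) powr (p - 2)) *\<^sub>R f x) $ i) \<le> norm (indicator K x + norm (f x) powr p)"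
    proof (intro always_eventually allI)
      fix x
      have "\<bar>((norm (f x) powr (p - 2)) *\<^sub>R f x) $ i\<bar> \<le> norm (f x) powr (p - 1)"
        using component_le_norm_cart[of "(norm (f x) powr (p - 2)) *\<^sub>R f x" i] unfolding p_flux_norm[OF p] .
      also have "\<dots> \<le> 1 + norm (f x) powr p"
      proof (cases "norm (f x) \<le> 1")
        case True
        then have "norm (f x) powr (p - 1) \<le> 1" using p by (intro powr_le1) auto
        then show ?thesis by (simp add: add_increasing2)
      next
        case False
        then have "norm (f x) powr (p - 1) \<le> norm (f x) powr p" by (intro powr_mono) auto
        then show ?thesis by simp
      qed
      finally show "norm (indicator K x *\<^sub>R ((norm (f x) powr (p - 2)) *\<^sub>R f x) $ i) \<le> norm (indicator K x + norm (f x) powr p)"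
        by (cases "x \<in> K") auto
    qed
  qed
qed

text \<open>The test function has gradient \<open>G grad \<eta> + Z (grad v - W)\<close>.
  Subtracting the two equations expresses the integral of \<open>f \<psi>\<close> by three pairings
  of the flux difference: with \<open>G grad \<eta>\<close>, dominated by \<open>j\<close>; with
  \<open>Z (grad v - gu)\<close>, small by the choice of the mollifier; and with
  \<open>Z (gu - W)\<close>, which has the good sign by monotonicity. The bounds
  \<open>|u| \<le> 1\<close> and \<open>w \<ge> 0\<close> give \<open>G \<le> 1\<close> and
  \<open>Z \<le> 2\<close> on \<open>K\<close>.\<close>

lemma test_inequality:
  fixes u w f \<eta> :: "real^'n::finite \<Rightarrow> real" and W gu :: "real^'n \<Rightarrow> real^'n"
  assumes p: "p \<ge> 2"
    and u: "continuous_on UNIV u" "\<And>x. \<bar>u x\<bar> \<le> 1"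
    and weak: "\<And>i. has_weak_partial i u (\<lambda>x. gu x $ i)" "\<And>i. in_Lp p (\<lambda>x. gu x $ i)"
    and equ: "\<And>\<psi> K. C_k (Suc 0) \<psi> \<Longrightarrow> compact K \<Longrightarrow> K \<subseteq> D \<Longrightarrow> (\<And>x. x \<notin> K \<Longrightarrow> \<psi> x = 0) \<Longrightarrow>
        (LINT x|lborel. ((norm (gu x) powr (p - 2)) *\<^sub>R gu x) \<bullet> gradient \<psi> x) = 0"
    and D: "open D"
    and w: "\<And>x. x \<in> D \<Longrightarrow> w x \<ge> 0" "\<And>x. x \<in> D \<Longrightarrow> (w has_derivative (\<lambda>h. W x \<bullet> h)) (at x)" "continuous_on D W"
    and eqw: "\<And>\<psi> K. C_k (Suc 0) \<psi> \<Longrightarrow> compact K \<Longrightarrow> K \<subseteq> D \<Longrightarrow> (\<And>x. x \<notin> K \<Longrightarrow> \<psi> x = 0) \<Longrightarrow>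
        (LINT x|lborel. ((norm (W x) powr (p - 2)) *\<^sub>R W x) \<bullet> gradient \<psi> x) = (LINT x|lborel. f x * \<psi> x)"
    and f: "continuous_on D f"
    and \<eta>: "C_k (Suc 0) \<eta>" "\<And>x. 0 \<le> \<eta> x" "\<And>x. \<eta> x \<le> 1"
    and \<sigma>: "\<sigma> > 0" and \<tau>: "\<tau> > 0" "\<tau> < \<sigma>" and e: "e > 0"
    and K: "compact K" "K \<subseteq> D" "\<And>x. x \<in> D \<Longrightarrow> x \<notin> K \<Longrightarrow> \<eta> x = 0 \<or> u x < w x"
    and J: "\<And>x. x \<in> K \<Longrightarrow> (norm (gu x) + norm (W x)) powr (p - 1) * norm (gradient \<eta> x) \<le> j x"
      "\<And>x. j x \<ge> 0" "integrable lborel j"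
    and supp: "\<And>x. \<eta> x \<noteq> 0 \<Longrightarrow> norm x \<le> R"
  obtains v where "\<And>x. norm x \<le> R \<Longrightarrow> \<bar>v x - u x\<bar> \<le> \<tau>"
    "integrable lborel (\<lambda>x. f x * (if x \<in> D then \<eta> x * (max 0 (v x - w x - \<sigma>))\<^sup>2 else 0))"
    "(LINT x|lborel. f x * (if x \<in> D then \<eta> x * (max 0 (v x - w x - \<sigma>))\<^sup>2 else 0)) \<le> e + 2 * (LINT x|lborel. j x)"
proof -
  \<comment> \<open>The weight for \<open>conv_Lp_pairing\<close>. Twice its power p - 1 dominates
    the flux difference on \<open>K\<close>, and it is in L^p because \<open>W\<close> is bounded
    there.\<close>
  define P where "P x = indicator K x * (norm (gu x) + norm (W x))" for x
  have cK: "continuous_on K W" using w(3) K(2) continuous_on_subset by blast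
  have gum: "gu \<in> borel_measurable borel" "integrable lborel (\<lambda>x. norm (gu x) powr p)" using norm_Lp[OF weak(2)] p by auto
  have Kb: "K \<in> sets borel" using K(1) by (simp add: borel_compact)
  have WK: "(\<lambda>x. indicator K x *\<^sub>R norm (W x)) \<in> borel_measurable borel"
    using cK Kb by (intro borel_measurable_continuous_on_indicator continuous_on_norm) auto
  have Pm: "P \<in> borel_measurable borel"
  proof -
    have "P = (\<lambda>x. indicator K x * norm (gu x) + indicator K x *\<^sub>R norm (W x))" by (auto simp: P_def algebra_simps)
    then show ?thesis using WK gum(1) Kb by simp
  qed
  have P0: "P x \<ge> 0" for x unfolding P_def by simp
  obtain MW where MW: "MW \<ge> 0" "\<And>x. x \<in> K \<Longrightarrow> norm (W x) \<le> MW"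
  proof -
    have "compact (W ` K)" by (rule compact_continuous_image[OF cK K(1)])
    then obtain M where "\<And>x. x \<in> K \<Longrightarrow> norm (W x) \<le> M" by (metis bounded_iff compact_imp_bounded imageI)
    then have "max M 0 \<ge> 0" "\<And>x. x \<in> K \<Longrightarrow> norm (W x) \<le> max M 0" by (auto simp: le_max_iff_disj)
    then show ?thesis using that by blast
  qed
  have iK: "integrable lborel (\<lambda>x. indicator K x :: real)"
    using emeasure_compact_finite[OF K(1)] K(1) by (intro integrable_real_indicator) (auto simp: borel_compact)
  have Pi: "integrable lborel (\<lambda>x. P x powr p)"
  proof (rule Bochner_Integration.integrable_bound)
    show "integrable lborel (\<lambda>x. 2 powr p * (norm (gu x) powr p + MW powr p * indicator K x))"
      using gum(2) iK by (intro integrable_mult_right Bochner_Integration.integrable_add)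
    show "(\<lambda>x. P x powr p) \<in> borel_measurable lborel" using Pm by measurable
    show "AE x in lborel. norm (P x powr p) \<le> norm (2 powr p * (norm (gu x) powr p + MW powr p * indicator K x))"
    proof (intro always_eventually allI)
      fix x
      show "norm (P x powr p) \<le> norm (2 powr p * (norm (gu x) powr p + MW powr p * indicator K x))"
      proof (cases "x \<in> K")
        case True
        have "P x powr p \<le> (norm (gu x) + MW) powr p" using True MW p by (intro powr_mono2) (auto simp: P_def)
        also have "\<dots> \<le> 2 powr p * (norm (gu x) powr p + MW powr p)" using MW p by (intro powr_add_le) auto
        finally show ?thesis using True by simp
      qed (simp add: P_def)
    qed
  qed
  have lu: "locally_integrable u" using u(1) by (rule continuous_locally_integrable)
  have lg: "locally_integrable (\<lambda>x. gu x $ i)" for i using weak(1)[of i] unfolding has_weak_partial_def by blast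
  \<comment> \<open>The 4 is the product of the bound 2 on \<open>Z\<close> and the 2 of
    \<open>p_flux_diff_norm\<close>; the n components share what is left.\<close>
  define e1 where "e1 = e / (4 * real CARD('n))"
  have e1: "e1 > 0" unfolding e1_def using e by simp
  define S1 where "S1 \<rho> i x = P x powr (p - 1) * \<bar>conv \<rho> (\<lambda>x. gu x $ i) x - gu x $ i\<bar>" for \<rho> i x
  have ex: "\<forall>i. \<exists>d. d > 0 \<and> (\<forall>\<rho>. mollifier d \<rho> \<longrightarrow> integrable lborel (S1 \<rho> i) \<and> (LINT x|lborel. S1 \<rho> i x) \<le> e1)"
  proof
    fix i
    have p1: "p > 1" using p by simp
    show "\<exists>d. d > 0 \<and> (\<forall>\<rho>. mollifier d \<rho> \<longrightarrow> integrable lborel (S1 \<rho> i) \<and> (LINT x|lborel. S1 \<rho> i x) \<le> e1)"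
      unfolding S1_def by (rule conv_Lp_pairing[OF p1 weak(2)[of i] lg[of i] Pm P0 Pi e1]) blast
  qed
  from choice[OF ex] obtain dd
    where "\<forall>i. dd i > 0 \<and> (\<forall>\<rho>. mollifier (dd i) \<rho> \<longrightarrow> integrable lborel (S1 \<rho> i) \<and> (LINT x|lborel. S1 \<rho> i x) \<le> e1)"
    by (rule exE)
  then have dd: "\<And>i. dd i > 0" "\<And>i \<rho>. mollifier (dd i) \<rho> \<Longrightarrow> integrable lborel (S1 \<rho> i)"
    "\<And>i \<rho>. mollifier (dd i) \<rho> \<Longrightarrow> (LINT x|lborel. S1 \<rho> i x) \<le> e1"
    by blast+
  obtain d0 where d0: "d0 > 0" "\<And>x y. norm x \<le> R \<Longrightarrow> dist x y < d0 \<Longrightarrow> \<bar>u y - u x\<bar> \<le> \<tau>"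
  proof -
    have "uniformly_continuous_on (cball 0 (R + 1)) u"
      by (rule compact_uniformly_continuous[OF continuous_on_subset[OF u(1)]]) auto
    then obtain d where d: "d > 0" "\<And>x y. x \<in> cball 0 (R+1) \<Longrightarrow> y \<in> cball 0 (R+1) \<Longrightarrow> dist y x < d \<Longrightarrow> dist (u y) (u x) < \<tau>"
      using \<tau>(1) unfolding uniformly_continuous_on_def by metis
    show ?thesis
    proof (rule that[of "min d 1"])
      fix x y :: "real^'n" assume a: "norm x \<le> R" "dist x y < min d 1"
      then have "norm (x - y) < 1" by (simp add: dist_norm)
      then have "norm y \<le> R + 1" using norm_triangle_ineq3[of x y] a(1) by linarith
      then show "\<bar>u y - u x\<bar> \<le> \<tau>" using d(2)[of x y] a by (simp add: dist_real_def dist_commute)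
    qed (use d in auto)
  qed
  \<comment> \<open>One radius for all demands: uniform closeness of \<open>v\<close> to
    \<open>u\<close> on the ball, and a small pairing for every component of the gradient.\<close>
  define d where "d = min d0 (Min (range dd))"
  have d: "d > 0" "d \<le> d0" "\<And>i. d \<le> dd i"
    unfolding d_def using dd(1) d0(1) by (auto simp: Min_gr_iff intro: min.coboundedI2)
  obtain \<rho> :: "real^'n \<Rightarrow> real" where \<rho>: "mollifier d \<rho>" using mollifier_exists[OF d(1)] by blast
  have \<rho>i: "mollifier (dd i) \<rho>" for i by (rule mollifier_mono[OF \<rho> d(3)])
  note m = mollifierD[OF \<rho>]
  define v where "v = conv \<rho> u"
  have v1: "\<bar>v x - u x\<bar> \<le> \<tau>" if "norm x \<le> R" for x
    unfolding v_def by (rule conv_approx[OF lu \<rho>]) (use d0(2)[OF that] d(2) in auto)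
  have v2: "\<bar>v x\<bar> \<le> 1" for x
    using conv_approx[OF lu \<rho>, of x 0 1] u(2) unfolding v_def by simp
  have vC: "C_k (Suc 0) v" unfolding v_def by (rule C_k_conv[OF lu m(1)])
  have gv: "gradient v x $ i = conv \<rho> (\<lambda>x. gu x $ i) x" for x i
    unfolding gradient_nth v_def partial_conv[OF lu m(1)] by (rule conv_weak_partial[OF weak(1) m(1)])
  have dv: "(v has_derivative (\<lambda>h. gradient v x \<bullet> h)) (at x)" for x
    using vC by (intro has_derivative_gradient) auto
  have d\<eta>: "(\<eta> has_derivative (\<lambda>h. gradient \<eta> x \<bullet> h)) (at x)" for x
    using \<eta>(1) by (intro has_derivative_gradient) auto
  define G where "G x = (max 0 (v x - w x - \<sigma>))\<^sup>2" for x
  define Z where "Z x = \<eta> x * (2 * max 0 (v x - w x - \<sigma>))" for x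
  define \<psi> where "\<psi> x = (if x \<in> D then \<eta> x * G x else 0)" for x
  define V where "V x = G x *\<^sub>R gradient \<eta> x + Z x *\<^sub>R (gradient v x - W x)" for x
  have cw: "continuous_on D w"
    using w(2) by (intro differentiable_imp_continuous_on) (auto simp: differentiable_on_def differentiable_def intro: has_derivative_at_withinI)
  have cvD: "continuous_on D v" "continuous_on D \<eta>" "continuous_on D (gradient v)" "continuous_on D (gradient \<eta>)"
    using C1_continuous[OF vC] C1_continuous[OF \<eta>(1)] C1_continuous_gradient[OF vC] C1_continuous_gradient[OF \<eta>(1)]
    by (auto intro: continuous_on_subset)
  have cV: "continuous_on D V" unfolding V_def G_def Z_def by (intro continuous_intros cw cvD w(3))
  \<comment> \<open>This is the purpose of the shift by \<open>\<sigma>\<close>: off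
    \<open>K\<close> one has \<open>u < w\<close> wherever the cutoff is nonzero, and
    \<open>v\<close> exceeds \<open>u\<close> by at most \<open>\<tau> < \<sigma>\<close>, so the
    positive part vanishes.\<close>
  have z: "\<psi> x = 0" if "x \<notin> K" for x
  proof (cases "x \<in> D \<and> \<eta> x \<noteq> 0")
    case True
    then have "u x < w x" "norm x \<le> R" using K(3) that supp by auto
    then have "v x - w x - \<sigma> < 0" using v1[of x] \<tau> by linarith
    then show ?thesis unfolding \<psi>_def G_def by simp
  qed (auto simp: \<psi>_def)
  have d\<psi>: "(\<psi> has_derivative (\<lambda>h. V x \<bullet> h)) (at x)" if x: "x \<in> D" for x
  proof -
    have 1: "((\<lambda>x. v x - w x) has_derivative (\<lambda>h. gradient v x \<bullet> h - W x \<bullet> h)) (at x)"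
      by (rule has_derivative_diff[OF dv w(2)[OF x]])
    have 2: "(G has_derivative (\<lambda>h. (gradient v x \<bullet> h - W x \<bullet> h) * (2 * max 0 (v x - w x - \<sigma>)))) (at x)"
      unfolding G_def by (rule DERIV_compose_FDERIV[OF quadratic_ramp_deriv 1])
    have 3: "((\<lambda>x. \<eta> x * G x) has_derivative (\<lambda>h. V x \<bullet> h)) (at x)"
      using has_derivative_mult[OF d\<eta>[of x] 2] by (simp add: V_def Z_def inner_add_left inner_diff_left algebra_simps)
    show ?thesis
      by (rule has_derivative_transform_within_open[OF 3 D x]) (simp add: \<psi>_def)
  qed
  have glue: "C_k (Suc 0) \<psi>" "\<And>x. x \<in> D \<Longrightarrow> gradient \<psi> x = V x" "\<And>x. x \<notin> K \<Longrightarrow> gradient \<psi> x = 0"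
    using C1_glue[OF D K(1,2) z d\<psi> cV] by blast+
  define Au where "Au x = (norm (gu x) powr (p - 2)) *\<^sub>R gu x" for x
  define Aw where "Aw x = (norm (W x) powr (p - 2)) *\<^sub>R W x" for x
  have eu: "(LINT x|lborel. Au x \<bullet> gradient \<psi> x) = 0" unfolding Au_def by (rule equ[OF glue(1) K(1,2) z])
  have ew: "(LINT x|lborel. Aw x \<bullet> gradient \<psi> x) = (LINT x|lborel. f x * \<psi> x)" unfolding Aw_def by (rule eqw[OF glue(1) K(1,2) z])
  have cg: "continuous_on UNIV (gradient \<psi>)" by (rule C1_continuous_gradient[OF glue(1)])
  have iu: "integrable lborel (\<lambda>x. Au x \<bullet> gradient \<psi> x)"
  proof -
    have "integrable lborel (\<lambda>x. partial i \<psi> x * Au x $ i)" for i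
    proof (rule locint_mult_integrable[OF _ _ K(1)])
      show "locally_integrable (\<lambda>x. Au x $ i)" unfolding Au_def by (rule flux_locally_integrable[OF p weak(2)])
      show "continuous_on UNIV (partial i \<psi>)" using glue(1) by simp
      show "partial i \<psi> x = 0" if "x \<notin> K" for x using glue(3)[OF that] gradient_nth[of \<psi> x i] by simp
    qed
    then have "integrable lborel (\<lambda>x. \<Sum>i\<in>UNIV. partial i \<psi> x * Au x $ i)" by (intro Bochner_Integration.integrable_sum)
    then show ?thesis by (simp add: inner_vec_def gradient_nth mult.commute)
  qed
  have ind: "integrable lborel F" if "continuous_on K F" "\<And>x. x \<notin> K \<Longrightarrow> F x = 0" for F :: "real^'n \<Rightarrow> real"
  proof -
    have "integrable lborel (\<lambda>x. indicator K x *\<^sub>R F x)" by (rule borel_integrable_compact[OF K(1) that(1)])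
    moreover have "indicator K x *\<^sub>R F x = F x" for x using that(2)[of x] by (cases "x \<in> K") auto
    ultimately show ?thesis by (simp only:)
  qed
  have iw: "integrable lborel (\<lambda>x. Aw x \<bullet> gradient \<psi> x)"
  proof (rule ind)
    \<comment> \<open>For \<open>p = 2\<close> the scalar factor has exponent 0 and jumps to 0 where
      \<open>W\<close> vanishes; its product with \<open>W\<close> is nevertheless
      \<open>W\<close>.\<close>
    have "continuous_on K Aw" unfolding Aw_def
    proof (cases "p = 2")
      case True
      then have "norm (W x) powr (p - 2) *\<^sub>R W x = W x" for x by simp
      then show "continuous_on K (\<lambda>x. norm (W x) powr (p - 2) *\<^sub>R W x)" using cK by simp
    next
      case False
      then show "continuous_on K (\<lambda>x. norm (W x) powr (p - 2) *\<^sub>R W x)"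
        using p by (intro continuous_on_scaleR continuous_on_powr' continuous_intros cK) auto
    qed
    then show "continuous_on K (\<lambda>x. Aw x \<bullet> gradient \<psi> x)"
      by (intro continuous_intros continuous_on_subset[OF cg]) auto
  qed (simp add: glue(3))
  have if\<psi>: "integrable lborel (\<lambda>x. f x * \<psi> x)"
  proof (rule ind)
    show "continuous_on K (\<lambda>x. f x * \<psi> x)"
      by (intro continuous_intros continuous_on_subset[OF f K(2)] continuous_on_subset[OF C1_continuous[OF glue(1)]]) auto
  qed (simp add: z)
  define S where "S x = (\<Sum>i\<in>UNIV. S1 \<rho> i x)" for x
  have iS: "integrable lborel S" unfolding S_def by (intro Bochner_Integration.integrable_sum dd(2)[OF \<rho>i])
  have lS: "(LINT x|lborel. S x) \<le> e / 4"
  proof -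
    have "(LINT x|lborel. S x) = (\<Sum>i\<in>UNIV. LINT x|lborel. S1 \<rho> i x)"
      unfolding S_def by (intro Bochner_Integration.integral_sum dd(2)[OF \<rho>i])
    also have "\<dots> \<le> (\<Sum>i\<in>(UNIV :: 'n set). e1)" by (intro sum_mono dd(3)[OF \<rho>i])
    also have "\<dots> = e / 4" by (simp add: e1_def)
    finally show ?thesis .
  qed
  have pw: "Aw x \<bullet> gradient \<psi> x - Au x \<bullet> gradient \<psi> x \<le> 4 * S x + 2 * j x" for x
  proof (cases "x \<in> K")
    case False
    have "S x \<ge> 0" unfolding S_def S1_def by (intro sum_nonneg) simp
    then show ?thesis using glue(3)[OF False] J(2)[of x] by simp
  next
    case True
    then have xD: "x \<in> D" using K(2) by blast
    have Px: "P x = norm (gu x) + norm (W x)" unfolding P_def using True by simp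
    have vw: "v x - w x - \<sigma> \<le> 1" using v2[of x] w(1)[OF xD] \<sigma> by linarith
    have G1: "0 \<le> G x" "G x \<le> 1" unfolding G_def using vw by (auto intro: power_le_one)
    have Z1: "0 \<le> Z x" unfolding Z_def using \<eta>(2)[of x] by simp
    have "Z x \<le> 1 * (2 * 1)" unfolding Z_def using \<eta>(2,3)[of x] vw by (intro mult_mono) auto
    then have Z2: "Z x \<le> 2" by simp
    have AA: "norm (Au x - Aw x) \<le> 2 * P x powr (p - 1)"
      unfolding Au_def Aw_def Px by (rule p_flux_diff_norm[OF p])
    have mon: "(Au x - Aw x) \<bullet> (gu x - W x) \<ge> 0" unfolding Au_def Aw_def by (rule p_flux_monotone[OF p])
    have "Aw x \<bullet> gradient \<psi> x - Au x \<bullet> gradient \<psi> x = - ((Au x - Aw x) \<bullet> V x)"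
      unfolding glue(2)[OF xD] by (simp add: inner_diff_left)
    also have "\<dots> = - (G x * ((Au x - Aw x) \<bullet> gradient \<eta> x)) - Z x * ((Au x - Aw x) \<bullet> (gradient v x - gu x)) - Z x * ((Au x - Aw x) \<bullet> (gu x - W x))"
      unfolding V_def by (simp add: inner_diff_left inner_diff_right inner_add_right algebra_simps)
    also have "\<dots> \<le> 1 * (2 * P x powr (p - 1) * norm (gradient \<eta> x)) + 2 * (2 * P x powr (p - 1) * norm (gradient v x - gu x))"
    proof -
      have cs: "- ((Au x - Aw x) \<bullet> y) \<le> 2 * P x powr (p - 1) * norm y" for y
      proof -
        have "- ((Au x - Aw x) \<bullet> y) \<le> norm (Au x - Aw x) * norm y"
          using norm_cauchy_schwarz[of "- (Au x - Aw x)" y] by (simp only: inner_minus_left norm_minus_cancel)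
        also have "\<dots> \<le> 2 * P x powr (p - 1) * norm y" using AA by (intro mult_right_mono) auto
        finally show ?thesis .
      qed
      have nn: "0 \<le> 2 * P x powr (p - 1) * norm y" for y :: "real^'n" by simp
      have "G x * (- ((Au x - Aw x) \<bullet> gradient \<eta> x)) \<le> G x * (2 * P x powr (p - 1) * norm (gradient \<eta> x))"
        by (rule mult_left_mono[OF cs G1(1)])
      also have "\<dots> \<le> 1 * (2 * P x powr (p - 1) * norm (gradient \<eta> x))" by (rule mult_right_mono[OF G1(2) nn])
      finally have a: "G x * (- ((Au x - Aw x) \<bullet> gradient \<eta> x)) \<le> 1 * (2 * P x powr (p - 1) * norm (gradient \<eta> x))" .
      have "Z x * (- ((Au x - Aw x) \<bullet> (gradient v x - gu x))) \<le> Z x * (2 * P x powr (p - 1) * norm (gradient v x - gu x))"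
        by (rule mult_left_mono[OF cs Z1])
      also have "\<dots> \<le> 2 * (2 * P x powr (p - 1) * norm (gradient v x - gu x))" by (rule mult_right_mono[OF Z2 nn])
      finally have b: "Z x * (- ((Au x - Aw x) \<bullet> (gradient v x - gu x))) \<le> 2 * (2 * P x powr (p - 1) * norm (gradient v x - gu x))" .
      have c: "Z x * ((Au x - Aw x) \<bullet> (gu x - W x)) \<ge> 0" by (rule mult_nonneg_nonneg[OF Z1 mon])
      show ?thesis using a b c by (simp only: mult_minus_right)
    qed
    also have "\<dots> \<le> 2 * j x + 4 * S x"
    proof -
      have "P x powr (p - 1) * norm (gradient \<eta> x) \<le> j x" using J(1)[OF True] unfolding Px .
      moreover have "P x powr (p - 1) * norm (gradient v x - gu x) \<le> S x"
      proof -
        have "norm (gradient v x - gu x) \<le> (\<Sum>i\<in>UNIV. \<bar>conv \<rho> (\<lambda>x. gu x $ i) x - gu x $ i\<bar>)"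
          using norm_le_l1_cart[of "gradient v x - gu x"] by (simp add: gv)
        then show ?thesis unfolding S_def S1_def sum_distrib_left[symmetric] by (intro mult_left_mono) auto
      qed
      ultimately show ?thesis by simp
    qed
    finally show ?thesis by simp
  qed
  have "(LINT x|lborel. f x * \<psi> x) = (LINT x|lborel. Aw x \<bullet> gradient \<psi> x - Au x \<bullet> gradient \<psi> x)"
    using iu iw eu ew by simp
  also have "\<dots> \<le> (LINT x|lborel. 4 * S x + 2 * j x)"
    using iu iw iS J(3) pw by (intro integral_mono) auto
  also have "\<dots> = 4 * (LINT x|lborel. S x) + 2 * (LINT x|lborel. j x)" using iS J(3) by simp
  also have "\<dots> \<le> e + 2 * (LINT x|lborel. j x)" using lS by simp
  finally have "(LINT x|lborel. f x * \<psi> x) \<le> e + 2 * (LINT x|lborel. j x)" .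
  then show ?thesis using that[of v] v1 if\<psi> unfolding \<psi>_def G_def by blast
qed

text \<open>If \<open>u > w\<close> at \<open>x0\<close>, strictness of the barrier yields a lower
  bound \<open>c0 > 0\<close> for the integral of \<open>f \<psi>\<close>, coming from a small ball
  around \<open>x0\<close> and independent of the cutoff. The upper bound consists of the
  mollification error and the cutoff terms; with \<open>e = c0 / 4\<close> it is at most
  \<open>3 c0 / 4\<close>. The bound \<open>C\<close> on \<open>|W| |x|\<close> leaves only
  \<open>C / R\<close> of the barrier where the cutoff varies.\<close>

lemma comparison_principle:
  fixes u w f :: "real^'n::finite \<Rightarrow> real" and W gu :: "real^'n \<Rightarrow> real^'n"
  assumes p: "p \<ge> 2" "p > real CARD('n)"
    and u: "continuous_on UNIV u" "\<And>x. \<bar>u x\<bar> \<le> 1"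
    and weak: "\<And>i. has_weak_partial i u (\<lambda>x. gu x $ i)" "\<And>i. in_Lp p (\<lambda>x. gu x $ i)"
    and equ: "\<And>\<psi> K. C_k (Suc 0) \<psi> \<Longrightarrow> compact K \<Longrightarrow> K \<subseteq> D \<Longrightarrow> (\<And>x. x \<notin> K \<Longrightarrow> \<psi> x = 0) \<Longrightarrow>
        (LINT x|lborel. ((norm (gu x) powr (p - 2)) *\<^sub>R gu x) \<bullet> gradient \<psi> x) = 0"
    and D: "open D"
    and w: "\<And>x. x \<in> D \<Longrightarrow> w x \<ge> 0" "\<And>x. x \<in> D \<Longrightarrow> (w has_derivative (\<lambda>h. W x \<bullet> h)) (at x)" "continuous_on D W"
      "continuous_on (closure D) w" "\<And>x. x \<in> closure D \<Longrightarrow> x \<notin> D \<Longrightarrow> u x < w x"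
    and eqw: "\<And>\<psi> K. C_k (Suc 0) \<psi> \<Longrightarrow> compact K \<Longrightarrow> K \<subseteq> D \<Longrightarrow> (\<And>x. x \<notin> K \<Longrightarrow> \<psi> x = 0) \<Longrightarrow>
        (LINT x|lborel. ((norm (W x) powr (p - 2)) *\<^sub>R W x) \<bullet> gradient \<psi> x) = (LINT x|lborel. f x * \<psi> x)"
    and f: "continuous_on D f" "\<And>x. x \<in> D \<Longrightarrow> f x > 0"
    and C: "C \<ge> 0" "\<And>x. x \<in> D \<Longrightarrow> norm (W x) * norm x \<le> C"
    and x0: "x0 \<in> D"
  shows "u x0 \<le> w x0"
proof (rule ccontr)
  assume "\<not> u x0 \<le> w x0"
  define \<sigma> where "\<sigma> = (u x0 - w x0) / 2"
  have \<sigma>: "\<sigma> > 0" "u x0 - w x0 = 2 * \<sigma>" unfolding \<sigma>_def using \<open>\<not> u x0 \<le> w x0\<close> by auto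
  have cw: "continuous_on D w" using w(4) by (rule continuous_on_subset) (rule closure_subset)
  have cuw: "continuous_on D (\<lambda>x. u x - w x)" by (intro continuous_intros cw continuous_on_subset[OF u(1)]) auto
  \<comment> \<open>From \<open>7/4 \<sigma>\<close> there remains \<open>\<sigma> / 2\<close> after
    subtracting the shift \<open>\<sigma>\<close> and the error \<open>\<sigma> / 4\<close> of the
    mollification.\<close>
  obtain r where r: "r > 0" "cball x0 r \<subseteq> D" "\<And>x. x \<in> cball x0 r \<Longrightarrow> u x - w x \<ge> 7 / 4 * \<sigma>"
  proof -
    have "continuous (at x0) (\<lambda>x. u x - w x)" using cuw D x0 by (simp add: continuous_on_eq_continuous_at)
    then obtain s where s: "s > 0" "\<And>x. dist x x0 < s \<Longrightarrow> \<bar>(u x - w x) - (u x0 - w x0)\<bar> < \<sigma> / 4"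
      unfolding continuous_at_eps_delta dist_real_def using \<sigma>(1) by (metis zero_less_divide_iff zero_less_numeral)
    obtain s' where s': "s' > 0" "cball x0 s' \<subseteq> D" using D x0 open_contains_cball by blast
    show ?thesis
    proof (rule that[of "min (s / 2) s'"])
      fix x assume "x \<in> cball x0 (min (s / 2) s')"
      then have "dist x x0 < s" using s(1) by (simp add: dist_commute)
      then show "u x - w x \<ge> 7 / 4 * \<sigma>" using s(2)[OF \<open>dist x x0 < s\<close>] \<sigma>(2) by linarith
    qed (use s s' in auto)
  qed
  let ?B = "cball x0 r"
  obtain c1 where c1: "c1 > 0" "\<And>x. x \<in> ?B \<Longrightarrow> f x \<ge> c1"
  proof -
    have "continuous_on ?B f" using f(1) r(2) continuous_on_subset by blast
    then obtain y where y: "y \<in> ?B" "\<And>x. x \<in> ?B \<Longrightarrow> f y \<le> f x"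
      using continuous_attains_inf[OF compact_cball, of x0 r f] r(1) by auto
    then show ?thesis using that[of "f y"] f(2) r(2) by blast
  qed
  have mB: "measure lborel ?B > 0" using r(1) by (simp add: content_cball_gt_0_iff)
  define c0 where "c0 = c1 * (\<sigma>\<^sup>2 / 4) * measure lborel ?B"
  have c0: "c0 > 0" unfolding c0_def using c1 \<sigma> mB by simp
  have gum: "gu \<in> borel_measurable borel" "integrable lborel (\<lambda>x. norm (gu x) powr p)" using norm_Lp[OF weak(2)] p by auto
  define e where "e = c0 / 4"
  have e: "e > 0" unfolding e_def using c0 by simp
  obtain R0 where R0: "R0 > 0"
    "\<And>R. R \<ge> R0 \<Longrightarrow> integrable lborel (\<lambda>x. (norm (gu x) + C / R) powr (p - 1) * (16 / R) * indicator (cball 0 (2 * R)) x)"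
    "\<And>R. R \<ge> R0 \<Longrightarrow> (LINT x|lborel. (norm (gu x) + C / R) powr (p - 1) * (16 / R) * indicator (cball 0 (2 * R)) x) \<le> e"
    using annulus_estimate[OF p(2), of "\<lambda>x. norm (gu x)" C e] gum C(1) e by auto
  \<comment> \<open>Large enough that the cutoff is 1 on the small ball; \<open>c0\<close> and
    \<open>e\<close> are already fixed and do not change with it.\<close>
  define R where "R = max R0 (norm x0 + r)"
  have R: "R > 0" "R \<ge> R0" "norm x0 + r \<le> R" unfolding R_def using R0(1) by auto
  define j where "j x = (norm (gu x) + C / R) powr (p - 1) * (16 / R) * indicator (cball 0 (2 * R)) x" for x
  have j: "integrable lborel j" "(LINT x|lborel. j x) \<le> e" unfolding j_def using R0(2,3) R(2) by auto
  obtain \<eta> :: "real^'n \<Rightarrow> real" where \<eta>: "C_k (Suc 0) \<eta>" "\<And>x. 0 \<le> \<eta> x" "\<And>x. \<eta> x \<le> 1"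
    "\<And>x. norm x \<le> R \<Longrightarrow> \<eta> x = 1" "\<And>x. norm x \<ge> 2 * R \<Longrightarrow> \<eta> x = 0"
    "\<And>x. norm (gradient \<eta> x) \<le> 16 / R" "\<And>x. norm x < R \<Longrightarrow> gradient \<eta> x = 0"
    "\<And>x. norm x \<ge> 2 * R \<Longrightarrow> gradient \<eta> x = 0"
    using cutoff_exists[OF R(1)] by metis
  \<comment> \<open>The set where \<open>u \<ge> w\<close>, taken in the closure and cut to a ball.
    Since \<open>u < w\<close> on the boundary, it is a compact subset of the open set
    \<open>D\<close>.\<close>
  define K where "K = {x \<in> closure D \<inter> cball 0 (2 * R). u x - w x \<in> {0..}}"
  have K1: "compact K"
  proof -
    have "continuous_on (closure D \<inter> cball 0 (2 * R)) (\<lambda>x. u x - w x)"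
      by (intro continuous_intros continuous_on_subset[OF w(4)] continuous_on_subset[OF u(1)]) auto
    then have "closed ((closure D \<inter> cball 0 (2 * R)) \<inter> (\<lambda>x. u x - w x) -` {0..})"
      by (rule continuous_closed_preimage) (auto intro: closed_Int)
    moreover have "K = (closure D \<inter> cball 0 (2 * R)) \<inter> (\<lambda>x. u x - w x) -` {0..}" unfolding K_def by blast
    ultimately have "closed K" by (simp only:)
    moreover have "bounded K" unfolding K_def using bounded_cball[of "0::real^'n" "2 * R"] by (rule bounded_subset) auto
    ultimately show ?thesis by (simp add: compact_eq_bounded_closed)
  qed
  have K2: "K \<subseteq> D"
  proof
    fix x assume "x \<in> K"
    then have "x \<in> closure D" "u x \<ge> w x" unfolding K_def by auto
    then show "x \<in> D" using w(5)[of x] by force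
  qed
  have K3: "\<eta> x = 0 \<or> u x < w x" if "x \<in> D" "x \<notin> K" for x
  proof (cases "norm x \<le> 2 * R")
    case True
    have "x \<in> closure D" using that(1) closure_subset by blast
    then show ?thesis using that True unfolding K_def by auto
  next
    case False
    then show ?thesis using \<eta>(5)[of x] by simp
  qed
  have J: "(norm (gu x) + norm (W x)) powr (p - 1) * norm (gradient \<eta> x) \<le> j x" if "x \<in> K" for x
  proof (cases "norm x < R")
    case True
    then show ?thesis using \<eta>(7) R(1) by (simp add: j_def)
  next
    case False
    have xD: "x \<in> D" using that K2 by blast
    have x2: "x \<in> cball 0 (2 * R)" using that unfolding K_def by blast
    have "norm (W x) * R \<le> norm (W x) * norm x" using False by (intro mult_left_mono) auto
    also have "\<dots> \<le> C" using C(2)[OF xD] .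
    finally have "norm (W x) \<le> C / R" using R(1) by (simp add: field_simps)
    then have "(norm (gu x) + norm (W x)) powr (p - 1) * norm (gradient \<eta> x) \<le> (norm (gu x) + C / R) powr (p - 1) * (16 / R)"
      using p(1) \<eta>(6)[of x] by (intro mult_mono powr_mono2) auto
    then show ?thesis unfolding j_def using x2 by simp
  qed
  obtain v where v: "\<And>x. norm x \<le> 2 * R \<Longrightarrow> \<bar>v x - u x\<bar> \<le> \<sigma> / 4"
    "integrable lborel (\<lambda>x. f x * (if x \<in> D then \<eta> x * (max 0 (v x - w x - \<sigma>))\<^sup>2 else 0))"
    "(LINT x|lborel. f x * (if x \<in> D then \<eta> x * (max 0 (v x - w x - \<sigma>))\<^sup>2 else 0)) \<le> e + 2 * (LINT x|lborel. j x)"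
  proof (rule test_inequality[where \<tau> = "\<sigma> / 4" and R = "2 * R" and j = j and e = e,
      OF p(1) u weak equ D w(1,2,3) eqw f(1) \<eta>(1,2,3) \<sigma>(1) _ _ e K1 K2 K3 J])
    show "norm x \<le> 2 * R" if "\<eta> x \<noteq> 0" for x using \<eta>(5)[of x] that by force
    show "j x \<ge> 0" for x unfolding j_def using R(1) by simp
  qed (use \<sigma> j in auto)
  have "c0 = (LINT x|lborel. c1 * (\<sigma>\<^sup>2 / 4) * indicator ?B x)" unfolding c0_def by simp
  also have "\<dots> \<le> (LINT x|lborel. f x * (if x \<in> D then \<eta> x * (max 0 (v x - w x - \<sigma>))\<^sup>2 else 0))"
  proof (rule integral_mono[OF _ v(2)])
    show "integrable lborel (\<lambda>x. c1 * (\<sigma>\<^sup>2 / 4) * indicator ?B x :: real)"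
      using emeasure_lborel_cball_finite[of x0 r] by (intro integrable_mult_right integrable_real_indicator) auto
    fix x
    show "c1 * (\<sigma>\<^sup>2 / 4) * indicator ?B x \<le> f x * (if x \<in> D then \<eta> x * (max 0 (v x - w x - \<sigma>))\<^sup>2 else 0)"
    proof (cases "x \<in> ?B")
      case True
      then have xD: "x \<in> D" using r(2) by blast
      have "norm x \<le> norm x0 + r" using True norm_triangle_ineq3[of x x0] by (simp add: dist_norm norm_minus_commute)
      then have nx: "norm x \<le> R" using R(3) by linarith
      have "v x - w x - \<sigma> \<ge> \<sigma> / 2" 
      proof -
        have "\<bar>v x - u x\<bar> \<le> \<sigma> / 4" by (rule v(1)) (use nx R(1) in linarith)
        then show ?thesis using r(3)[OF True] by linarith
      qed
      then have "(max 0 (v x - w x - \<sigma>))\<^sup>2 \<ge> (\<sigma> / 2)\<^sup>2" using \<sigma>(1) by (intro power_mono) auto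
      then have "c1 * (\<sigma>\<^sup>2 / 4) \<le> f x * (max 0 (v x - w x - \<sigma>))\<^sup>2"
        using c1(1) c1(2)[OF True] by (intro mult_mono) (auto simp: power_divide)
      then show ?thesis using True xD \<eta>(4)[OF nx] by simp
    next
      case False
      then show ?thesis using f(2)[of x] \<eta>(2)[of x] by (auto intro: less_imp_le)
    qed
  qed
  also have "\<dots> \<le> e + 2 * e" using v(3) j(2) by linarith
  also have "\<dots> < c0" unfolding e_def using c0 by simp
  finally show False by simp
qed

section \<open>The angular profile\<close>

text \<open>Right-hand side of the equation for the slope k, with \<open>q = k^2\<close> and
  \<open>B = \<gamma> (p - 1)\<close>.\<close>

definition slope_rate :: "real \<Rightarrow> real \<Rightarrow> real \<Rightarrow> real" where
  "slope_rate p B q = (1 + q) * (B * (1 + q) + p - 2) / (1 + (p - 1) * q)"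

definition slope_rate' :: "real \<Rightarrow> real \<Rightarrow> real \<Rightarrow> real" where
  "slope_rate' p B q = (((B * (1 + q) + p - 2) + (1 + q) * B) * (1 + (p - 1) * q)
     - (1 + q) * (B * (1 + q) + p - 2) * (p - 1)) / (1 + (p - 1) * q)\<^sup>2"

lemma slope_rate_denom_pos: "p > 2 \<Longrightarrow> q \<ge> 0 \<Longrightarrow> 1 + (p - 1) * q > (0::real)"
  by (simp add: add_pos_nonneg)

lemma slope_rate_pos: "p > 2 \<Longrightarrow> B > 0 \<Longrightarrow> q \<ge> 0 \<Longrightarrow> slope_rate p B q > 0"
proof -
  assume a: "p > 2" "B > 0" "q \<ge> 0"
  then have "B * (1 + q) > 0" by simp
  with a have "B * (1 + q) + p - 2 > 0" by linarith
  with a show ?thesis unfolding slope_rate_def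
    by (intro divide_pos_pos mult_pos_pos slope_rate_denom_pos) auto
qed

lemma slope_rate_deriv:
  assumes "p > 2" "q \<ge> 0"
  shows "(slope_rate p B has_real_derivative slope_rate' p B q) (at q)"
proof -
  have "1 + (p - 1) * q \<noteq> 0" using slope_rate_denom_pos[OF assms] by simp
  then show ?thesis unfolding slope_rate_def[abs_def] slope_rate'_def
    by (auto intro!: derivative_eq_intros simp: power2_eq_square algebra_simps)
qed

text \<open>The bound on \<open>\<beta>\<close> says that \<open>\<beta>\<close> is below the positive root of \<open>3 x\<^sup>2 + 2 x - 1 = 4 x / (p - 1)\<close>.\<close>
lemma exponent_slack:
  fixes p \<beta> :: real
  assumes p: "p > 2" and b0: "0 < \<beta>"
    and b: "\<beta> < - 1/3 + 2 / (3 * (p - 1)) + sqrt ((- 1/3 + 2 / (3 * (p - 1)))\<^sup>2 + 1/3)"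
  obtains \<gamma> where "\<beta> < \<gamma>"
    "4 * (\<gamma> * (p-1)) * (\<gamma> * (p-1) + p - 2) < ((1 + \<gamma>) * (p - 1))\<^sup>2"
proof -
  let ?a = "- 1/3 + 2 / (3 * (p - 1))"
  let ?b = "?a + sqrt (?a\<^sup>2 + 1/3)"
  \<comment> \<open>The room left between \<open>\<beta>\<close> and the critical exponent becomes
    the strictness of the barrier.\<close>
  obtain g where g: "\<beta> < g" "g < ?b" using b dense by blast
  have "(g - ?a)\<^sup>2 < ?a\<^sup>2 + 1/3"
  proof (cases "g - ?a \<ge> 0")
    case True
    then have "(g - ?a)\<^sup>2 < (sqrt (?a\<^sup>2 + 1/3))\<^sup>2" using g by (intro power_strict_mono) auto
    then show ?thesis by simp
  next
    case False
    \<comment> \<open>In this case \<open>0 < g < ?a\<close>, so \<open>g\<close> is closer to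
      \<open>?a\<close> than 0 is.\<close>
    then have "\<bar>g - ?a\<bar> < \<bar>?a\<bar>" using g b0 by linarith
    then have "(g - ?a)\<^sup>2 < ?a\<^sup>2" using abs_square_le_1 by (metis abs_ge_zero power2_abs power_strict_mono zero_less_numeral)
    then show ?thesis by linarith
  qed
  moreover have "3 * g\<^sup>2 - 6 * g * a < 1" if "(g - a)\<^sup>2 < a\<^sup>2 + 1/3" for a
    using that by (simp add: power2_eq_square algebra_simps)
  ultimately have "3 * g\<^sup>2 - 6 * g * ?a < 1" by blast
  then have "(3 * g\<^sup>2 - 6 * g * ?a) * (p-1) < 1 * (p - 1)" using p by (intro mult_strict_right_mono) auto
  moreover have "?a * (p-1) = - (p-1)/3 + 2/3" using p by (simp add: field_simps)
  then have "(3 * g\<^sup>2 - 6 * g * ?a) * (p-1) = 3 * g\<^sup>2 * (p-1) - 6 * g * (- (p-1)/3 + 2/3)"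
    by (metis (no_types, lifting) left_diff_distrib mult.assoc)
  moreover have "3 * g\<^sup>2 * (p-1) - 6 * g * (- (p-1)/3 + 2/3) = 3 * g\<^sup>2 * (p-1) + 2 * g * (p-1) - 4 * g" by (simp add: field_simps)
  ultimately have "3 * g\<^sup>2 * (p-1) + 2 * g * (p-1) - 4 * g < p - 1" by (simp only: mult_1)
  then have "(3 * g\<^sup>2 * (p-1) + 2 * g * (p-1) - 4 * g) * (p-1) < (p - 1) * (p-1)"
    using p by (intro mult_strict_right_mono) auto
  then have "4 * (g * (p-1)) * (g * (p-1) + p - 2) < ((1 + g) * (p - 1))\<^sup>2"
    by (simp add: power2_eq_square algebra_simps)
  with g show ?thesis using that by blast
qed

text \<open>T is the inverse of the solution of \<open>k' = slope_rate p B (k\<^sup>2)\<close>. Partial fractions give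
  \<open>T k = \<kappa> arctan (a k) - arctan k\<close>, and the condition on B is \<open>\<kappa> > 2\<close>.\<close>
lemma theta_exists:
  fixes p B :: real
  assumes p: "p > 2" and B: "B > 0" and slack: "4 * B * (B + p - 2) < (B + p - 1)\<^sup>2"
  obtains T :: "real \<Rightarrow> real" and k1 where "T 0 = 0" "k1 > 0" "pi / 2 < T k1" "T k1 < pi"
    "\<And>k. (T has_real_derivative 1 / slope_rate p B (k\<^sup>2)) (at k)"
proof -
  define F where "F = B + p - 2"
  have F: "F > 0" using p B unfolding F_def by linarith
  define a where "a = sqrt (B / F)"
  define kap where "kap = (B + p - 1) / sqrt (B * F)"
  have a: "a > 0" unfolding a_def using B F by simp
  have sq: "sqrt (B*F) > 0" using B F by simp
  \<comment> \<open>The squared form of \<open>kap > 2\<close>; here the condition on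
    \<open>B\<close> enters.\<close>
  have "(2 * sqrt (B * F))\<^sup>2 < (B + p - 1)\<^sup>2" 
    using slack B F mult_pos_pos[OF B F] by (simp add: F_def power_mult_distrib del: mult_pos_pos)
  then have "2 * sqrt (B * F) < B + p - 1" by (rule power2_less_imp_less) (use p B in linarith)
  then have kap: "kap > 2" unfolding kap_def using sq by (simp add: field_simps)
  have kapa: "kap * a = (B + p - 1) / F"
  proof -
    have "a = sqrt B / sqrt F" unfolding a_def by (simp add: real_sqrt_divide)
    then have "kap * a = (B + p - 1) / (sqrt F * sqrt F)"
      unfolding kap_def using B F by (simp add: real_sqrt_mult)
    then show ?thesis using F by simp
  qed
  define T where "T k = kap * arctan (a * k) - arctan k" for k
  have D: "(T has_real_derivative 1 / slope_rate p B (k\<^sup>2)) (at k)" for k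
  proof -
    have 1: "1 + (p - 1) * k\<^sup>2 > 0" using p by (intro slope_rate_denom_pos) auto
    have 2: "F + B * k\<^sup>2 > 0" using F B by (simp add: add_pos_nonneg)
    have 3: "1 + k\<^sup>2 > 0" by (simp add: add_pos_nonneg)
    have a2: "1 + (a*k)\<^sup>2 = (F + B * k\<^sup>2) / F" unfolding a_def using B F by (simp add: power_mult_distrib field_simps)
    have "(T has_real_derivative kap * (a / (1 + (a*k)\<^sup>2)) - 1 / (1 + k\<^sup>2)) (at k)"
      unfolding T_def by (auto intro!: derivative_eq_intros simp: divide_simps)
    moreover have "kap * (a / (1 + (a*k)\<^sup>2)) = (B + p - 1) / (F + B * k\<^sup>2)"
    proof -
      have "kap * (a / (1 + (a*k)\<^sup>2)) = (kap * a) / (1 + (a*k)\<^sup>2)" by simp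
      also have "\<dots> = (B + p - 1) / (F + B * k\<^sup>2)" unfolding kapa a2 using F 2 by simp
      finally show ?thesis .
    qed
    moreover have "(B + p - 1) / (F + B * k\<^sup>2) - 1 / (1 + k\<^sup>2) = 1 / slope_rate p B (k\<^sup>2)"
    proof -
      have "(B + p - 1) / (F + B * k\<^sup>2) - 1 / (1 + k\<^sup>2) = ((B+p-1)*(1+k\<^sup>2) - (F + B * k\<^sup>2)) / ((F + B * k\<^sup>2)*(1+k\<^sup>2))"
        using 2 3 by (simp add: diff_frac_eq)
      also have "(B+p-1)*(1+k\<^sup>2) - (F + B * k\<^sup>2) = 1 + (p-1)*k\<^sup>2" by (simp add: F_def algebra_simps)
      also have FB: "F + B * k\<^sup>2 = B * (1 + k\<^sup>2) + p - 2" by (simp add: F_def algebra_simps)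
      finally show ?thesis unfolding slope_rate_def FB
        by (simp only: mult.commute divide_divide_eq_right mult_1)
    qed
    ultimately show ?thesis by simp
  qed
  have T0: "T 0 = 0" by (simp add: T_def)
  have cT: "isCont T k" for k using D DERIV_isCont by blast
  have lim: "(T \<longlongrightarrow> kap * (pi/2) - pi/2) at_top"
    unfolding T_def
    by (intro tendsto_intros filterlim_compose[OF tendsto_arctan_at_top] filterlim_tendsto_pos_mult_at_top[OF tendsto_const a]
        filterlim_ident tendsto_arctan_at_top)
  \<comment> \<open>A value strictly between \<open>pi / 2\<close> and the limit
    \<open>(kap - 1) pi / 2\<close>, so that the equation is solved past the equator, and below
    \<open>pi\<close>, so that the cosine remains injective up to it.\<close>
  define t1 where "t1 = min (3 * pi / 4) ((pi/2 + (kap * (pi/2) - pi/2))/2)"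
  have "kap * (pi/2) > 2 * (pi/2)" using kap by (intro mult_strict_right_mono) auto
  then have t1: "pi/2 < t1" "t1 < pi" "t1 < kap * (pi/2) - pi/2" unfolding t1_def min_def using pi_gt_zero by (auto simp: field_simps)
  have "eventually (\<lambda>k. T k > t1) at_top" using order_tendstoD(1)[OF lim t1(3)] .
  then obtain k2 where k2: "T k2 > t1" "k2 > 0" 
    using eventually_conj[OF _ eventually_gt_at_top[of 0]] eventually_happens[of _ "at_top::real filter"] by (metis (mono_tags, lifting) trivial_limit_at_top_linorder)
  have "\<exists>k\<ge>0. k \<le> k2 \<and> T k = t1"
    by (rule IVT) (use T0 k2 t1 pi_gt_zero cT in \<open>auto intro: less_imp_le simp: \<close>)
  then obtain k1 where k1: "0 \<le> k1" "T k1 = t1" by blast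
  have "k1 \<noteq> 0" using k1 T0 t1 pi_gt_zero by auto
  then show ?thesis using that[of T k1] T0 k1 t1 D by auto
qed

text \<open>This makes \<open>k / sin \<theta>\<close> continuously differentiable in \<open>cos \<theta>\<close> up to \<open>\<theta> = 0\<close>, hence the barrier twice
  differentiable on the axis of symmetry.\<close>
lemma theta_limit:
  fixes p B :: real
  assumes p: "p > 2" and B: "B > 0" and T0: "T 0 = 0"
    and D: "\<And>k. (T has_real_derivative 1 / slope_rate p B (k\<^sup>2)) (at k)"
  obtains l where "((\<lambda>k. (k * cos (T k) - slope_rate p B (k\<^sup>2) * sin (T k)) / sin (T k) ^ 3) \<longlongrightarrow> l) (at_right 0)"
proof -
  define F where "F k = slope_rate p B (k\<^sup>2)" for k
  have Fpos: "F k > 0" for k unfolding F_def using slope_rate_pos[OF p B] by simp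
  have DF: "(F has_real_derivative slope_rate' p B (k\<^sup>2) * (2 * k)) (at k)" for k
    unfolding F_def by (auto intro!: derivative_eq_intros slope_rate_deriv[OF p, THEN DERIV_chain2])
  have DT: "(T has_real_derivative 1 / F k) (at k)" for k using D unfolding F_def .
  have DS: "((\<lambda>k. sin (T k)) has_real_derivative cos (T k) / F k) (at k)" for k
    by (auto intro!: derivative_eq_intros DT)
  have cT: "isCont T k" for k using DT DERIV_isCont by blast
  have cF: "isCont F k" for k using DF DERIV_isCont by blast
  have lims: "((\<lambda>k. sin (T k) / k) \<longlongrightarrow> 1 / F 0) (at_right 0)"
    using DS[of 0] T0 unfolding has_field_derivative_iff by (auto intro: tendsto_mono at_le)
  have cphi': "isCont (slope_rate' p B) 0" unfolding slope_rate'_def by (intro continuous_intros) auto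
  have limphi': "((\<lambda>k. slope_rate' p B (k\<^sup>2)) \<longlongrightarrow> slope_rate' p B 0) (at_right 0)"
    by (rule isCont_tendsto_compose[OF cphi']) (auto intro!: tendsto_eq_intros)
  \<comment> \<open>The derivative of \<open>N\<close> loses its cosine terms because
    \<open>T' = 1 / F\<close>. What remains carries a factor k and a factor
    \<open>sin (T k)\<close>, so \<open>N\<close> is of third order at 0.\<close>
  define N where "N k = k * cos (T k) - F k * sin (T k)" for k
  have DN: "(N has_real_derivative - (k / F k + slope_rate' p B (k\<^sup>2) * (2 * k)) * sin (T k)) (at k)" for k
    unfolding N_def using Fpos[of k]
    by (auto intro!: derivative_eq_intros DT DF DS simp: field_simps)
  have limF: "(F \<longlongrightarrow> F 0) (at_right 0)" using cF[of 0] unfolding isCont_def by (auto intro: tendsto_mono at_le)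
  have limT: "(T \<longlongrightarrow> 0) (at_right 0)" using cT[of 0] T0 unfolding isCont_def by (auto intro: tendsto_mono at_le)
  define l where "l = - (1 / F 0 + slope_rate' p B 0 * 2) * (1 / F 0) / 3"
  have "((\<lambda>k. N k / k ^ 3) \<longlongrightarrow> l) (at_right 0)"
  proof (rule lhopital_right_0[where f' = "\<lambda>k. - (k / F k + slope_rate' p B (k\<^sup>2) * (2 * k)) * sin (T k)" and g' = "\<lambda>k. 3 * k\<^sup>2"])
    show "(N \<longlongrightarrow> 0) (at_right 0)" unfolding N_def by (auto intro!: tendsto_eq_intros limF limT)
    show "((\<lambda>x. x ^ 3) \<longlongrightarrow> 0) (at_right (0::real))" by (auto intro!: tendsto_eq_intros)
    have "eventually (\<lambda>x::real. x \<noteq> 0) (at_right 0)" by (simp add: eventually_at_filter)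
    then show "\<forall>\<^sub>F x::real in at_right 0. x ^ 3 \<noteq> 0" "\<forall>\<^sub>F x::real in at_right 0. 3 * x\<^sup>2 \<noteq> 0" by auto
    show "\<forall>\<^sub>F x in at_right 0. (N has_real_derivative - (x / F x + slope_rate' p B (x\<^sup>2) * (2 * x)) * sin (T x)) (at x)"
      using DN by simp
    show "\<forall>\<^sub>F x in at_right 0. ((\<lambda>x. x ^ 3) has_real_derivative 3 * x\<^sup>2) (at (x::real))"
      by (auto intro!: always_eventually derivative_eq_intros)
    have "((\<lambda>k. - (1 / F k + slope_rate' p B (k\<^sup>2) * 2) * (sin (T k) / k) / 3) \<longlongrightarrow> l) (at_right 0)"
      unfolding l_def using Fpos[of 0] by (intro tendsto_intros limF limphi' lims) auto
    then show "((\<lambda>x. - (x / F x + slope_rate' p B (x\<^sup>2) * (2 * x)) * sin (T x) / (3 * x\<^sup>2)) \<longlongrightarrow> l) (at_right 0)"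
    proof (rule Lim_transform_eventually)
      show "\<forall>\<^sub>F k in at_right 0. - (1 / F k + slope_rate' p B (k\<^sup>2) * 2) * (sin (T k) / k) / 3
          = - (k / F k + slope_rate' p B (k\<^sup>2) * (2 * k)) * sin (T k) / (3 * k\<^sup>2)"
      proof (rule eventually_mono[OF \<open>eventually (\<lambda>x::real. x \<noteq> 0) (at_right 0)\<close>])
        fix k :: real assume "k \<noteq> 0"
        then show "- (1 / F k + slope_rate' p B (k\<^sup>2) * 2) * (sin (T k) / k) / 3
          = - (k / F k + slope_rate' p B (k\<^sup>2) * (2 * k)) * sin (T k) / (3 * k\<^sup>2)"
          using Fpos[of k] by (simp add: divide_simps power2_eq_square) (simp add: algebra_simps)?
      qed
    qed
  qed
  \<comment> \<open>As \<open>sin (T k) / k\<close> tends to \<open>1 / F 0\<close>, the cube of the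
    sine may replace \<open>k^3\<close>.\<close>
  then have "((\<lambda>k. (N k / k ^ 3) / (sin (T k) / k) ^ 3) \<longlongrightarrow> l / (1 / F 0) ^ 3) (at_right 0)"
    using Fpos[of 0] by (intro tendsto_intros lims) auto
  then have "((\<lambda>k. N k / sin (T k) ^ 3) \<longlongrightarrow> l / (1 / F 0) ^ 3) (at_right 0)"
  proof (rule Lim_transform_eventually)
    have "eventually (\<lambda>x::real. x \<noteq> 0) (at_right 0)" by (simp add: eventually_at_filter)
    then show "\<forall>\<^sub>F k in at_right 0. (N k / k ^ 3) / (sin (T k) / k) ^ 3 = N k / sin (T k) ^ 3"
      by eventually_elim (simp add: power_divide)
  qed
  then show ?thesis using that unfolding N_def F_def by blast
qed

text \<open>Here \<open>s = cos \<theta>\<close> and \<open>m = k / sin \<theta>\<close>, so that \<open>k\<^sup>2 = (1 - s\<^sup>2) m\<^sup>2\<close> and \<open>k' = s m - (1 - s\<^sup>2) m'\<close>. Beyond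
  \<open>s = 1\<close> the function m is continued linearly, which spares one-sided derivatives.\<close>
lemma profile_slope_exists:
  fixes p B :: real
  assumes p: "p > 2" and B: "B > 0" and slack: "4 * B * (B + p - 2) < (B + p - 1)\<^sup>2"
  obtains c0 :: real and m m' :: "real \<Rightarrow> real" where "-1 < c0" "c0 < 0"
    "\<And>s. c0 < s \<Longrightarrow> (m has_real_derivative m' s) (at s)"
    "continuous_on {c0<..} m'"
    "\<And>s. c0 < s \<Longrightarrow> s \<le> 1 \<Longrightarrow> m s > 0"
    "\<And>s. c0 < s \<Longrightarrow> s \<le> 1 \<Longrightarrow> s * m s - (1 - s\<^sup>2) * m' s = slope_rate p B ((1 - s\<^sup>2) * (m s)\<^sup>2)"
proof -
  obtain T k1 where T0: "T 0 = 0" and k1: "k1 > 0" "pi/2 < T k1" "T k1 < pi"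
    and DT: "\<And>k. (T has_real_derivative 1 / slope_rate p B (k\<^sup>2)) (at k)"
    using theta_exists[OF assms] by metis
  define t1 where "t1 = T k1"
  define F where "F k = slope_rate p B (k\<^sup>2)" for k
  have Fpos: "F k > 0" for k unfolding F_def using slope_rate_pos[OF p B] by simp
  have DT: "(T has_real_derivative 1 / F k) (at k)" for k using DT unfolding F_def .
  have cF: "isCont F k" for k
  proof -
    have "(F has_real_derivative slope_rate' p B (k\<^sup>2) * (2 * k)) (at k)"
      unfolding F_def by (auto intro!: derivative_eq_intros slope_rate_deriv[OF p, THEN DERIV_chain2])
    then show ?thesis by (rule DERIV_isCont)
  qed
  have cT: "isCont T k" for k using DT DERIV_isCont by blast
  have mono: "T x < T y" if "x < y" for x y
    by (rule DERIV_pos_imp_increasing[OF that]) (use DT Fpos in \<open>force\<close>)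
  then have inj: "inj T" by (metis injI linorder_neqE_linordered_idom less_irrefl)
  define K where "K = inv T"
  have KT: "K (T k) = k" for k unfolding K_def using inj by simp
  \<comment> \<open>The range starts at the negative value \<open>T (-1)\<close>, so that the
    inverse is defined and differentiable on both sides of 0; any other negative argument would
    serve as well.\<close>
  have rng: "\<exists>k. k > -1 \<and> k \<le> k1 \<and> T k = t" if "T (-1) < t" "t \<le> t1" for t
  proof -
    have "\<exists>k\<ge>-1. k \<le> k1 \<and> T k = t"
      by (rule IVT) (use that k1 cT in \<open>auto simp: t1_def\<close>)
    then show ?thesis using that by (metis order_le_less less_irrefl)
  qed
  have TK: "T (K t) = t" if "T (-1) < t" "t \<le> t1" for t using rng[OF that] KT by metis
  have cK: "isCont K t" if t: "T (-1) < t" "t < t1" for t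
  proof -
    obtain k where k: "k > -1" "k \<le> k1" "T k = t" using rng t by (metis less_imp_le)
    have "isCont K (T k)" by (rule isCont_inverse_function[where d = 1]) (auto simp: KT cT)
    with k show ?thesis by simp
  qed
  have DK: "(K has_real_derivative F (K t)) (at t)" if t: "T (-1) < t" "t < t1" for t
  proof -
    have "(K has_real_derivative inverse (1 / F (K t))) (at t)"
      by (rule DERIV_inverse_function[where f = T and a = "T (-1)" and b = t1]) (use t DT Fpos[of "K t"] TK cK in auto)
    then show ?thesis by simp
  qed
  have Tm1: "T (-1) < 0" using mono[of "-1" 0] T0 by simp
  have K0: "K 0 = 0" using KT[of 0] T0 by simp
  have Kpos: "K t > 0" if "0 < t" "t \<le> t1" for t
  proof (rule ccontr)
    assume "\<not> K t > 0"
    then have "T (K t) \<le> 0" using mono[of "K t" 0] T0 by (cases "K t = 0") auto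
    then show False using TK[of t] that Tm1 by simp
  qed
  have t1: "pi/2 < t1" "t1 < pi" using k1 unfolding t1_def by auto
  \<comment> \<open>Negative because \<open>t1 > pi / 2\<close>: the profile reaches beyond the
    equator and has two-sided derivatives at \<open>s = 0\<close>.\<close>
  define c0 where "c0 = cos t1"
  have c0: "-1 < c0" "c0 < 0"
  proof -
    show "-1 < c0" unfolding c0_def using cos_monotone_0_pi[of t1 pi] t1 pi_gt_zero by simp
    show "c0 < 0" unfolding c0_def using cos_monotone_0_pi[of "pi/2" t1] t1 pi_gt_zero by simp
  qed
  have arc: "0 < arccos s" "arccos s < t1" if "c0 < s" "s < 1" for s
  proof -
    show "0 < arccos s" using that c0 arccos_lt_bounded[of s] by simp
    have "arccos s < arccos c0" using that c0 by (intro arccos_less_arccos) auto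
    then show "arccos s < t1" unfolding c0_def using t1 pi_gt_zero by (simp add: arccos_cos)
  qed
  define m1 where "m1 s = K (arccos s) / sqrt (1 - s\<^sup>2)" for s
  define m1' where "m1' s = (s * m1 s - F (K (arccos s))) / (1 - s\<^sup>2)" for s
  have sq: "1 - s\<^sup>2 > 0" if "c0 < s" "s < 1" for s
    using that c0 by (simp add: abs_square_less_1)
  have D1: "(m1 has_real_derivative m1' s) (at s)" if s: "c0 < s" "s < 1" for s
  proof -
    have r: "sqrt (1 - s\<^sup>2) > 0" using sq[OF s] by simp
    have rr: "sqrt (1 - s\<^sup>2) * sqrt (1 - s\<^sup>2) = 1 - s\<^sup>2" using sq[OF s] by simp
    have "((\<lambda>s. K (arccos s)) has_real_derivative F (K (arccos s)) * inverse (- sqrt (1 - s\<^sup>2))) (at s)"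
      by (rule DERIV_chain2[OF DK DERIV_arccos]) (use arc[OF s] Tm1 s c0 in auto)
    moreover have "((\<lambda>s. sqrt (1 - s\<^sup>2)) has_real_derivative - s / sqrt (1 - s\<^sup>2)) (at s)"
      using sq[OF s] by (auto intro!: derivative_eq_intros simp: divide_simps)
    ultimately have "(m1 has_real_derivative (F (K (arccos s)) * inverse (- sqrt (1 - s\<^sup>2)) * sqrt (1 - s\<^sup>2)
        - K (arccos s) * (- s / sqrt (1 - s\<^sup>2))) / (sqrt (1 - s\<^sup>2) * sqrt (1 - s\<^sup>2))) (at s)"
      unfolding m1_def using r by (intro DERIV_divide) auto
    moreover have "(F (K (arccos s)) * inverse (- sqrt (1 - s\<^sup>2)) * sqrt (1 - s\<^sup>2)
        - K (arccos s) * (- s / sqrt (1 - s\<^sup>2))) / (sqrt (1 - s\<^sup>2) * sqrt (1 - s\<^sup>2)) = m1' s"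
      unfolding m1'_def rr m1_def using r by (simp add: field_simps)
    ultimately show ?thesis by simp
  qed
  \<comment> \<open>The quotient in \<open>theta_limit\<close> is \<open>m1'\<close> expressed
    through the slope, so \<open>l\<close> is the limit of \<open>m1'\<close> at the pole
    \<open>s = 1\<close>.\<close>
  obtain l where l: "((\<lambda>k. (k * cos (T k) - F k * sin (T k)) / sin (T k) ^ 3) \<longlongrightarrow> l) (at_right 0)"
    using theta_limit[where T = T, OF p B T0] DT unfolding F_def by metis
  have ev: "eventually (\<lambda>s. c0 < s \<and> s < 1) (at_left 1)"
    using c0 by (auto simp: eventually_at_left_field intro!: exI[of _ c0])
  have limarc: "(arccos \<longlongrightarrow> 0) (at_left 1)"
  proof -
    have "continuous_on {-1..1} arccos" by (rule continuous_on_arccos')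
    then have "(arccos \<longlongrightarrow> arccos 1) (at 1 within {-1..1})" unfolding continuous_on_def by (simp del: arccos_1)
    then show ?thesis by (simp add: at_within_Icc_at_left)
  qed
  have limarc': "filterlim arccos (at_right 0) (at_left 1)"
  proof -
    have "\<forall>\<^sub>F x in at_left 1. 0 < arccos x" by (rule eventually_mono[OF ev]) (use arc in auto)
    then show ?thesis using limarc unfolding filterlim_at by (auto elim: eventually_mono)
  qed
  have limK: "filterlim K (at_right 0) (at_right 0)"
  proof -
    have "(K \<longlongrightarrow> 0) (at_right 0)" using cK[of 0] Tm1 t1 K0 pi_gt_zero unfolding isCont_def by (auto intro: tendsto_mono at_le)
    moreover have "eventually (\<lambda>t. 0 < t \<and> t < t1) (at_right 0)" 
      using t1 pi_gt_zero by (auto simp: eventually_at_right_field intro!: exI[of _ t1])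
    then have "eventually (\<lambda>t. K t > 0) (at_right 0)" by eventually_elim (use Kpos in auto)
    ultimately show ?thesis unfolding filterlim_at by (auto elim: eventually_mono)
  qed
  have limKa: "filterlim (\<lambda>s. K (arccos s)) (at_right 0) (at_left 1)"
    by (rule filterlim_compose[OF limK limarc'])
  have limm1': "(m1' \<longlongrightarrow> l) (at_left 1)"
  proof (rule Lim_transform_eventually[OF filterlim_compose[OF l limKa]])
    show "\<forall>\<^sub>F s in at_left 1. (K (arccos s) * cos (T (K (arccos s))) - F (K (arccos s)) * sin (T (K (arccos s)))) /
        sin (T (K (arccos s))) ^ 3 = m1' s"
    proof (rule eventually_mono[OF ev])
      fix s assume s: "c0 < s \<and> s < 1"
      have T: "T (K (arccos s)) = arccos s" using TK arc[of s] s Tm1 by simp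
      have c: "cos (arccos s) = s" "sin (arccos s) = sqrt (1 - s\<^sup>2)" using s c0 by (auto simp: sin_arccos)
      have r: "sqrt (1 - s\<^sup>2) > 0" using sq s by simp
      have rr: "sqrt (1 - s\<^sup>2) ^ 3 = (1 - s\<^sup>2) * sqrt (1 - s\<^sup>2)" using sq[of s] s by (simp add: power3_eq_cube)
      show "(K (arccos s) * cos (T (K (arccos s))) - F (K (arccos s)) * sin (T (K (arccos s)))) /
        sin (T (K (arccos s))) ^ 3 = m1' s"
        unfolding T c m1'_def m1_def rr using r sq[of s] s by (simp add: field_simps)
    qed
  qed
  have limm1: "(m1 \<longlongrightarrow> F 0) (at_left 1)"
  proof -
    have "((\<lambda>k. k / sin (T k)) \<longlongrightarrow> F 0) (at_right 0)"
    proof -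
      have "((\<lambda>k. sin (T k)) has_real_derivative cos (T 0) * (1 / F 0)) (at 0)" by (auto intro!: derivative_eq_intros DT)
      then have "((\<lambda>k. sin (T k) / k) \<longlongrightarrow> 1 / F 0) (at_right 0)"
        using T0 unfolding has_field_derivative_iff by (auto intro: tendsto_mono at_le)
      then have "((\<lambda>k. inverse (sin (T k) / k)) \<longlongrightarrow> inverse (1 / F 0)) (at_right 0)"
        by (rule tendsto_inverse) (use Fpos[of 0] in simp)
      then show ?thesis by simp
    qed
    from filterlim_compose[OF this limKa] show ?thesis
    proof (rule Lim_transform_eventually)
      show "\<forall>\<^sub>F s in at_left 1. K (arccos s) / sin (T (K (arccos s))) = m1 s"
      proof (rule eventually_mono[OF ev])
        fix s assume s: "c0 < s \<and> s < 1"
        have T: "T (K (arccos s)) = arccos s" using TK arc[of s] s Tm1 by simp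
        show "K (arccos s) / sin (T (K (arccos s))) = m1 s" unfolding T m1_def using s c0 by (simp add: sin_arccos)
      qed
    qed
  qed
  define m where "m s = (if s < 1 then m1 s else F 0 + l * (s - 1))" for s
  define m' where "m' s = (if s < 1 then m1' s else l)" for s
  have Dm: "(m has_real_derivative m' s) (at s)" if s: "c0 < s" for s
  proof -
    consider "s < 1" | "s > 1" | "s = 1" by linarith
    then show ?thesis
    proof cases
      case 1
      have "eventually (\<lambda>x. x \<in> {..<1}) (nhds s)" using 1 by (intro eventually_nhds_in_open) auto
      then have "eventually (\<lambda>x. m1 x = m x) (nhds s)" by eventually_elim (simp add: m_def)
      from DERIV_cong_ev[OF refl this refl] D1[OF s 1] show ?thesis unfolding m'_def using 1 by simp
    next
      case 2
      have "eventually (\<lambda>x. x \<in> {1<..}) (nhds s)" using 2 by (intro eventually_nhds_in_open) auto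
      then have "eventually (\<lambda>x. F 0 + l * (x - 1) = m x) (nhds s)" by eventually_elim (simp add: m_def)
      moreover have "((\<lambda>x. F 0 + l * (x - 1)) has_real_derivative l) (at s)" by (auto intro!: derivative_eq_intros)
      ultimately have "(m has_real_derivative l) (at s)"
        using DERIV_cong_ev[OF refl, of "\<lambda>x. F 0 + l * (x - 1)" m s l l] by simp
      then show ?thesis unfolding m'_def using 2 by simp
    next
      case 3
      \<comment> \<open>From the left the derivative at the pole is the limit of the derivatives, by
        the rule of l'Hopital; from the right it is that of the linear continuation.\<close>
      have "((\<lambda>s. (m s - m 1) / (s - 1)) \<longlongrightarrow> l) (at_left 1)"
      proof (rule lhopital_left[where f' = m1' and g' = "\<lambda>_. 1"])
        have "(m \<longlongrightarrow> F 0) (at_left 1)"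
          by (rule Lim_transform_eventually[OF limm1]) (auto intro: eventually_mono[OF ev] simp: m_def)
        then have "((\<lambda>s. m s - m 1) \<longlongrightarrow> F 0 - m 1) (at_left 1)" by (intro tendsto_intros)
        then show "((\<lambda>s. m s - m 1) \<longlongrightarrow> 0) (at_left 1)" by (simp add: m_def)
        show "((\<lambda>x. x - 1) \<longlongrightarrow> 0) (at_left (1::real))" by (auto intro!: tendsto_eq_intros)
        show "\<forall>\<^sub>F x in at_left 1. x - 1 \<noteq> (0::real)" by (rule eventually_mono[OF ev]) auto
        show "\<forall>\<^sub>F x in at_left (1::real). 1 \<noteq> (0::real)" by simp
        show "\<forall>\<^sub>F x in at_left 1. ((\<lambda>s. m s - m 1) has_real_derivative m1' x) (at x)"
        proof (rule eventually_mono[OF ev])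
          fix s assume s: "c0 < s \<and> s < 1"
          have "eventually (\<lambda>x. x \<in> {..<1}) (nhds s)" using s by (intro eventually_nhds_in_open) auto
          then have "eventually (\<lambda>x. m1 x = m x) (nhds s)" by eventually_elim (simp add: m_def)
          from DERIV_cong_ev[OF refl this refl] D1[of s] s have "(m has_real_derivative m1' s) (at s)" by simp
          then show "((\<lambda>s. m s - m 1) has_real_derivative m1' s) (at s)" by (auto intro!: derivative_eq_intros)
        qed
        show "\<forall>\<^sub>F x in at_left 1. ((\<lambda>x. x - 1) has_real_derivative 1) (at (x::real))" by (auto intro!: always_eventually derivative_eq_intros)
        show "((\<lambda>x. m1' x / 1) \<longlongrightarrow> l) (at_left 1)" using limm1' by simp
      qed
      moreover have "((\<lambda>s. (m s - m 1) / (s - 1)) \<longlongrightarrow> l) (at_right 1)"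
      proof (rule Lim_transform_eventually[OF tendsto_const])
        have "eventually (\<lambda>s. s > 1) (at_right (1::real))" by (simp add: eventually_at_filter)
        then show "\<forall>\<^sub>F s in at_right 1. l = (m s - m 1) / (s - 1)" by eventually_elim (simp add: m_def)
      qed
      ultimately have "((\<lambda>s. (m s - m 1) / (s - 1)) \<longlongrightarrow> l) (at 1)" by (simp add: filterlim_split_at)
      then show ?thesis unfolding has_field_derivative_iff m'_def using 3 by simp
    qed
  qed
  have cm: "isCont m s" if "c0 < s" for s using Dm[OF that] DERIV_isCont by blast
  have cm': "isCont m' s" if s: "c0 < s" for s
  proof -
    consider "s < 1" | "s > 1" | "s = 1" by linarith
    then show ?thesis
    proof cases
      case 1
      have "isCont arccos s" using DERIV_arccos[of s] 1 s c0 by (intro DERIV_isCont) auto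
      moreover have "isCont K (arccos s)" using cK arc[of s] s 1 Tm1 by simp
      ultimately have "isCont (\<lambda>s. K (arccos s)) s" by (rule isCont_o2)
      then have "isCont (\<lambda>s. F (K (arccos s))) s" by (rule isCont_o2) (rule cF)
      moreover have "isCont m1 s" using D1[of s] s 1 DERIV_isCont by blast
      ultimately have "isCont m1' s" unfolding m1'_def using sq[of s] s 1 by (intro continuous_intros) auto
      have "eventually (\<lambda>x. x \<in> {..<1}) (nhds s)" using 1 by (intro eventually_nhds_in_open) auto
      then have "eventually (\<lambda>x. m1' x = m' x) (nhds s)" by eventually_elim (simp add: m'_def)
      from isCont_cong[OF this] \<open>isCont m1' s\<close> show ?thesis by simp
    next
      case 2
      have "eventually (\<lambda>x. x \<in> {1<..}) (nhds s)" using 2 by (intro eventually_nhds_in_open) auto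
      then have "eventually (\<lambda>x. m' x = l) (nhds s)" by eventually_elim (simp add: m'_def)
      from isCont_cong[OF this] show ?thesis by simp
    next
      case 3
      have "(m' \<longlongrightarrow> l) (at_left 1)"
        by (rule Lim_transform_eventually[OF limm1']) (auto intro: eventually_mono[OF ev] simp: m'_def)
      moreover have "(m' \<longlongrightarrow> l) (at_right 1)"
      proof (rule Lim_transform_eventually[OF tendsto_const])
        have "eventually (\<lambda>s. s > 1) (at_right (1::real))" by (simp add: eventually_at_filter)
        then show "\<forall>\<^sub>F s in at_right 1. l = m' s" by eventually_elim (simp add: m'_def)
      qed
      ultimately have "(m' \<longlongrightarrow> l) (at 1)" by (simp add: filterlim_split_at)
      then show ?thesis unfolding isCont_def using 3 by (simp add: m'_def)
    qed
  qed
  have mpos: "m s > 0" if "c0 < s" "s \<le> 1" for s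
  proof (cases "s < 1")
    case True
    then have "m1 s > 0" unfolding m1_def using that Kpos[of "arccos s"] arc[of s] sq[of s] by simp
    with True show ?thesis by (simp add: m_def)
  next
    case False
    with that have "s = 1" by simp
    then show ?thesis by (simp add: m_def Fpos)
  qed
  have ode: "s * m s - (1 - s\<^sup>2) * m' s = slope_rate p B ((1 - s\<^sup>2) * (m s)\<^sup>2)" if s: "c0 < s" "s \<le> 1" for s
  proof (cases "s < 1")
    case True
    have "(1 - s\<^sup>2) * (m1 s)\<^sup>2 = (K (arccos s))\<^sup>2"
      unfolding m1_def using sq[OF s(1) True] by (simp add: power_divide)
    then show ?thesis using sq[OF s(1) True] True unfolding m_def m'_def m1'_def F_def by simp
  next
    case False
    with that have "s = 1" by simp
    then show ?thesis by (simp add: m_def F_def)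
  qed
  show ?thesis
    by (rule that[of c0 m m']) (use c0 Dm cm' mpos ode in \<open>auto intro: continuous_at_imp_continuous_on\<close>)
qed


text \<open>\<open>H\<close> starts at -1 in \<open>c0\<close> and has derivative
  \<open>- m\<close>; as \<open>m\<close> is positive up to 1 it only decreases there, and
  \<open>H \<le> -1\<close> will put the barrier above 1 on the unit sphere. The last inequality is
  the slope equation for \<open>\<gamma>\<close>, with its coefficient
  \<open>\<gamma> (p - 1)\<close> lowered to \<open>\<beta> (p - 1)\<close>. The interval extends
  past 0 and 1 to make all derivatives two-sided; 2 stands for any number above 1.\<close>

lemma profile_exists:
  fixes p \<beta> :: real
  assumes p: "p > 2" and b0: "0 < \<beta>"
    and b: "\<beta> < - 1/3 + 2 / (3 * (p - 1)) + sqrt ((- 1/3 + 2 / (3 * (p - 1)))\<^sup>2 + 1/3)"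
  obtains c0 :: real and H m m' :: "real \<Rightarrow> real" where "c0 < 0"
    "\<And>s. c0 < s \<Longrightarrow> s < 2 \<Longrightarrow> (H has_real_derivative - m s) (at s)"
    "\<And>s. c0 < s \<Longrightarrow> s < 2 \<Longrightarrow> (m has_real_derivative m' s) (at s)"
    "continuous_on {c0<..<2} m'"
    "\<And>s. 0 \<le> s \<Longrightarrow> s \<le> 1 \<Longrightarrow> m s > 0"
    "\<And>s. 0 \<le> s \<Longrightarrow> s \<le> 1 \<Longrightarrow> H s \<le> -1"
    "\<And>s. 0 \<le> s \<Longrightarrow> s \<le> 1 \<Longrightarrow>
      (1 + (p - 1) * ((1 - s\<^sup>2) * (m s)\<^sup>2)) * (s * m s - (1 - s\<^sup>2) * m' s) - (p - 2) * (1 + (1 - s\<^sup>2) * (m s)\<^sup>2)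
      > \<beta> * (p - 1) * (1 + (1 - s\<^sup>2) * (m s)\<^sup>2)\<^sup>2"
proof -
  obtain g where g: "\<beta> < g" "4 * (g * (p-1)) * (g * (p-1) + p - 2) < ((1 + g) * (p - 1))\<^sup>2"
    using exponent_slack[OF assms] by metis
  define B where "B = g * (p - 1)"
  have B: "B > 0" "B > \<beta> * (p - 1)" using g p b0 unfolding B_def by auto
  have "4 * B * (B + p - 2) < (B + p - 1)\<^sup>2" using g(2) unfolding B_def by (simp add: algebra_simps)
  then obtain c1 :: real and m m' :: "real \<Rightarrow> real" where c1: "-1 < c1" "c1 < 0"
    and Dm: "\<And>s. c1 < s \<Longrightarrow> (m has_real_derivative m' s) (at s)"
    and cm': "continuous_on {c1<..} m'"
    and mpos: "\<And>s. c1 < s \<Longrightarrow> s \<le> 1 \<Longrightarrow> m s > 0"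
    and ode: "\<And>s. c1 < s \<Longrightarrow> s \<le> 1 \<Longrightarrow> s * m s - (1 - s\<^sup>2) * m' s = slope_rate p B ((1 - s\<^sup>2) * (m s)\<^sup>2)"
    using profile_slope_exists[OF p B(1)] by metis
  \<comment> \<open>Halving puts the closed interval from \<open>c0\<close> to 2 inside the domain
    of \<open>m\<close>.\<close>
  define c0 where "c0 = c1 / 2"
  have c0: "c1 < c0" "c0 < 0" using c1 unfolding c0_def by auto
  have cm: "continuous_on {c0..2} m"
    by (intro continuous_at_imp_continuous_on ballI DERIV_isCont[OF Dm]) (use c0 in auto)
  define H where "H s = - 1 - integral {c0..s} m" for s
  have DH: "(H has_real_derivative - m s) (at s)" if s: "c0 < s" "s < 2" for s
  proof -
    have "((\<lambda>u. integral {c0..u} m) has_real_derivative m s) (at s within {c0..2})"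
      by (rule integral_has_real_derivative[OF cm]) (use s in auto)
    then have "((\<lambda>u. integral {c0..u} m) has_real_derivative m s) (at s)"
      using s by (simp add: at_within_Icc_at)
    then show ?thesis unfolding H_def by (auto intro!: derivative_eq_intros)
  qed
  have H1: "H s \<le> -1" if s: "0 \<le> s" "s \<le> 1" for s
  proof -
    have "m integrable_on {c0..s}"
      by (rule integrable_continuous_real) (rule continuous_on_subset[OF cm], use s in auto)
    then have "integral {c0..s} m \<ge> 0"
    proof (rule Henstock_Kurzweil_Integration.integral_nonneg)
      fix t assume "t \<in> {c0..s}"
      then have "c1 < t" "t \<le> 1" using s c0 by auto
      then show "0 \<le> m t" using mpos[of t] by simp
    qed
    then show ?thesis by (simp add: H_def)
  qed
  have ineq: "(1 + (p - 1) * ((1 - s\<^sup>2) * (m s)\<^sup>2)) * (s * m s - (1 - s\<^sup>2) * m' s) - (p - 2) * (1 + (1 - s\<^sup>2) * (m s)\<^sup>2)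
      > \<beta> * (p - 1) * (1 + (1 - s\<^sup>2) * (m s)\<^sup>2)\<^sup>2" if s: "0 \<le> s" "s \<le> 1" for s
  proof -
    define q where "q = (1 - s\<^sup>2) * (m s)\<^sup>2"
    have q: "q \<ge> 0" unfolding q_def using s by (simp add: power_le_one)
    have e: "s * m s - (1 - s\<^sup>2) * m' s = slope_rate p B q" unfolding q_def using ode[of s] s c1 by simp
    have "(1 + (p - 1) * q) * slope_rate p B q - (p - 2) * (1 + q) = B * (1 + q)\<^sup>2"
    proof -
      have "(1 + (p - 1) * q) * slope_rate p B q = (1 + q) * (B * (1 + q) + p - 2)"
        unfolding slope_rate_def using slope_rate_denom_pos[OF p q] by simp
      then show ?thesis by (simp add: power2_eq_square algebra_simps)
    qed
    moreover have "B * (1 + q)\<^sup>2 > \<beta> * (p - 1) * (1 + q)\<^sup>2" using B q by (intro mult_strict_right_mono) auto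
    ultimately show ?thesis unfolding e q_def[symmetric] by simp
  qed
  show ?thesis
  proof (rule that[of c0 H m m'])
    show "continuous_on {c0<..<2} m'" by (rule continuous_on_subset[OF cm']) (use c0 in auto)
    show "(m has_real_derivative m' s) (at s)" if "c0 < s" for s using Dm that c0 by simp
    show "m s > 0" if "0 \<le> s" "s \<le> 1" for s using mpos that c1 by simp
  qed (fact c0 DH H1 ineq)+
qed

section \<open>The supersolution in the half-space\<close>

lemma has_derivative_norm_inner:
  fixes x :: "real^'n::finite"
  assumes "x \<noteq> 0"
  shows "(norm has_derivative (\<lambda>h. ((1 / norm x) *\<^sub>R x) \<bullet> h)) (at x)"
  using has_derivative_norm[OF assms] by (simp add: sgn_div_norm inner_commute divide_inverse_commute)

lemma latitude_derivative:
  fixes x :: "real^'n::finite"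
  assumes "x \<noteq> 0"
  shows "((\<lambda>x. x $ k / norm x) has_derivative
    (\<lambda>h. ((1 / (norm x)\<^sup>2) *\<^sub>R (norm x *\<^sub>R axis k 1 - (x $ k / norm x) *\<^sub>R x)) \<bullet> h)) (at x)"
proof -
  have n: "norm x \<noteq> 0" using assms by simp
  have k: "((\<lambda>x::real^'n. x $ k) has_derivative (\<lambda>h. h $ k)) (at x)"
    by (rule bounded_linear.has_derivative[OF bounded_linear_vec_nth]) (rule has_derivative_ident)
  have "((\<lambda>x. x $ k / norm x) has_derivative
      (\<lambda>h. (h $ k * norm x - x $ k * (((1 / norm x) *\<^sub>R x) \<bullet> h)) / (norm x * norm x))) (at x)"
    by (rule has_derivative_divide'[OF k has_derivative_norm_inner[OF assms] n])
  moreover have "(h $ k * norm x - x $ k * (((1 / norm x) *\<^sub>R x) \<bullet> h)) / (norm x * norm x)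
      = ((1 / (norm x)\<^sup>2) *\<^sub>R (norm x *\<^sub>R axis k 1 - (x $ k / norm x) *\<^sub>R x)) \<bullet> h" for h
    using n by (simp add: inner_diff_left inner_axis' power2_eq_square mult.commute)
  ultimately show ?thesis by simp
qed

text \<open>The left-hand side is the divergence of the flux of the barrier up to a positive factor, see
  \<open>divergence_pos\<close> below.\<close>
lemma flux_divergence_pos:
  fixes n q m m' s p \<beta> :: real
  assumes n: "n \<ge> 2" and m: "m > 0" and s: "s \<ge> 0" "s \<le> 1" and q: "q = (1 - s\<^sup>2) * m\<^sup>2"
    and ineq: "(1 + (p - 1) * q) * (s * m - (1 - s\<^sup>2) * m') - (p - 2) * (1 + q) > \<beta> * (p - 1) * (1 + q)\<^sup>2"
  shows "n * (1 + m * s) - m' * (1 - s\<^sup>2) - m * s - (\<beta> * (p - 1) + p)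
    - m * (1 - s\<^sup>2) * (\<beta> * (p - 1) * m + (p - 2) / 2 * ((- 2 * s * m\<^sup>2 + 2 * (1 - s\<^sup>2) * m * m') / (1 + q))) > 0"
    (is "?T > 0")
proof -
  have q0: "q \<ge> 0" unfolding q using s by (simp add: power_le_one)
  \<comment> \<open>The derivative of the slope with respect to the polar angle.\<close>
  define d where "d = s * m - (1 - s\<^sup>2) * m'"
  have 1: "m * (1 - s\<^sup>2) * (\<beta> * (p - 1) * m) = \<beta> * (p - 1) * q" unfolding q by (simp add: power2_eq_square)
  have 2: "m * (1 - s\<^sup>2) * (- 2 * s * m\<^sup>2 + 2 * (1 - s\<^sup>2) * m * m') = - 2 * q * d"
    unfolding q d_def by (simp add: power2_eq_square algebra_simps)
  have 3: "m * (1 - s\<^sup>2) * ((p - 2) / 2 * ((- 2 * s * m\<^sup>2 + 2 * (1 - s\<^sup>2) * m * m') / (1 + q))) = - ((p - 2) * (q * d / (1 + q)))"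
  proof -
    have "m * (1 - s\<^sup>2) * ((p - 2) / 2 * ((- 2 * s * m\<^sup>2 + 2 * (1 - s\<^sup>2) * m * m') / (1 + q)))
      = (p - 2) / 2 * ((m * (1 - s\<^sup>2) * (- 2 * s * m\<^sup>2 + 2 * (1 - s\<^sup>2) * m * m')) / (1 + q))" by simp
    then show ?thesis unfolding 2 by simp
  qed
  have 4: "m' * (1 - s\<^sup>2) = s * m - d" unfolding d_def by simp
  have "?T = n * (1 + m * s) - (s * m - d) - m * s - (\<beta> * (p - 1) + p) - (\<beta> * (p - 1) * q + - ((p - 2) * (q * d / (1 + q))))"
    by (simp only: distrib_left[of "m * (1 - s\<^sup>2)"] 1 3 4)
  then have T: "?T = n * (1 + m * s) + d - 2 * (m * s) - (\<beta> * (p - 1) + p) - \<beta> * (p - 1) * q + (p - 2) * (q * d / (1 + q))"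
    by (simp add: mult.commute[of s m])
  have "(1 + q) * ?T = (1 + q) * (n * (1 + m * s) + d - 2 * (m * s) - (\<beta> * (p - 1) + p) - \<beta> * (p - 1) * q) + (p - 2) * (q * d)"
    unfolding T using q0 by (simp add: distrib_left)
  \<comment> \<open>The planar expression splits off; the further dimensions contribute the
    nonnegative remainder with the factor \<open>n - 2\<close>.\<close>
  also have "\<dots> = ((1 + (p - 1) * q) * d - (p - 2) * (1 + q) - \<beta> * (p - 1) * (1 + q)\<^sup>2) + (1 + q) * (n - 2) * (1 + m * s)"
    by (simp add: power2_eq_square algebra_simps)
  also have "\<dots> > 0"
  proof (rule add_pos_nonneg)
    show "0 < (1 + (p - 1) * q) * d - (p - 2) * (1 + q) - \<beta> * (p - 1) * (1 + q)\<^sup>2" using ineq unfolding d_def by simp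
    show "0 \<le> (1 + q) * (n - 2) * (1 + m * s)" using q0 n m s by simp
  qed
  finally show ?thesis using q0 by (simp add: zero_less_mult_iff)
qed

text \<open>Collects the output of \<open>profile_exists\<close>. The assumptions refer to the axis
  \<open>k\<close> only through its index type, so one profile serves all axes.\<close>

locale halfspace_profile =
  fixes p \<beta> c0 :: real and H m m' :: "real \<Rightarrow> real" and k :: "'n::finite"
  assumes card2: "CARD('n) \<ge> 2" and p2: "p > 2" and \<beta>0: "\<beta> > 0" and c0: "c0 < 0"
    and DH: "\<And>s. c0 < s \<Longrightarrow> s < 2 \<Longrightarrow> (H has_real_derivative - m s) (at s)"
    and Dm: "\<And>s. c0 < s \<Longrightarrow> s < 2 \<Longrightarrow> (m has_real_derivative m' s) (at s)"
    and cm': "continuous_on {c0<..<2} m'"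
    and mpos: "\<And>s. 0 \<le> s \<Longrightarrow> s \<le> 1 \<Longrightarrow> m s > 0"
    and H1: "\<And>s. 0 \<le> s \<Longrightarrow> s \<le> 1 \<Longrightarrow> H s \<le> -1"
    and ineq: "\<And>s. 0 \<le> s \<Longrightarrow> s \<le> 1 \<Longrightarrow>
      (1 + (p - 1) * ((1 - s\<^sup>2) * (m s)\<^sup>2)) * (s * m s - (1 - s\<^sup>2) * m' s) - (p - 2) * (1 + (1 - s\<^sup>2) * (m s)\<^sup>2)
      > \<beta> * (p - 1) * (1 + (1 - s\<^sup>2) * (m s)\<^sup>2)\<^sup>2"
begin

section \<open>The barrier, its flux and their derivatives as explicit fields\<close>

definition lat :: "real^'n \<Rightarrow> real" where "lat x = x $ k / norm x"
definition dlat :: "real^'n \<Rightarrow> real^'n" where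
  "dlat x = (1 / (norm x)\<^sup>2) *\<^sub>R (norm x *\<^sub>R axis k 1 - lat x *\<^sub>R x)"
text \<open>One plus the squared slope: the gradient of \<open>ln r + H\<close> has norm
  \<open>sqrt E / r\<close>.\<close>

definition E :: "real \<Rightarrow> real" where "E s = 1 + (1 - s\<^sup>2) * (m s)\<^sup>2"
definition E' :: "real \<Rightarrow> real" where "E' s = - 2 * s * (m s)\<^sup>2 + 2 * (1 - s\<^sup>2) * m s * m' s"
text \<open>\<open>Y / r^2\<close> is the gradient of \<open>ln r + H\<close>; this makes
  \<open>W\<close> below the gradient of \<open>w\<close>.\<close>

definition Y :: "real^'n \<Rightarrow> real^'n" where
  "Y x = (1 + m (lat x) * lat x) *\<^sub>R x - (m (lat x) * norm x) *\<^sub>R axis k 1"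
definition w :: "real^'n \<Rightarrow> real" where "w x = exp (- \<beta> * (ln (norm x) + H (lat x)))"
definition W :: "real^'n \<Rightarrow> real^'n" where "W x = (- \<beta> * w x / (norm x)\<^sup>2) *\<^sub>R Y x"
text \<open>The logarithm of \<open>w^(p-1) r^(-p) E^((p-2)/2)\<close>, which is the scalar factor
  of the flux along \<open>- Y\<close> up to the power \<open>\<beta>^(p-1)\<close>. In logarithmic
  form its gradient is a sum.\<close>

definition \<Lambda> :: "real^'n \<Rightarrow> real" where
  "\<Lambda> x = - \<beta> * (p - 1) * H (lat x) + (p - 2) / 2 * ln (E (lat x)) - (\<beta> * (p - 1) + p) * ln (norm x)"
definition d\<Lambda> :: "real^'n \<Rightarrow> real^'n" where
  "d\<Lambda> x = (\<beta> * (p - 1) * m (lat x) + (p - 2) / 2 * (E' (lat x) / E (lat x))) *\<^sub>R dlat x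
     - ((\<beta> * (p - 1) + p) / (norm x)\<^sup>2) *\<^sub>R x"
definition dY :: "'n \<Rightarrow> real^'n \<Rightarrow> real^'n" where
  "dY i x = (1 + m (lat x) * lat x) *\<^sub>R axis i 1 + (x $ i * (m' (lat x) * lat x + m (lat x))) *\<^sub>R dlat x
     - (axis k 1 $ i) *\<^sub>R ((m' (lat x) * norm x) *\<^sub>R dlat x + (m (lat x) / norm x) *\<^sub>R x)"
definition dX :: "'n \<Rightarrow> real^'n \<Rightarrow> real^'n" where
  "dX i x = (- (\<beta> powr (p - 1) * exp (\<Lambda> x))) *\<^sub>R (Y x $ i *\<^sub>R d\<Lambda> x + dY i x)"
definition D :: "(real^'n) set" where "D = {x. x $ k > 0 \<and> norm x > 1}"

lemma open_D: "open D"
  unfolding D_def by (intro open_Collect_conj open_Collect_less continuous_intros)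

lemma closure_D: "closure D \<subseteq> {x. x $ k \<ge> 0 \<and> norm x \<ge> 1}"
  by (rule closure_minimal) (auto simp: D_def intro!: closed_Collect_conj closed_Collect_le continuous_intros)

lemma lat_bounds:
  assumes "x $ k \<ge> 0" "norm x \<ge> 1"
  shows "0 \<le> lat x" "lat x \<le> 1" "x \<noteq> 0" "norm x > 0"
proof -
  show n: "norm x > 0" using assms by linarith
  then show "x \<noteq> 0" by auto
  show "0 \<le> lat x" unfolding lat_def using assms n by simp
  have "x $ k \<le> norm x" using component_le_norm_cart[of x k] by linarith
  then show "lat x \<le> 1" unfolding lat_def using n by simp
qed

lemma E_pos: "0 \<le> s \<Longrightarrow> s \<le> 1 \<Longrightarrow> E s > 0"
  unfolding E_def by (simp add: add_pos_nonneg power_le_one)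

lemma lat_deriv: "x \<noteq> 0 \<Longrightarrow> (lat has_derivative (\<lambda>h. dlat x \<bullet> h)) (at x)"
  using latitude_derivative[of x k] unfolding lat_def[abs_def] dlat_def .

lemma E_deriv:
  assumes "c0 < s" "s < 2"
  shows "(E has_real_derivative E' s) (at s)"
  unfolding E_def[abs_def] E'_def using assms
  by (auto intro!: derivative_eq_intros Dm simp: power2_eq_square algebra_simps)

text \<open>The latitude is homogeneous of degree 0, so \<open>dlat\<close> is orthogonal to
  \<open>x\<close>; for the same reason the radial part of \<open>Y\<close> is \<open>x\<close>. The
  norm and the divergence of the flux are computed from these products alone.\<close>

lemma identities:
  assumes "x \<noteq> 0"
  shows "Y x \<bullet> x = (norm x)\<^sup>2" "Y x \<bullet> dlat x = - m (lat x) * (1 - (lat x)\<^sup>2)"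
    "dlat x \<bullet> x = 0" "dlat x $ k = (1 - (lat x)\<^sup>2) / norm x" "(norm (Y x))\<^sup>2 = (norm x)\<^sup>2 * E (lat x)"
proof -
  have n: "norm x > 0" using assms by simp
  have xk: "x $ k = lat x * norm x" unfolding lat_def using n by simp
  have xx: "x \<bullet> x = (norm x)\<^sup>2" by (simp add: power2_norm_eq_inner)
  have ee: "axis k (1::real) \<bullet> axis k 1 = 1" by (simp add: inner_axis)
  have ax: "axis k (1::real) \<bullet> x = lat x * norm x" "x \<bullet> axis k 1 = lat x * norm x"
    using xk by (simp_all add: inner_axis inner_axis')
  show 1: "Y x \<bullet> x = (norm x)\<^sup>2"
    unfolding Y_def by (simp add: inner_diff_left xx ax algebra_simps power2_eq_square)
  show 3: "dlat x \<bullet> x = 0"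
    unfolding dlat_def by (simp add: inner_diff_left xx ax algebra_simps power2_eq_square)
  have de: "dlat x \<bullet> axis k 1 = (1 - (lat x)\<^sup>2) / norm x"
    unfolding dlat_def using n by (simp add: inner_diff_left ee ax power2_eq_square field_simps)
  then show "dlat x $ k = (1 - (lat x)\<^sup>2) / norm x" by (simp add: inner_axis)
  have "Y x \<bullet> dlat x = (1 + m (lat x) * lat x) * (dlat x \<bullet> x) - (m (lat x) * norm x) * (dlat x \<bullet> axis k 1)"
    unfolding inner_commute[of "Y x"] by (simp add: Y_def inner_diff_right)
  then show "Y x \<bullet> dlat x = - m (lat x) * (1 - (lat x)\<^sup>2)" unfolding 3 de using n by simp
  have Ye: "Y x \<bullet> axis k 1 = lat x * norm x - m (lat x) * norm x * (1 - (lat x)\<^sup>2)"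
    unfolding Y_def by (simp add: inner_diff_left ee ax power2_eq_square algebra_simps)
  have "(norm (Y x))\<^sup>2 = Y x \<bullet> Y x" by (simp add: power2_norm_eq_inner)
  also have "\<dots> = (1 + m (lat x) * lat x) * (Y x \<bullet> x) - (m (lat x) * norm x) * (Y x \<bullet> axis k 1)"
    by (subst (2) Y_def) (simp add: inner_diff_right)
  also have "\<dots> = (norm x)\<^sup>2 * E (lat x)" unfolding 1 Ye E_def by (simp add: power2_eq_square algebra_simps)
  finally show "(norm (Y x))\<^sup>2 = (norm x)\<^sup>2 * E (lat x)" .
qed

section \<open>Derivatives and divergence at a point of the domain\<close>

context
  fixes x :: "real^'n"
  assumes x: "x \<in> D"
begin

lemma D_facts: "0 \<le> lat x" "lat x \<le> 1" "x \<noteq> 0" "norm x > 0" "c0 < lat x" "lat x < 2" "E (lat x) > 0"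
  using x lat_bounds[of x] c0 E_pos[of "lat x"] unfolding D_def by auto

lemma ln_norm_deriv: "((\<lambda>x. ln (norm x)) has_derivative (\<lambda>h. (x \<bullet> h) / (norm x)\<^sup>2)) (at x)"
proof -
  have "((\<lambda>x. ln (norm x)) has_derivative (\<lambda>h. (((1 / norm x) *\<^sub>R x) \<bullet> h) * (1 / norm x))) (at x)"
    by (rule DERIV_compose_FDERIV[OF _ has_derivative_norm_inner[OF D_facts(3)]])
      (use DERIV_ln[OF D_facts(4)] in \<open>simp add: inverse_eq_divide\<close>)
  then show ?thesis by (simp add: power2_eq_square)
qed

lemma w_deriv: "(w has_derivative (\<lambda>h. W x \<bullet> h)) (at x)"
proof -
  note f = D_facts
  have 1: "((\<lambda>x. H (lat x)) has_derivative (\<lambda>h. (dlat x \<bullet> h) * (- m (lat x)))) (at x)"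
    by (rule DERIV_compose_FDERIV[OF DH lat_deriv]) (use f in auto)
  have 2: "((\<lambda>x. - \<beta> * (ln (norm x) + H (lat x))) has_derivative
      (\<lambda>h. - \<beta> * ((x \<bullet> h) / (norm x)\<^sup>2 + (dlat x \<bullet> h) * (- m (lat x))))) (at x)"
    by (intro has_derivative_mult_right has_derivative_add ln_norm_deriv 1)
  have 3: "(w has_derivative (\<lambda>h. (- \<beta> * ((x \<bullet> h) / (norm x)\<^sup>2 + (dlat x \<bullet> h) * (- m (lat x)))) * w x)) (at x)"
    unfolding w_def by (rule DERIV_compose_FDERIV[OF DERIV_exp 2])
  have "(- \<beta> * ((x \<bullet> h) / (norm x)\<^sup>2 + (dlat x \<bullet> h) * (- m (lat x)))) * w x = W x \<bullet> h" for h
  proof -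
    have Wh: "W x \<bullet> h = (- \<beta> * w x / (norm x)\<^sup>2) * ((1 + m (lat x) * lat x) * (x \<bullet> h) - m (lat x) * norm x * (axis k 1 \<bullet> h))"
      by (simp add: W_def Y_def inner_diff_left)
    have dh: "dlat x \<bullet> h = (norm x * (axis k 1 \<bullet> h) - lat x * (x \<bullet> h)) / (norm x)\<^sup>2"
      by (simp add: dlat_def inner_diff_left)
    show ?thesis unfolding Wh dh by (simp add: divide_inverse algebra_simps)
  qed
  then show ?thesis using 3 by simp
qed

lemma \<Lambda>_deriv: "(\<Lambda> has_derivative (\<lambda>h. d\<Lambda> x \<bullet> h)) (at x)"
proof -
  note f = D_facts
  have 1: "((\<lambda>x. H (lat x)) has_derivative (\<lambda>h. (dlat x \<bullet> h) * (- m (lat x)))) (at x)"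
    by (rule DERIV_compose_FDERIV[OF DH lat_deriv]) (use f in auto)
  have "((\<lambda>s. ln (E s)) has_real_derivative 1 / E (lat x) * E' (lat x)) (at (lat x))"
    by (rule DERIV_chain2[OF DERIV_ln_divide E_deriv]) (use f in auto)
  then have 2: "((\<lambda>x. ln (E (lat x))) has_derivative (\<lambda>h. (dlat x \<bullet> h) * (1 / E (lat x) * E' (lat x)))) (at x)"
    by (rule DERIV_compose_FDERIV[OF _ lat_deriv[OF f(3)]])
  have "(\<Lambda> has_derivative (\<lambda>h. - \<beta> * (p - 1) * ((dlat x \<bullet> h) * (- m (lat x)))
      + (p - 2) / 2 * ((dlat x \<bullet> h) * (1 / E (lat x) * E' (lat x))) - (\<beta> * (p - 1) + p) * ((x \<bullet> h) / (norm x)\<^sup>2))) (at x)"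
    unfolding \<Lambda>_def[abs_def]
    by (intro has_derivative_diff has_derivative_add has_derivative_mult_right ln_norm_deriv 1 2)
  then show ?thesis unfolding d\<Lambda>_def by (simp add: inner_diff_left algebra_simps)
qed

lemma Y_deriv: "((\<lambda>x. Y x $ i) has_derivative (\<lambda>h. dY i x \<bullet> h)) (at x)"
proof -
  note f = D_facts
  have mm: "((\<lambda>x. m (lat x)) has_derivative (\<lambda>h. (dlat x \<bullet> h) * m' (lat x))) (at x)"
    by (rule DERIV_compose_FDERIV[OF Dm lat_deriv]) (use f in auto)
  have k: "((\<lambda>x::real^'n. x $ i) has_derivative (\<lambda>h. h $ i)) (at x)"
    by (rule bounded_linear.has_derivative[OF bounded_linear_vec_nth]) (rule has_derivative_ident)
  have 1: "((\<lambda>x. (1 + m (lat x) * lat x) * x $ i) has_derivative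
     (\<lambda>h. (1 + m (lat x) * lat x) * h $ i + (0 + (m (lat x) * (dlat x \<bullet> h) + (dlat x \<bullet> h) * m' (lat x) * lat x)) * x $ i)) (at x)"
    by (intro has_derivative_mult has_derivative_add has_derivative_const mm lat_deriv f k)
  have 2: "((\<lambda>x. (m (lat x) * norm x) * (axis k 1 $ i)) has_derivative
     (\<lambda>h. (m (lat x) * (((1 / norm x) *\<^sub>R x) \<bullet> h) + (dlat x \<bullet> h) * m' (lat x) * norm x) * (axis k 1 $ i))) (at x)"
    by (intro has_derivative_mult_left has_derivative_mult mm has_derivative_norm_inner f)
  have "((\<lambda>x. Y x $ i) has_derivative
     (\<lambda>h. (1 + m (lat x) * lat x) * h $ i + (0 + (m (lat x) * (dlat x \<bullet> h) + (dlat x \<bullet> h) * m' (lat x) * lat x)) * x $ i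
       - (m (lat x) * (((1 / norm x) *\<^sub>R x) \<bullet> h) + (dlat x \<bullet> h) * m' (lat x) * norm x) * (axis k 1 $ i))) (at x)"
    using has_derivative_diff[OF 1 2] unfolding Y_def by simp
  moreover have "(1 + m (lat x) * lat x) * h $ i + (0 + (m (lat x) * (dlat x \<bullet> h) + (dlat x \<bullet> h) * m' (lat x) * lat x)) * x $ i
       - (m (lat x) * (((1 / norm x) *\<^sub>R x) \<bullet> h) + (dlat x \<bullet> h) * m' (lat x) * norm x) * (axis k 1 $ i) = dY i x \<bullet> h" for h
    unfolding dY_def by (simp add: inner_diff_left inner_add_left inner_axis' algebra_simps)
  ultimately show ?thesis by simp
qed

lemma norm_W: "norm (W x) = \<beta> * w x / norm x * sqrt (E (lat x))"
proof -
  note f = D_facts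
  have "(norm (Y x))\<^sup>2 = (norm x * sqrt (E (lat x)))\<^sup>2"
    using identities(5)[OF f(3)] f(7) by (simp add: power_mult_distrib)
  then have "norm (Y x) = norm x * sqrt (E (lat x))" using f(7) by (simp add: power2_eq_iff_nonneg)
  then show ?thesis unfolding W_def using \<beta>0 f(4) by (simp add: w_def power2_eq_square abs_mult)
qed

text \<open>All scalar factors are positive, so they are compared through their logarithms, which
  add up to \<open>(p - 1) ln \<beta> + \<Lambda>\<close>.\<close>

lemma flux_eq: "(norm (W x) powr (p - 2)) *\<^sub>R W x = (- (\<beta> powr (p - 1) * exp (\<Lambda> x))) *\<^sub>R Y x"
proof -
  note f = D_facts
  define r where "r = norm x"
  have r: "r > 0" unfolding r_def using f(4) .
  have nW: "norm (W x) = \<beta> * w x / r * sqrt (E (lat x))" unfolding r_def by (rule norm_W)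
  have "ln (norm (W x)) = ln \<beta> - \<beta> * (ln r + H (lat x)) - ln r + ln (E (lat x)) / 2"
    unfolding nW using \<beta>0 r f(7) by (simp add: w_def ln_mult ln_div ln_sqrt r_def)
  moreover have "norm (W x) > 0" unfolding nW using \<beta>0 r f(7) by (simp add: w_def)
  ultimately have a: "norm (W x) powr (p - 2) = exp ((p - 2) * (ln \<beta> - \<beta> * (ln r + H (lat x)) - ln r + ln (E (lat x)) / 2))"
    by (simp add: powr_def)
  have b: "\<beta> * w x / r\<^sup>2 = exp (ln \<beta> - \<beta> * (ln r + H (lat x)) - 2 * ln r)"
  proof -
    have "exp (2 * ln r) = r\<^sup>2" using r exp_of_nat_mult[of 2 "ln r"] by simp
    moreover have "ln \<beta> - \<beta> * (ln r + H (lat x)) - 2 * ln r = (ln \<beta> + - \<beta> * (ln r + H (lat x))) - 2 * ln r" by simp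
    ultimately show ?thesis using \<beta>0 unfolding w_def r_def by (simp only: exp_diff exp_add exp_ln)
  qed
  have "norm (W x) powr (p - 2) * (\<beta> * w x / r\<^sup>2) = exp ((p - 1) * ln \<beta> + \<Lambda> x)"
    unfolding a b unfolding exp_add[symmetric] \<Lambda>_def r_def by (rule arg_cong[where f = exp]) (simp add: algebra_simps)
  also have "\<dots> = \<beta> powr (p - 1) * exp (\<Lambda> x)" using \<beta>0 by (simp add: powr_def exp_add)
  finally show ?thesis unfolding W_def r_def by simp
qed

text \<open>The divergence of \<open>exp \<Lambda> Y\<close> is \<open>exp \<Lambda>\<close> times
  the sum of \<open>Y \<bullet> d\<Lambda>\<close> and the divergence of \<open>Y\<close>. All
  powers of \<open>r\<close> cancel in this sum, so it depends on the latitude alone, and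
  \<open>flux_divergence_pos\<close> shows it to be positive.\<close>

lemma divergence_pos: "- (\<Sum>i\<in>UNIV. dX i x $ i) > 0"
proof -
  note f = D_facts
  define s where "s = lat x"
  have sd: "(\<Sum>i\<in>UNIV. Y x $ i * d\<Lambda> x $ i) = - m s * (1 - s\<^sup>2) * (\<beta> * (p - 1) * m s + (p - 2) / 2 * (E' s / E s)) - (\<beta> * (p - 1) + p)"
  proof -
    have "(\<Sum>i\<in>UNIV. Y x $ i * d\<Lambda> x $ i) = Y x \<bullet> d\<Lambda> x" by (simp add: inner_vec_def)
    also have "\<dots> = (\<beta> * (p - 1) * m s + (p - 2) / 2 * (E' s / E s)) * (Y x \<bullet> dlat x) - (\<beta> * (p - 1) + p) / (norm x)\<^sup>2 * (Y x \<bullet> x)"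
      unfolding d\<Lambda>_def s_def by (simp add: inner_diff_right)
    finally show ?thesis unfolding identities(1,2)[OF f(3)] s_def using f(4) by simp
  qed
  have sY: "(\<Sum>i\<in>UNIV. dY i x $ i) = real CARD('n) * (1 + m s * s) - m' s * (1 - s\<^sup>2) - m s * s"
  proof -
    have "dY i x $ i = (1 + m s * s) + (m' s * s + m s) * (dlat x $ i * x $ i)
        - (if i = k then m' s * norm x * dlat x $ k + m s / norm x * x $ k else 0)" for i
      unfolding dY_def s_def by (auto simp: axis_def)
    then have "(\<Sum>i\<in>UNIV. dY i x $ i) = real CARD('n) * (1 + m s * s) + (m' s * s + m s) * (dlat x \<bullet> x)
        - (m' s * norm x * dlat x $ k + m s / norm x * x $ k)"
      by (simp add: sum.distrib sum_subtractf inner_vec_def flip: sum_distrib_left)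
    moreover have "m s / norm x * x $ k = m s * s" unfolding s_def lat_def by simp
    moreover have "m' s * norm x * dlat x $ k = m' s * (1 - s\<^sup>2)"
      unfolding identities(4)[OF f(3)] s_def using f(4) by simp
    ultimately show ?thesis unfolding identities(3)[OF f(3)] by simp
  qed
  have T: "(\<Sum>i\<in>UNIV. Y x $ i * d\<Lambda> x $ i) + (\<Sum>i\<in>UNIV. dY i x $ i) > 0"
  proof -
    have "real CARD('n) * (1 + m s * s) - m' s * (1 - s\<^sup>2) - m s * s - (\<beta> * (p - 1) + p)
      - m s * (1 - s\<^sup>2) * (\<beta> * (p - 1) * m s + (p - 2) / 2 * ((- 2 * s * (m s)\<^sup>2 + 2 * (1 - s\<^sup>2) * m s * m' s) / (1 + (1 - s\<^sup>2) * (m s)\<^sup>2))) > 0"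
      by (rule flux_divergence_pos[OF _ mpos _ _ refl ineq]) (use card2 f s_def in auto)
    then show ?thesis unfolding sd sY E_def E'_def by simp
  qed
  have "- (\<Sum>i\<in>UNIV. dX i x $ i) = \<beta> powr (p - 1) * exp (\<Lambda> x) * ((\<Sum>i\<in>UNIV. Y x $ i * d\<Lambda> x $ i) + (\<Sum>i\<in>UNIV. dY i x $ i))"
  proof -
    have "dX i x $ i = - (\<beta> powr (p - 1) * exp (\<Lambda> x)) * (Y x $ i * d\<Lambda> x $ i + dY i x $ i)" for i
      unfolding dX_def by simp
    then show ?thesis by (simp add: sum.distrib sum_negf flip: sum_distrib_left)
  qed
  then show ?thesis using T \<beta>0 by simp
qed

lemma flux_deriv: "((\<lambda>x. ((- (\<beta> powr (p - 1) * exp (\<Lambda> x))) *\<^sub>R Y x) $ i) has_derivative (\<lambda>h. dX i x \<bullet> h)) (at x)"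
proof -
  have "((\<lambda>x. exp (\<Lambda> x)) has_derivative (\<lambda>h. (d\<Lambda> x \<bullet> h) * exp (\<Lambda> x))) (at x)"
    by (rule DERIV_compose_FDERIV[OF DERIV_exp \<Lambda>_deriv])
  from has_derivative_mult_right[OF has_derivative_mult[OF this Y_deriv], of "- (\<beta> powr (p - 1))" i]
  show ?thesis unfolding dX_def by (simp add: inner_add_left algebra_simps)
qed

end

section \<open>Continuity on a closed set that contains the domain and its boundary\<close>

definition S :: "(real^'n) set" where "S = {x. x $ k \<ge> 0 \<and> norm x \<ge> 1}"

lemma D_subset_S: "D \<subseteq> S" and closure_D_subset_S: "closure D \<subseteq> S"
  using closure_D closure_subset[of D] unfolding S_def by auto

lemma continuous_lat: "continuous_on S lat"
  unfolding lat_def[abs_def] S_def by (intro continuous_intros) auto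

lemma continuous_on_lat_compose:
  assumes "continuous_on {c0<..<2} g" shows "continuous_on S (\<lambda>x. g (lat x))"
proof (rule continuous_on_compose2[OF assms continuous_lat])
  show "lat ` S \<subseteq> {c0<..<2}" using lat_bounds(1,2) c0 unfolding S_def by force
qed

lemma continuous_profile:
  "continuous_on {c0<..<2} H" "continuous_on {c0<..<2} m" "continuous_on {c0<..<2} E" "continuous_on {c0<..<2} E'"
proof -
  show H: "continuous_on {c0<..<2} H" using DH by (intro continuous_at_imp_continuous_on ballI DERIV_isCont) auto
  show m: "continuous_on {c0<..<2} m" using Dm by (intro continuous_at_imp_continuous_on ballI DERIV_isCont) auto
  show "continuous_on {c0<..<2} E" unfolding E_def[abs_def] by (intro continuous_intros m)
  show "continuous_on {c0<..<2} E'" unfolding E'_def[abs_def] by (intro continuous_intros m cm')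
qed

lemmas continuous_profile_lat =
  continuous_profile[THEN continuous_on_lat_compose] cm'[THEN continuous_on_lat_compose]

lemma S_nonzero: "x \<in> S \<Longrightarrow> norm x \<noteq> 0" "x \<in> S \<Longrightarrow> x \<noteq> 0" "x \<in> S \<Longrightarrow> E (lat x) \<noteq> 0"
  using lat_bounds[of x] E_pos[of "lat x"] unfolding S_def by auto

lemma continuous_fields:
  "continuous_on S w" "continuous_on S W" "continuous_on S (dX i)"
proof -
  show w: "continuous_on S w"
    unfolding w_def[abs_def] by (intro continuous_intros continuous_profile_lat) (use S_nonzero in auto)
  have Y: "continuous_on S Y"
    unfolding Y_def[abs_def] by (intro continuous_intros continuous_profile_lat continuous_lat)
  have dlat: "continuous_on S dlat"
    unfolding dlat_def[abs_def] by (intro continuous_intros continuous_lat) (use S_nonzero in auto)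
  show "continuous_on S W"
    unfolding W_def[abs_def] by (intro continuous_intros w Y) (use S_nonzero in auto)
  have L: "continuous_on S \<Lambda>"
    unfolding \<Lambda>_def[abs_def] by (intro continuous_intros continuous_profile_lat) (use S_nonzero in auto)
  have dL: "continuous_on S d\<Lambda>"
    unfolding d\<Lambda>_def[abs_def] by (intro continuous_intros continuous_profile_lat dlat) (use S_nonzero in auto)
  have dY: "continuous_on S (dY i)"
    unfolding dY_def[abs_def] by (intro continuous_intros continuous_profile_lat continuous_lat dlat) (use S_nonzero in auto)
  show "continuous_on S (dX i)"
    unfolding dX_def[abs_def] by (intro continuous_intros L dL dY Y)
qed

text \<open>Outside the unit ball \<open>ln r \<ge> 0\<close>, so
  \<open>|W| |x| = \<beta> w sqrt E\<close> is at most a function of the latitude alone, which is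
  continuous on the compact interval from 0 to 1.\<close>

lemma W_growth: obtains C where "C \<ge> 0" "\<And>x. x \<in> D \<Longrightarrow> norm (W x) * norm x \<le> C"
proof -
  have sub: "{0..1} \<subseteq> {c0<..<2}" using c0 by auto
  have "continuous_on {0..1} (\<lambda>s. \<beta> * exp (- \<beta> * H s) * sqrt (E s))"
    by (intro continuous_intros continuous_on_subset[OF continuous_profile(1) sub] continuous_on_subset[OF continuous_profile(3) sub])
  then have "\<exists>t\<in>{0..1}. \<forall>s\<in>{0..1}. \<beta> * exp (- \<beta> * H s) * sqrt (E s) \<le> \<beta> * exp (- \<beta> * H t) * sqrt (E t)"
    by (intro continuous_attains_sup) auto
  then obtain t where t: "\<And>s. s \<in> {0..1} \<Longrightarrow> \<beta> * exp (- \<beta> * H s) * sqrt (E s) \<le> \<beta> * exp (- \<beta> * H t) * sqrt (E t)" "t \<in> {0..1}"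
    by blast
  show ?thesis
  proof (rule that)
    show "\<beta> * exp (- \<beta> * H t) * sqrt (E t) \<ge> 0" using \<beta>0 E_pos[of t] t(2) by simp
    fix x assume x: "x \<in> D"
    note f = D_facts[OF x]
    have "ln (norm x) \<ge> 0" using x unfolding D_def by simp
    then have "w x \<le> exp (- \<beta> * H (lat x))" unfolding w_def using \<beta>0 by (simp add: distrib_left)
    then have "\<beta> * w x * sqrt (E (lat x)) \<le> \<beta> * exp (- \<beta> * H (lat x)) * sqrt (E (lat x))"
      using \<beta>0 f(7) by (intro mult_right_mono mult_left_mono) auto
    also have "\<dots> \<le> \<beta> * exp (- \<beta> * H t) * sqrt (E t)" using t(1) f by simp
    finally show "norm (W x) * norm x \<le> \<beta> * exp (- \<beta> * H t) * sqrt (E t)"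
      unfolding norm_W[OF x] using f(4) by simp
  qed
qed

text \<open>The domain omits the unit ball and hence both point masses. On the flat part of its
  boundary \<open>u = 0 < w\<close>; on the spherical part \<open>w > 1 \<ge> u\<close>.\<close>

lemma solution_le_supersolution:
  fixes u :: "real^'n \<Rightarrow> real"
  assumes p: "p > real CARD('n)" and u: "grad_Lp p u"
    and eq: "\<And>\<phi>. test_function \<phi> \<Longrightarrow> neg_p_laplacian p u \<phi> = c * (\<phi> (axis k 1) - \<phi> (- axis k 1))"
    and bound: "\<And>x. \<bar>u x\<bar> \<le> 1" and zero: "\<And>x. x $ k = 0 \<Longrightarrow> u x = 0"
    and x0: "x0 \<in> D"
  shows "u x0 \<le> w x0"
proof -
  have p2': "p \<ge> 2" using p2 by simp
  have weak: "has_weak_partial i u (\<lambda>x. weak_gradient u x $ i)" "in_Lp p (\<lambda>x. weak_gradient u x $ i)" for i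
  proof -
    have ex: "\<exists>g. has_weak_partial i u g" and Lp: "in_Lp p (weak_partial i u)" using u unfolding grad_Lp_def by auto
    from someI_ex[OF ex] have "has_weak_partial i u (weak_partial i u)" unfolding weak_partial_def .
    with Lp show "has_weak_partial i u (\<lambda>x. weak_gradient u x $ i)" "in_Lp p (\<lambda>x. weak_gradient u x $ i)"
      unfolding weak_gradient_def by simp_all
  qed
  have ax: "axis k 1 \<notin> D" "- axis k 1 \<notin> D" unfolding D_def by (auto simp: norm_axis_1)
  have equ: "(LINT x|lborel. ((norm (weak_gradient u x) powr (p - 2)) *\<^sub>R weak_gradient u x) \<bullet> gradient \<psi> x) = 0"
    if \<psi>: "C_k (Suc 0) \<psi>" and K: "compact K" "K \<subseteq> D" "\<And>x. x \<notin> K \<Longrightarrow> \<psi> x = 0" for \<psi> K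
  proof (rule weak_equation_C1[OF flux_locally_integrable[OF p2' weak(2)] open_D _ \<psi> K])
    fix \<phi> L assume \<phi>: "test_function \<phi>" "compact L" "L \<subseteq> D" "\<And>x. x \<notin> L \<Longrightarrow> \<phi> x = 0"
    have "\<phi> (axis k 1) = 0" "\<phi> (- axis k 1) = 0" using \<phi>(3,4) ax by auto
    then show "(LINT x|lborel. ((norm (weak_gradient u x) powr (p - 2)) *\<^sub>R weak_gradient u x) \<bullet> gradient \<phi> x) = 0"
      using eq[OF \<phi>(1)] unfolding neg_p_laplacian_def by simp
  qed
  obtain C where C: "C \<ge> 0" "\<And>x. x \<in> D \<Longrightarrow> norm (W x) * norm x \<le> C" using W_growth by blast
  have eqw: "(LINT x|lborel. ((norm (W x) powr (p - 2)) *\<^sub>R W x) \<bullet> gradient \<psi> x) = (LINT x|lborel. - (\<Sum>i\<in>UNIV. dX i x $ i) * \<psi> x)"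
    if \<psi>: "C_k (Suc 0) \<psi>" and K: "compact K" "K \<subseteq> D" "\<And>x. x \<notin> K \<Longrightarrow> \<psi> x = 0" for \<psi> K
  proof -
    have "((norm (W x) powr (p - 2)) *\<^sub>R W x) \<bullet> gradient \<psi> x = ((- (\<beta> powr (p - 1) * exp (\<Lambda> x))) *\<^sub>R Y x) \<bullet> gradient \<psi> x" for x
    proof (cases "x \<in> D")
      case True
      then show ?thesis by (simp only: flux_eq)
    next
      case False
      then have "x \<notin> K" using K(2) by blast
      then have "gradient \<psi> x = 0"
        unfolding vec_eq_iff gradient_nth using partial_zero_outside[where f = \<psi> and x = x, OF K(1,3)] by simp
      then show ?thesis by simp
    qed
    then have "(LINT x|lborel. ((norm (W x) powr (p - 2)) *\<^sub>R W x) \<bullet> gradient \<psi> x)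
        = (LINT x|lborel. ((- (\<beta> powr (p - 1) * exp (\<Lambda> x))) *\<^sub>R Y x) \<bullet> gradient \<psi> x)" by (simp only:)
    also have "\<dots> = (LINT x|lborel. - (\<Sum>i\<in>UNIV. dX i x $ i) * \<psi> x)"
      by (rule divergence_identity[OF open_D flux_deriv continuous_on_subset[OF continuous_fields(3) D_subset_S] \<psi> K])
    finally show ?thesis .
  qed
  show ?thesis
  proof (rule comparison_principle[OF p2' p _ bound weak equ open_D _ w_deriv _ _ _ eqw _ _ C x0])
    show "continuous_on UNIV u" using u unfolding grad_Lp_def by blast
    show "0 \<le> w x" for x unfolding w_def by simp
    show "continuous_on D W" by (rule continuous_on_subset[OF continuous_fields(2) D_subset_S])
    show "continuous_on (closure D) w" by (rule continuous_on_subset[OF continuous_fields(1) closure_D_subset_S])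
    show "continuous_on D (\<lambda>x. - (\<Sum>i\<in>UNIV. dX i x $ i))"
      by (intro continuous_intros continuous_on_subset[OF continuous_fields(3) D_subset_S])
    show "0 < - (\<Sum>i\<in>UNIV. dX i x $ i)" if "x \<in> D" for x by (rule divergence_pos[OF that])
    fix x assume x: "x \<in> closure D" "x \<notin> D"
    then have S: "x $ k \<ge> 0" "norm x \<ge> 1" using closure_D_subset_S unfolding S_def by auto
    show "u x < w x"
    proof (cases "x $ k = 0")
      case True
      then show ?thesis using zero[of x] by (simp add: w_def)
    next
      case False
      then have n1: "norm x = 1" using x(2) S unfolding D_def by auto
      have "\<beta> * H (lat x) < 0" using H1[of "lat x"] lat_bounds(1,2)[OF S] \<beta>0 by (simp add: mult_pos_neg)
      then have "w x > 1" unfolding w_def n1 by simp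
      then show ?thesis using bound[of x] by linarith
    qed
  qed
qed

end

section \<open>Reflection and the decay estimate\<close>

lemma reflect_fixed: "x $ k = 0 \<Longrightarrow> reflect k x = x"
  unfolding reflect_def vec_eq_iff by auto

lemma norm_reflect: "norm (reflect k x) = norm x"
  unfolding norm_vec_def reflect_def L2_set_def by (auto intro!: arg_cong[where f = sqrt] sum.cong)

theorem theorem1p1:
  fixes p \<beta> :: real
  assumes "CARD('n::finite) \<ge> 2"
    and "p > real CARD('n)"
    and "\<beta> < - 1/3 + 2 / (3 * (p - 1)) + sqrt ((- 1/3 + 2 / (3 * (p - 1)))\<^sup>2 + 1/3)"
  shows "\<exists>C\<^sub>1 :: real. \<forall>(m :: 'n) (u :: real^'n \<Rightarrow> real).
    morrey_extremal p u \<and>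
    (\<exists>c>0. \<forall>\<phi>. test_function \<phi> \<longrightarrow>
        neg_p_laplacian p u \<phi> = c * (\<phi> (axis m 1) - \<phi> (- axis m 1))) \<and>
    (\<forall>x. \<bar>u x\<bar> \<le> 1) \<and> u (axis m 1) = 1 \<and> u (- axis m 1) = - 1 \<and>
    (\<forall>x. u (reflect m x) = - u x) \<and>
    (\<forall>x. x $ m > 0 \<longrightarrow> u x > 0)
    \<longrightarrow> (\<forall>x. norm x \<ge> 1 \<longrightarrow> \<bar>u x\<bar> \<le> C\<^sub>1 * norm x powr (- \<beta>))"
proof (cases "\<beta> > 0")
  \<comment> \<open>For \<open>\<beta> \<le> 0\<close> the power of the norm is at least 1 outside
    the unit ball, and the bound on \<open>u\<close> suffices.\<close>
  case False
  show ?thesis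
  proof (intro exI[of _ 1] allI impI, elim conjE)
    fix m :: 'n and u :: "real^'n \<Rightarrow> real" and x :: "real^'n"
    assume u: "\<forall>x. \<bar>u x\<bar> \<le> 1" and x: "norm x \<ge> 1"
    have "norm x powr (- \<beta>) \<ge> 1" using x False by (intro ge_one_powr_ge_zero) auto
    then show "\<bar>u x\<bar> \<le> 1 * norm x powr (- \<beta>)" using u[rule_format, of x] by linarith
  qed
next
  case True
  have p2: "p > 2" using assms(1,2) by linarith
  obtain c0 :: real and H m m' :: "real \<Rightarrow> real" where prof: "c0 < 0"
    "\<And>s. c0 < s \<Longrightarrow> s < 2 \<Longrightarrow> (H has_real_derivative - m s) (at s)"
    "\<And>s. c0 < s \<Longrightarrow> s < 2 \<Longrightarrow> (m has_real_derivative m' s) (at s)"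
    "continuous_on {c0<..<2} m'"
    "\<And>s. 0 \<le> s \<Longrightarrow> s \<le> 1 \<Longrightarrow> m s > 0"
    "\<And>s. 0 \<le> s \<Longrightarrow> s \<le> 1 \<Longrightarrow> H s \<le> -1"
    "\<And>s. 0 \<le> s \<Longrightarrow> s \<le> 1 \<Longrightarrow>
      (1 + (p - 1) * ((1 - s\<^sup>2) * (m s)\<^sup>2)) * (s * m s - (1 - s\<^sup>2) * m' s) - (p - 2) * (1 + (1 - s\<^sup>2) * (m s)\<^sup>2)
      > \<beta> * (p - 1) * (1 + (1 - s\<^sup>2) * (m s)\<^sup>2)\<^sup>2"
    by (rule profile_exists[OF p2 True assms(3)]) blast
  \<comment> \<open>Established before the axis and \<open>u\<close> are fixed, so that the constant
    cannot depend on them.\<close>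
  have prof_loc: "halfspace_profile TYPE('n) p \<beta> c0 H m m'"
    by unfold_locales (fact assms(1) p2 True prof)+
  have cH: "continuous_on {0..1} (\<lambda>s. exp (- \<beta> * H s))"
    by (intro continuous_intros continuous_at_imp_continuous_on ballI DERIV_isCont[OF prof(2)]) (use prof(1) in auto)
  obtain t where t: "t \<in> {0..1}" "\<And>s. s \<in> {0..1} \<Longrightarrow> exp (- \<beta> * H s) \<le> exp (- \<beta> * H t)"
    using continuous_attains_sup[OF _ _ cH] by auto
  \<comment> \<open>The largest angular factor of \<open>w\<close>, serving as
    \<open>C\<^sub>1\<close>. It is at least 1 because \<open>H \<le> -1\<close>, which takes care
    of the points of norm 1, where the comparison in \<open>D\<close> says nothing.\<close>
  define M where "M = exp (- \<beta> * H t)"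
  have M1: "M \<ge> 1" unfolding M_def using prof(6)[of t] t(1) True by (simp add: mult_le_0_iff)
  show ?thesis
  proof (intro exI[of _ M] allI impI, elim conjE exE)
    fix k :: 'n and u :: "real^'n \<Rightarrow> real" and x :: "real^'n" and c :: real
    assume ext: "morrey_extremal p u"
      and eq: "\<forall>\<phi>. test_function \<phi> \<longrightarrow> neg_p_laplacian p u \<phi> = c * (\<phi> (axis k 1) - \<phi> (- axis k 1))"
      and bound: "\<forall>x. \<bar>u x\<bar> \<le> 1"
      and anti: "\<forall>x. u (reflect k x) = - u x" and pos: "\<forall>x. x $ k > 0 \<longrightarrow> u x > 0"
      and x: "norm x \<ge> 1"
    interpret halfspace_profile p \<beta> c0 H m m' k by (rule prof_loc)
    have gL: "grad_Lp p u" using ext unfolding morrey_extremal_def by blast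
    have zero: "u y = 0" if "y $ k = 0" for y using anti[rule_format, of y] reflect_fixed[OF that] by simp
    have upper: "\<bar>u y\<bar> \<le> M * norm y powr (- \<beta>)" if y: "norm y \<ge> 1" "y $ k > 0" for y
    proof (cases "norm y = 1")
      case True
      then show ?thesis using bound[rule_format, of y] M1 by simp
    next
      case False
      then have yD: "y \<in> D" unfolding D_def using y by simp
      have "u y \<le> w y"
        using solution_le_supersolution[OF assms(2) gL, of c y] eq bound zero yD by blast
      also have "w y = norm y powr (- \<beta>) * exp (- \<beta> * H (lat y))"
        unfolding w_def powr_def using D_facts(3)[OF yD] by (simp add: distrib_left flip: exp_add)
      also have "\<dots> \<le> norm y powr (- \<beta>) * M"
        unfolding M_def using t(2)[of "lat y"] D_facts(1,2)[OF yD] by (intro mult_left_mono) auto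
      finally show ?thesis using pos[rule_format, OF y(2)] by (simp add: mult.commute)
    qed
    consider "x $ k > 0" | "x $ k = 0" | "x $ k < 0" by linarith
    then show "\<bar>u x\<bar> \<le> M * norm x powr (- \<beta>)"
    proof cases
      case 1
      then show ?thesis using upper x by blast
    next
      case 2
      then show ?thesis using zero M1 by simp
    next
      case 3
      then have "reflect k x $ k > 0" by (simp add: reflect_def)
      then have "\<bar>u (reflect k x)\<bar> \<le> M * norm (reflect k x) powr (- \<beta>)" using upper[of "reflect k x"] x norm_reflect[of k x] by simp
      then show ?thesis using anti norm_reflect[of k x] by simp
    qed
  qed
qed

end
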